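(* Let $\kappa:[0,1]^2\to[0,1]$ be a graphon (symmetric Lebesgue measurable function) and let $F$ be a fixed simple graph with $v(F)=k$ nodes. Let $T_F^{\mathrm{inj}}$ and $T_F^{\mathrm{ind}}$ be the injective and induced subgraph counts of $F$ in the $\kappa$-random graph $\mathbb G(n,\kappa)$, $n\ge k$, and set $\sigma_1^{\mathrm{inj}}=\|f_1^{\mathrm{inj}}(X_1)-\mathbb E\{f_1^{\mathrm{inj}}(X_1)\}\|_2$ and $\sigma_1^{\mathrm{ind}}=\|f_1^{\mathrm{ind}}(X_1)-\mathbb E\{f_1^{\mathrm{ind}}(X_1)\}\|_2$. If $\sigma_1^{\mathrm{inj}}>0$, then there is a constant $C>0$ not depending on $n$ such that $$\sup_{z\in\mathbb R}\left|\mathbb P\left[\frac{\sqrt n}{k\sigma_1^{\mathrm{inj}}}\binom nk^{-1}\bigl(T_F^{\mathrm{inj}}-\mathbb E\{T_F^{\mathrm{inj}}\}\bigr)\le z\right]-\Phi(z)\right|\le Cn^{-1/2}.$$ If $\sigma_1^{\mathrm{ind}}>0$, then there is a constant $C>0$ not depending on $n$ such that $$\sup_{z\in\mathbb R}\left|\mathbb P\left[\frac{\sqrt n}{k\sigma_1^{\mathrm{ind}}}\binom nk^{-1}\bigl(T_F^{\mathrm{ind}}-\mathbb E\{T_F^{\mathrm{ind}}\}\bigr)\le z\right]-\Phi(z)\right|\le Cn^{-1/2}.$$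
   Context: Let $X_1,\dots,X_n$ and $Y_{i,j}$, $1\le i<j\le n$, be independent uniform random variables on $[0,1]$, and $\xi_{i,j}=\xi_{j,i}=\mathbf 1\{Y_{i,j}\le\kappa(X_i,X_j)\}$; $\mathbb G(n,\kappa)$ is the random graph on $\{1,\dots,n\}$ with adjacency indicators $\xi_{i,j}$. For $x=(x_{i,j})_{1\le i<j\le k}$ define $$\phi_F^{\mathrm{inj}}(x)=\sum_{H:H\cong F}\ \prod_{(i,j)\in E(H)}x_{i,j},\qquad \phi_F^{\mathrm{ind}}(x)=\sum_{H:H\cong F}\ \prod_{(i,j)\in E(H)}x_{i,j}\prod_{(i,j)\notin E(H)}(1-x_{i,j}),$$ where $H$ ranges over the $k!/|\mathrm{Aut}(F)|$ graphs on node set $\{1,\dots,k\}$ isomorphic to $F$, and products are over pairs $i<j$ in $\{1,\dots,k\}$. Then $$T_F^{\mathrm{inj}}=\sum_{1\le\alpha(1)<\dots<\alpha(k)\le n}\phi_F^{\mathrm{inj}}\bigl((\xi_{\alpha(i),\alpha(j)})_{1\le i<j\le k}\bigr),$$ and $T_F^{\mathrm{ind}}$ is defined in the same way with $\phi_F^{\mathrm{ind}}$. Further, $$f_1^{\mathrm{inj}}(x)=\sum_{H\cong F}\mathbb E\Bigl\{\prod_{(i,j)\in E(H)}\kappa(X_i,X_j)\Bigm|X_1=x\Bigr\},$$ $$f_1^{\mathrm{ind}}(x)=\sum_{H\cong F}\mathbb E\Bigl\{\prod_{(i,j)\in E(H)}\kappa(X_i,X_j)\prod_{(i,j)\notin E(H)}(1-\kappa(X_i,X_j))\Bigm|X_1=x\Bigr\}.$$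 $\|Z\|_2=(\mathbb E Z^2)^{1/2}$; $\Phi$ is the standard normal distribution function. The constants may depend on $F$ and $\kappa$. *)

theory Defs
  imports
    "HOL-Probability.Probability"
    "Graph_Theory.Pair_Digraph"
    "Graph_Theory.Digraph_Isomorphism"
begin

text \<open>
  Finite simple graphs are rendered by the locale \<^locale>\<open>pair_graph\<close>: an edge is a symmetric
  pair of arcs without loops. A product over edges runs over the pairs \<open>(i, j)\<close> with \<open>i < j\<close>, so
  that each edge is counted once.
\<close>

definition graphon :: "(real \<times> real \<Rightarrow> real) \<Rightarrow> bool" where
  "graphon \<kappa> \<longleftrightarrow>
     \<kappa> \<in> borel_measurable (lebesgue_on ({0..1} \<times> {0..1})) \<and>
     (\<forall>x\<in>{0..1}. \<forall>y\<in>{0..1}. \<kappa> (x, y) \<in> {0..1} \<and> \<kappa> (x, y) = \<kappa> (y, x))"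

definition num_nodes :: "'v pair_pre_digraph \<Rightarrow> nat" where
  "num_nodes F = card (pverts F)"

definition copies :: "'v pair_pre_digraph \<Rightarrow> nat pair_pre_digraph set" where
  "copies F = {H. pair_graph H \<and> pverts H = {1..num_nodes F} \<and>
                  digraph_iso (with_proj H) (with_proj F)}"

definition edge_pairs :: "nat pair_pre_digraph \<Rightarrow> (nat \<times> nat) set" where
  "edge_pairs H = {(i, j). i \<in> pverts H \<and> j \<in> pverts H \<and> i < j \<and> (i, j) \<in> parcs H}"

definition nonedge_pairs :: "nat pair_pre_digraph \<Rightarrow> (nat \<times> nat) set" where
  "nonedge_pairs H = {(i, j). i \<in> pverts H \<and> j \<in> pverts H \<and> i < j \<and> (i, j) \<notin> parcs H}"

definition phi_inj :: "'v pair_pre_digraph \<Rightarrow> (nat \<Rightarrow> nat \<Rightarrow> real) \<Rightarrow> real" where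
  "phi_inj F x = (\<Sum>H\<in>copies F. \<Prod>(i, j)\<in>edge_pairs H. x i j)"

definition phi_ind :: "'v pair_pre_digraph \<Rightarrow> (nat \<Rightarrow> nat \<Rightarrow> real) \<Rightarrow> real" where
  "phi_ind F x = (\<Sum>H\<in>copies F. (\<Prod>(i, j)\<in>edge_pairs H. x i j) *
                                 (\<Prod>(i, j)\<in>nonedge_pairs H. 1 - x i j))"

definition increasing_maps :: "nat \<Rightarrow> nat \<Rightarrow> (nat \<Rightarrow> nat) set" where
  "increasing_maps k n = {\<alpha> \<in> {1..k} \<rightarrow>\<^sub>E {1..n}. strict_mono_on {1..k} \<alpha>}"

definition T_inj :: "'v pair_pre_digraph \<Rightarrow> nat \<Rightarrow> (nat \<Rightarrow> nat \<Rightarrow> real) \<Rightarrow> real" where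
  "T_inj F n \<xi> = (\<Sum>\<alpha>\<in>increasing_maps (num_nodes F) n. phi_inj F (\<lambda>i j. \<xi> (\<alpha> i) (\<alpha> j)))"

definition T_ind :: "'v pair_pre_digraph \<Rightarrow> nat \<Rightarrow> (nat \<Rightarrow> nat \<Rightarrow> real) \<Rightarrow> real" where
  "T_ind F n \<xi> = (\<Sum>\<alpha>\<in>increasing_maps (num_nodes F) n. phi_ind F (\<lambda>i j. \<xi> (\<alpha> i) (\<alpha> j)))"

definition indep_uniforms ::
  "'w measure \<Rightarrow> nat \<Rightarrow> (nat \<Rightarrow> 'w \<Rightarrow> real) \<Rightarrow> (nat \<Rightarrow> nat \<Rightarrow> 'w \<Rightarrow> real) \<Rightarrow> bool" where
  "indep_uniforms M n X Y \<longleftrightarrow>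
     prob_space M \<and>
     prob_space.indep_vars M (\<lambda>_. borel) (case_sum X (\<lambda>(i, j). Y i j))
       ({1..n} <+> {(i, j). 1 \<le> i \<and> i < j \<and> j \<le> n}) \<and>
     (\<forall>i\<in>{1..n}. distr M borel (X i) = uniform_measure lborel {0..1}) \<and>
     (\<forall>i j. 1 \<le> i \<and> i < j \<and> j \<le> n \<longrightarrow> distr M borel (Y i j) = uniform_measure lborel {0..1})"

text \<open>
  The adjacency indicators of the \<open>\<kappa>\<close>-random graph for the outcome \<open>\<omega>\<close>. Since \<open>Y i j\<close> is only
  meaningful for \<open>i < j\<close>, the indices are sorted first. The diagonal is irrelevant.
\<close>

definition adjacency ::
  "(real \<times> real \<Rightarrow> real) \<Rightarrow> (nat \<Rightarrow> 'w \<Rightarrow> real) \<Rightarrow> (nat \<Rightarrow> nat \<Rightarrow> 'w \<Rightarrow> real) \<Rightarrow>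
   'w \<Rightarrow> nat \<Rightarrow> nat \<Rightarrow> real" where
  "adjacency \<kappa> X Y \<omega> i j =
     of_bool (Y (min i j) (max i j) \<omega> \<le> \<kappa> (X (min i j) \<omega>, X (max i j) \<omega>))"

text \<open>
  The conditional expectation of \<open>Z\<close> given \<open>X = x\<close>, as a function of \<open>x\<close>: any Borel function \<open>g\<close>
  such that \<open>g(X)\<close> is a version of the conditional expectation of \<open>Z\<close> given the
  \<open>\<sigma>\<close>-algebra generated by \<open>X\<close>. It is unique up to null sets of the law of \<open>X\<close>.
\<close>

definition cond_exp_at :: "'w measure \<Rightarrow> ('w \<Rightarrow> real) \<Rightarrow> ('w \<Rightarrow> real) \<Rightarrow> real \<Rightarrow> real" where
  "cond_exp_at M Z X = (SOME g. g \<in> borel_measurable borel \<and>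
     (AE \<omega> in M. g (X \<omega>) = real_cond_exp M (vimage_algebra (space M) X borel) Z \<omega>))"

text \<open>
  The quantities \<open>f\<^sub>1\<close> and \<open>\<sigma>\<^sub>1\<close> depend only on the joint law of \<open>X\<^sub>1, \<dots>, X\<^sub>k\<close>, so they are defined
  on the unit cube, with the coordinate projections \<open>\<lambda>u. u i\<close> as the variables \<open>X\<^sub>i\<close>. As \<open>\<kappa>\<close> is only
  Lebesgue measurable, \<open>\<kappa>(X\<^sub>i, X\<^sub>j)\<close> is a random variable on the completed probability space only.
\<close>

definition cube :: "nat \<Rightarrow> (nat \<Rightarrow> real) measure" where
  "cube k = completion (Pi\<^sub>M {1..k} (\<lambda>_. uniform_measure lborel {0..1}))"

definition f1_inj :: "(real \<times> real \<Rightarrow> real) \<Rightarrow> 'v pair_pre_digraph \<Rightarrow> real \<Rightarrow> real" where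
  "f1_inj \<kappa> F x =
     (\<Sum>H\<in>copies F. cond_exp_at (cube (num_nodes F))
        (\<lambda>u. \<Prod>(i, j)\<in>edge_pairs H. \<kappa> (u i, u j)) (\<lambda>u. u 1) x)"

definition f1_ind :: "(real \<times> real \<Rightarrow> real) \<Rightarrow> 'v pair_pre_digraph \<Rightarrow> real \<Rightarrow> real" where
  "f1_ind \<kappa> F x =
     (\<Sum>H\<in>copies F. cond_exp_at (cube (num_nodes F))
        (\<lambda>u. (\<Prod>(i, j)\<in>edge_pairs H. \<kappa> (u i, u j)) *
             (\<Prod>(i, j)\<in>nonedge_pairs H. 1 - \<kappa> (u i, u j))) (\<lambda>u. u 1) x)"

definition L2_norm_rv :: "'w measure \<Rightarrow> ('w \<Rightarrow> real) \<Rightarrow> real" where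
  "L2_norm_rv M Z = sqrt (integral\<^sup>L M (\<lambda>\<omega>. (Z \<omega>)\<^sup>2))"

definition sigma1_inj :: "(real \<times> real \<Rightarrow> real) \<Rightarrow> 'v pair_pre_digraph \<Rightarrow> real" where
  "sigma1_inj \<kappa> F =
     (let M = cube (num_nodes F)
      in L2_norm_rv M (\<lambda>u. f1_inj \<kappa> F (u 1) - integral\<^sup>L M (\<lambda>v. f1_inj \<kappa> F (v 1))))"

definition sigma1_ind :: "(real \<times> real \<Rightarrow> real) \<Rightarrow> 'v pair_pre_digraph \<Rightarrow> real" where
  "sigma1_ind \<kappa> F =
     (let M = cube (num_nodes F)
      in L2_norm_rv M (\<lambda>u. f1_ind \<kappa> F (u 1) - integral\<^sup>L M (\<lambda>v. f1_ind \<kappa> F (v 1))))"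

text \<open>
  Probability and expectation on the completion of \<open>M\<close>, for the same reason as in \<^const>\<open>cube\<close>.
  On events and integrable functions that are already measurable with respect to \<open>M\<close> they agree
  with the measure and integral of \<open>M\<close>.
\<close>

definition Pr :: "'w measure \<Rightarrow> ('w \<Rightarrow> bool) \<Rightarrow> real" where
  "Pr M P = measure (completion M) {\<omega> \<in> space M. P \<omega>}"

definition Expec :: "'w measure \<Rightarrow> ('w \<Rightarrow> real) \<Rightarrow> real" where
  "Expec M Z = integral\<^sup>L (completion M) Z"

end

theory Submission
  imports Defs "HOL-Real_Asymp.Real_Asymp" "HOL-Combinatorics.Permutations"
begin

text \<open>
  After centring and scaling, the count \<open>W\<close> is a generalized U-statistic with Hoeffding projection \<open>L\<close>, a
  normalized sum of independent terms \<open>G (X i)\<close>. Replacing \<open>X i\<close> by an independent copy \<open>X' i\<close> turns \<open>W\<close>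
  into \<open>W' i\<close>, and \<open>(W, W' i)\<close> is an exchangeable pair with the antisymmetric companion
  \<open>D i = G (X i) - G (X' i)\<close>. Since \<open>L\<close> is the conditional expectation of \<open>\<Sum>i. D i\<close>, Stein's equation gives
  \<open>E (L * f W) = (\<Sum>i. E (D i * (f W - f (W' i)))) / 2\<close>. The Stein solution satisfies
  \<open>f' w = w * f w + of_bool (w \<le> z) - \<Phi> z\<close>, where \<open>w * f w\<close> is increasing and the indicator is decreasing, so
  the Taylor error of \<open>f\<close> is controlled by increments of a bounded monotone function, and exchangeability
  evaluates these increments exactly (the argument of Shao and Zhang). Hence the Kolmogorov distance is at
  most a constant times
  \<open>E \<bar>1 - V / 2\<bar> + E \<bar>V'\<bar> + E \<bar>W - L\<bar>\<close>, where \<open>V\<close> and \<open>V'\<close> average \<open>\<Sum>i. D i * (W - W' i)\<close> and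
  \<open>\<Sum>i. \<bar>D i\<bar> * (W - W' i)\<close>. The linear part of \<open>W - W' i\<close> contributes sums of independent centred terms;
  everything else is bounded in \<open>L\<^sup>2\<close>, because the kernels remaining after the projection are orthogonal
  unless they share two nodes.
\<close>

section \<open>Stein's equation for the normal distribution\<close>

text \<open>Only node variables are resampled, never edge variables: \<open>L\<close> depends on the
  nodes alone, and the noise of the edges sits in the remainder. Two sets of k nodes that share at
  most one node share no pair and hence no edge variable, which is why the edges do not spoil
  orthogonality. Each exchangeable pair is used on its own inside a finite sum of expectations, so a
  single fresh coordinate serves for every node. In the Stein argument conditional expectations are
  replaced by integrals tested against bounded functions of \<open>W\<close>. For the rate:
  \<open>D i\<close> is of order n to the -1/2 and the nonlinear part of an increment has L2 norm of
  order 1/n, so n products of the two add up to n to the -1/2. A second obstacle is measurability. A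
  graphon is only Lebesgue measurable, so it is replaced by a Borel version that is symmetric and
  [0,1]-valued everywhere; counts and projections then agree almost surely, and the completions in
  the definitions absorb the exceptional null sets. Injective and induced counts are treated
  together through a Boolean flag.\<close>

abbreviation std_normal_cdf :: "real \<Rightarrow> real" ("\<Phi>") where
  "\<Phi> \<equiv> cdf std_normal_distribution"

lemma std_normal_density_has_derivative:
  "(std_normal_density has_real_derivative - x * std_normal_density x) (at x)"
  unfolding std_normal_density_def
  by (auto intro!: derivative_eq_intros simp: field_simps)

lemma std_normal_density_minus: "std_normal_density (- x) = std_normal_density x"
  by (simp add: std_normal_density_def)

lemma continuous_std_normal_density: "continuous_on A std_normal_density"
  unfolding std_normal_density_def by (intro continuous_intros) auto

lemma std_normal_cdf_diff:
  assumes "a \<le> b"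
  shows "\<Phi> b - \<Phi> a = integral {a..b} std_normal_density"
proof -
  interpret real_distribution std_normal_distribution by (rule real_dist_normal_dist)
  have int: "set_integrable lborel {a..b} std_normal_density"
    unfolding set_integrable_def
    by (rule borel_integrable_compact) (auto intro: continuous_std_normal_density)
  have nn: "emeasure std_normal_distribution {a<..b} = (\<integral>\<^sup>+x. ennreal (indicator {a..b} x * std_normal_density x) \<partial>lborel)"
  proof -
    have "(\<lambda>x. ennreal (std_normal_density x)) \<in> borel_measurable lborel" by simp
    note density = emeasure_density[OF this, of "{a<..b}", simplified]
    show ?thesis
      unfolding density
      by (rule nn_integral_cong_AE, rule AE_mp[OF AE_lborel_singleton[of a]], rule AE_I2)
         (simp split: split_indicator)
  qed
  have "integrable lborel (\<lambda>x. indicator {a..b} x * std_normal_density x)"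
    using int by (simp add: set_integrable_def)
  then have eq: "emeasure std_normal_distribution {a<..b} = ennreal (integral\<^sup>L lborel (\<lambda>x. indicator {a..b} x * std_normal_density x))"
    unfolding nn by (intro nn_integral_eq_integral) auto
  have "measure std_normal_distribution {a<..b} = integral\<^sup>L lborel (\<lambda>x. indicator {a..b} x * std_normal_density x)"
    unfolding measure_def eq by (intro enn2real_ennreal integral_nonneg_AE) auto
  also have "\<dots> = integral {a..b} std_normal_density"
    using set_borel_integral_eq_integral(2)[OF int] by (simp add: set_lebesgue_integral_def)
  finally show ?thesis
    using assms by (cases "a = b") (simp_all add: cdf_diff_eq)
qed

lemma std_normal_cdf_has_derivative:
  "(\<Phi> has_real_derivative std_normal_density x) (at x)"
proof -
  have "((\<lambda>y. integral {x - 1..y} std_normal_density) has_real_derivative std_normal_density x) (at x within {x - 1..x + 1})"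
    by (rule integral_has_real_derivative) (auto intro: continuous_std_normal_density)
  then have "((\<lambda>y. \<Phi> (x - 1) + integral {x - 1..y} std_normal_density) has_real_derivative std_normal_density x) (at x within {x - 1..x + 1})"
    by (auto intro!: derivative_eq_intros)
  then have "(\<Phi> has_real_derivative std_normal_density x) (at x within {x - 1..x + 1})"
    by (rule has_field_derivative_transform_within[where d = 1])
       (auto simp: std_normal_cdf_diff[of "x - 1", symmetric])
  then show ?thesis
    by (simp add: at_within_Icc_at)
qed

lemma std_normal_cdf_at_top: "(\<Phi> \<longlongrightarrow> 1) at_top"
  using real_distribution.cdf_lim_at_top_prob[OF real_dist_normal_dist] .

lemma std_normal_cdf_at_bot: "(\<Phi> \<longlongrightarrow> 0) at_bot"
  using finite_borel_measure.cdf_lim_at_bot[of std_normal_distribution] real_dist_normal_dist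
  by (simp add: real_distribution.finite_borel_measure_M)

text \<open>The density is even, so \<open>\<Phi> x + \<Phi> (- x)\<close> has derivative zero; its
  limit at infinity is 1.\<close>

lemma std_normal_cdf_minus: "\<Phi> (- x) = 1 - \<Phi> x"
proof -
  define G where "G x = \<Phi> x + \<Phi> (- x)" for x
  have d: "(G has_real_derivative 0) (at x)" for x
    unfolding G_def
    by (auto intro!: derivative_eq_intros DERIV_chain2[OF std_normal_cdf_has_derivative]
       std_normal_cdf_has_derivative simp: std_normal_density_minus)
  have c: "G y = G x" for y
    by (rule DERIV_isconst_all) (use d in auto)
  have "(G \<longlongrightarrow> 1 + 0) at_top"
    unfolding G_def
    by (intro tendsto_add std_normal_cdf_at_top filterlim_compose[OF std_normal_cdf_at_bot] filterlim_uminus_at_bot_at_top)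
  moreover have "G = (\<lambda>_. G x)" by (rule ext) (rule c)
  ultimately have "((\<lambda>_. G x) \<longlongrightarrow> 1) (at_top :: real filter)" by simp
  then have "G x = 1" by (simp add: tendsto_const_iff)
  then show ?thesis by (simp add: G_def)
qed

lemma std_normal_cdf_bounds: "0 \<le> \<Phi> x" "\<Phi> x \<le> 1"
proof -
  interpret real_distribution std_normal_distribution by (rule real_dist_normal_dist)
  show "0 \<le> \<Phi> x" "\<Phi> x \<le> 1"
    by (auto intro: cdf_nonneg cdf_bounded_prob)
qed

lemma std_normal_cdf_mono: "x \<le> y \<Longrightarrow> \<Phi> x \<le> \<Phi> y"
  using std_normal_cdf_diff[of x y] integral_nonneg[OF integrable_continuous_real[OF continuous_std_normal_density], of x y]
  by simp

section \<open>Gaussian tail bounds\<close>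

lemma nonneg_if_antimono_tendsto_0:
  fixes f f' :: "real \<Rightarrow> real"
  assumes "\<And>y. x \<le> y \<Longrightarrow> (f has_real_derivative f' y) (at y)" "\<And>y. x \<le> y \<Longrightarrow> f' y \<le> 0"
    and "(f \<longlongrightarrow> 0) at_top"
  shows "0 \<le> f x"
proof (rule tendsto_upperbound[OF assms(3)])
  show "\<forall>\<^sub>F y in at_top. f y \<le> f x"
    using eventually_ge_at_top[of x]
  proof eventually_elim
    case (elim y)
    show ?case
      by (rule DERIV_nonpos_imp_nonincreasing[OF elim]) (use assms(1,2) in auto)
  qed
qed simp

text \<open>A crude bound that serves for the decay of polynomial multiples of the tail, the limit
  used by the sharper bounds. The difference has derivative
  \<open>(1 - y) * std_normal_density y\<close>, hence the restriction to x at least 1.\<close>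

lemma std_normal_tail_le_density:
  assumes "1 \<le> x"
  shows "1 - \<Phi> x \<le> std_normal_density x"
proof -
  have "0 \<le> std_normal_density x - (1 - \<Phi> x)"
  proof (rule nonneg_if_antimono_tendsto_0[where x = x and f = "\<lambda>x. std_normal_density x - (1 - \<Phi> x)"])
    fix y assume "x \<le> y"
    show "((\<lambda>x. std_normal_density x - (1 - \<Phi> x)) has_real_derivative
        (1 - y) * std_normal_density y) (at y)"
      by (auto intro!: derivative_eq_intros std_normal_density_has_derivative std_normal_cdf_has_derivative
          simp: algebra_simps)
    show "(1 - y) * std_normal_density y \<le> 0"
      using assms \<open>x \<le> y\<close> by (intro mult_nonpos_nonneg) auto
  next
    have "(std_normal_density \<longlongrightarrow> 0) at_top"
      unfolding std_normal_density_def by real_asymp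
    then show "((\<lambda>x. std_normal_density x - (1 - \<Phi> x)) \<longlongrightarrow> 0) at_top"
      by (auto intro!: tendsto_eq_intros std_normal_cdf_at_top)
  qed
  then show ?thesis by simp
qed

lemma poly_times_std_normal_tail_tendsto_0:
  "((\<lambda>x. x ^ m * (1 - \<Phi> x)) \<longlongrightarrow> 0) at_top"
proof (rule tendsto_sandwich)
  show "\<forall>\<^sub>F x in at_top. 0 \<le> x ^ m * (1 - \<Phi> x)"
    using eventually_ge_at_top[of 0] by eventually_elim (auto simp: std_normal_cdf_bounds)
  show "\<forall>\<^sub>F x in at_top. x ^ m * (1 - \<Phi> x) \<le> x ^ m * std_normal_density x"
    using eventually_ge_at_top[of 1] by eventually_elim (auto intro!: mult_left_mono std_normal_tail_le_density)
  show "((\<lambda>x. x ^ m * std_normal_density x) \<longlongrightarrow> 0) at_top"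
    unfolding std_normal_density_def by real_asymp
qed simp

text \<open>The derivative of the difference is minus the tail itself, so the inequality holds on
  the whole line and not only for positive x.\<close>

lemma std_normal_tail_upper: "x * (1 - \<Phi> x) \<le> std_normal_density x"
proof -
  have "0 \<le> std_normal_density x - x * (1 - \<Phi> x)"
  proof (rule nonneg_if_antimono_tendsto_0[where x = x and f = "\<lambda>x. std_normal_density x - x * (1 - \<Phi> x)"])
    fix y assume "x \<le> y"
    show "((\<lambda>x. std_normal_density x - x * (1 - \<Phi> x)) has_real_derivative
        - (1 - \<Phi> y)) (at y)"
      by (auto intro!: derivative_eq_intros std_normal_density_has_derivative std_normal_cdf_has_derivative
          simp: algebra_simps)
    show "- (1 - \<Phi> y) \<le> 0"
      by (simp add: std_normal_cdf_bounds)
  next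
    have "(std_normal_density \<longlongrightarrow> 0) at_top"
      unfolding std_normal_density_def by real_asymp
    from tendsto_diff[OF this poly_times_std_normal_tail_tendsto_0[of 1]]
    show "((\<lambda>x. std_normal_density x - x * (1 - \<Phi> x)) \<longlongrightarrow> 0) at_top"
      by simp
  qed
  then show ?thesis by simp
qed

text \<open>The derivative of the difference is twice the defect in
  \<open>std_normal_tail_upper\<close>, hence nonpositive. This is the bound behind
  \<open>mult_mills_ratio_mono\<close>.\<close>

lemma std_normal_tail_lower: "x * std_normal_density x \<le> (1 + x\<^sup>2) * (1 - \<Phi> x)"
proof -
  have "0 \<le> (1 + x\<^sup>2) * (1 - \<Phi> x) - x * std_normal_density x"
  proof (rule nonneg_if_antimono_tendsto_0[where x = x
      and f = "\<lambda>x. (1 + x\<^sup>2) * (1 - \<Phi> x) - x * std_normal_density x"])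
    fix y assume "x \<le> y"
    show "((\<lambda>x. (1 + x\<^sup>2) * (1 - \<Phi> x) - x * std_normal_density x) has_real_derivative
        2 * (y * (1 - \<Phi> y) - std_normal_density y)) (at y)"
      by (auto intro!: derivative_eq_intros std_normal_density_has_derivative std_normal_cdf_has_derivative
          simp: algebra_simps power2_eq_square)
    show "2 * (y * (1 - \<Phi> y) - std_normal_density y) \<le> 0"
      using std_normal_tail_upper[of y] by simp
  next
    have d: "((\<lambda>x. x * std_normal_density x) \<longlongrightarrow> 0) at_top"
      unfolding std_normal_density_def by real_asymp
    from tendsto_diff[OF tendsto_add[OF poly_times_std_normal_tail_tendsto_0[of 0] poly_times_std_normal_tail_tendsto_0[of 2]] d]
    show "((\<lambda>x. (1 + x\<^sup>2) * (1 - \<Phi> x) - x * std_normal_density x) \<longlongrightarrow> 0) at_top"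
      by (simp add: algebra_simps)
  qed
  then show ?thesis by simp
qed

section \<open>The Mills ratio and the solution of Stein's equation\<close>

definition mills_ratio :: "real \<Rightarrow> real" where
  "mills_ratio x = (1 - \<Phi> x) / std_normal_density x"

lemma mills_ratio_has_derivative:
  "(mills_ratio has_real_derivative x * mills_ratio x - 1) (at x)"
proof -
  have p: "std_normal_density x > 0" by (rule normal_density_pos) simp
  show ?thesis
    unfolding mills_ratio_def[abs_def]
    by (rule derivative_eq_intros std_normal_density_has_derivative std_normal_cdf_has_derivative refl)+
       (use p in \<open>auto simp: field_simps\<close>)
qed

lemma mills_ratio_nonneg: "0 \<le> mills_ratio x"
  by (simp add: mills_ratio_def std_normal_cdf_bounds)

lemma mult_mills_ratio_le_1: "x * mills_ratio x \<le> 1"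
  using std_normal_tail_upper[of x] normal_density_pos[of 1 0 x]
  by (simp add: mills_ratio_def field_simps)

lemma mills_ratio_antimono:
  assumes "x \<le> y"
  shows "mills_ratio y \<le> mills_ratio x"
  by (rule DERIV_nonpos_imp_nonincreasing[OF assms])
     (use mills_ratio_has_derivative mult_mills_ratio_le_1 in force)

text \<open>The derivative is \<open>(1 + w^2) * mills_ratio w - w\<close>; that it is nonnegative
  is the lower tail bound divided by the density.\<close>

lemma mult_mills_ratio_mono:
  assumes "x \<le> y"
  shows "x * mills_ratio x \<le> y * mills_ratio y"
proof (rule DERIV_nonneg_imp_nondecreasing[OF assms])
  fix w
  have "w * std_normal_density w / std_normal_density w \<le> (1 + w\<^sup>2) * (1 - \<Phi> w) / std_normal_density w"
    by (rule divide_right_mono[OF std_normal_tail_lower]) simp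
  then have "w \<le> (1 + w\<^sup>2) * mills_ratio w"
    using normal_density_pos[of 1 0 w] by (simp add: mills_ratio_def)
  then have "0 \<le> mills_ratio w + w * (w * mills_ratio w - 1)"
    by (simp add: algebra_simps power2_eq_square)
  moreover have "((\<lambda>x. x * mills_ratio x) has_real_derivative mills_ratio w + w * (w * mills_ratio w - 1)) (at w)"
    by (auto intro!: derivative_eq_intros mills_ratio_has_derivative)
  ultimately show "\<exists>d. ((\<lambda>x. x * mills_ratio x) has_real_derivative d) (at w) \<and> 0 \<le> d"
    by blast
qed

text \<open>Both sides are the product of the two tails over the density. At w = z this says that
  the two branches of the Stein solution meet.\<close>

lemma mills_ratio_mult_cdf: "mills_ratio w * \<Phi> w = mills_ratio (- w) * (1 - \<Phi> w)"
  by (simp add: mills_ratio_def std_normal_cdf_minus std_normal_density_minus)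

lemma mills_ratio_0: "mills_ratio 0 \<le> 2"
proof -
  have "\<Phi> 0 = 1 / 2"
    using std_normal_cdf_minus[of 0] by simp
  moreover have "1 / std_normal_density 0 = sqrt (2 * pi)"
    by (simp add: std_normal_density_def)
  moreover have "sqrt (2 * pi) \<le> sqrt (4\<^sup>2)"
    using pi_less_4 by (intro real_sqrt_le_mono) auto
  moreover have "mills_ratio 0 = 1 / 2 * (1 / std_normal_density 0)"
    unfolding mills_ratio_def \<open>\<Phi> 0 = 1 / 2\<close> by simp
  ultimately show ?thesis by simp
qed

text \<open>The solution of Stein's equation \<open>f' w = w * f w + of_bool (w \<le> z) - \<Phi> z\<close>.\<close>

definition stein_sol :: "real \<Rightarrow> real \<Rightarrow> real" where
  "stein_sol z w = (if w \<le> z then mills_ratio (- w) * (1 - \<Phi> z) else mills_ratio w * \<Phi> z)"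

lemma stein_sol_ge: "z \<le> w \<Longrightarrow> stein_sol z w = mills_ratio w * \<Phi> z"
  using mills_ratio_mult_cdf[of z] by (cases "w = z") (auto simp: stein_sol_def)

text \<open>Read off from the equation instead of being defined as a derivative: at the kink w = z
  the solution need not be differentiable, and this choice makes Stein's equation hold there
  too.\<close>

definition stein_sol_deriv :: "real \<Rightarrow> real \<Rightarrow> real" where
  "stein_sol_deriv z w = w * stein_sol z w + of_bool (w \<le> z) - \<Phi> z"

lemma stein_sol_nonneg: "0 \<le> stein_sol z w"
  by (simp add: stein_sol_def mills_ratio_nonneg std_normal_cdf_bounds)

text \<open>A cdf factor is at most 1, which settles one side of 0. On the other side the factor is
  first raised to its value at the argument itself, and \<open>mills_ratio_mult_cdf\<close> reflects
  the ratio.\<close>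

lemma stein_sol_le_mills_ratio: "stein_sol z w \<le> mills_ratio \<bar>w\<bar>"
proof -
  have a: "mills_ratio v * \<Phi> u \<le> mills_ratio \<bar>v\<bar>" if "u \<le> v" for u v
  proof (cases "0 \<le> v")
    case True
    then show ?thesis
      using mult_left_mono[OF std_normal_cdf_bounds(2)[of u] mills_ratio_nonneg[of v]] by simp
  next
    case False
    have "mills_ratio v * \<Phi> u \<le> mills_ratio v * \<Phi> v"
      by (intro mult_left_mono std_normal_cdf_mono that mills_ratio_nonneg)
    also have "\<dots> = mills_ratio (- v) * (1 - \<Phi> v)"
      by (rule mills_ratio_mult_cdf)
    also have "\<dots> \<le> mills_ratio (- v) * 1"
      by (intro mult_left_mono mills_ratio_nonneg) (simp add: std_normal_cdf_bounds)
    finally show ?thesis using False by simp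
  qed
  \<comment> \<open>The left branch is the right branch for the reflected pair
    \<open>(- z, - w)\<close>.\<close>
  show ?thesis
    using a[of z w] a[of "- z" "- w"] by (auto simp: stein_sol_def std_normal_cdf_minus)
qed

lemma abs_stein_sol_le: "\<bar>stein_sol z w\<bar> \<le> 2"
  using stein_sol_le_mills_ratio[of z w] mills_ratio_antimono[of 0 "\<bar>w\<bar>"] mills_ratio_0 stein_sol_nonneg[of z w]
  by simp

lemma abs_mult_stein_sol_le: "\<bar>w * stein_sol z w\<bar> \<le> 1"
  using mult_left_mono[OF stein_sol_le_mills_ratio abs_ge_zero, of w z w] mult_mills_ratio_le_1[of "\<bar>w\<bar>"]
    stein_sol_nonneg[of z w]
  by (simp add: abs_mult)

text \<open>On either side of z the function is, up to reflection, a nonnegative multiple of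
  \<open>x * mills_ratio x\<close>. If z separates a and b, its value there links the two
  pieces.\<close>

lemma mult_stein_sol_mono:
  assumes "a \<le> b"
  shows "a * stein_sol z a \<le> b * stein_sol z b"
proof -
  have le: "a * stein_sol z a \<le> b * stein_sol z b" if "a \<le> b" "b \<le> z" for a b
    using mult_right_mono[OF mult_mills_ratio_mono[of "- b" "- a"], of "1 - \<Phi> z"] that
    by (simp add: stein_sol_def std_normal_cdf_bounds mult.assoc)
  have ge: "a * stein_sol z a \<le> b * stein_sol z b" if "a \<le> b" "z \<le> a" for a b
    using mult_right_mono[OF mult_mills_ratio_mono[of a b], of "\<Phi> z"] that
    by (simp add: stein_sol_ge std_normal_cdf_bounds mult.assoc)
  show ?thesis
    using le[of a b] ge[of a b] le[of a z] ge[of z b] assms by fastforce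
qed

lemma abs_stein_sol_deriv_le: "\<bar>stein_sol_deriv z w\<bar> \<le> 2"
  using abs_mult_stein_sol_le[of w z] std_normal_cdf_bounds[of z]
  by (auto simp: stein_sol_deriv_def)

lemma stein_sol_has_derivative_less:
  assumes "w < z"
  shows "(stein_sol z has_real_derivative stein_sol_deriv z w) (at w)"
proof -
  have "((\<lambda>w. mills_ratio (- w) * (1 - \<Phi> z)) has_real_derivative stein_sol_deriv z w) (at w)"
    using assms
    by (auto intro!: derivative_eq_intros DERIV_chain2[OF mills_ratio_has_derivative]
        simp: stein_sol_deriv_def stein_sol_def algebra_simps)
  then show ?thesis
    by (rule has_field_derivative_transform_within_open[of _ _ _ "{..<z}"])
       (use assms in \<open>auto simp: stein_sol_def\<close>)
qed

lemma stein_sol_has_derivative_greater: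
  assumes "z < w"
  shows "(stein_sol z has_real_derivative stein_sol_deriv z w) (at w)"
proof -
  have "((\<lambda>w. mills_ratio w * \<Phi> z) has_real_derivative stein_sol_deriv z w) (at w)"
    using assms
    by (auto intro!: derivative_eq_intros mills_ratio_has_derivative
        simp: stein_sol_deriv_def stein_sol_def algebra_simps)
  then show ?thesis
    by (rule has_field_derivative_transform_within_open[of _ _ _ "{z<..}"])
       (use assms in \<open>auto simp: stein_sol_def\<close>)
qed

lemma continuous_mills_ratio: "continuous_on A mills_ratio"
  using DERIV_isCont[OF mills_ratio_has_derivative]
  by (simp add: continuous_at_imp_continuous_on)

lemma continuous_stein_sol: "continuous_on A (stein_sol z)"
proof -
  have "continuous_on ({..z} \<union> {z..}) (\<lambda>w. if w \<in> {..z} then mills_ratio (- w) * (1 - \<Phi> z)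
    else mills_ratio w * \<Phi> z)"
    using mills_ratio_mult_cdf[of z]
    by (intro continuous_on_If)
       (auto intro!: continuous_intros continuous_on_compose2[OF continuous_mills_ratio[of UNIV]])
  moreover have "{..z} \<union> {z..} = UNIV" by auto
  ultimately have "continuous_on UNIV (stein_sol z)"
    by (simp add: stein_sol_def[abs_def])
  then show ?thesis
    by (rule continuous_on_subset) simp
qed

text \<open>The side condition keeps the kink at z out of the open interval; the mean value theorem
  tolerates it at an endpoint.\<close>

lemma stein_sol_mvt:
  assumes "a < b" "b \<le> z \<or> z \<le> a"
  obtains \<xi> where "a < \<xi>" "\<xi> < b" "stein_sol z b - stein_sol z a = (b - a) * stein_sol_deriv z \<xi>"
proof -
  have d: "(stein_sol z has_real_derivative stein_sol_deriv z x) (at x)" if "a < x" "x < b" for x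
    using assms that stein_sol_has_derivative_less[of x z] stein_sol_has_derivative_greater[of z x] by force
  obtain l \<xi> where "a < \<xi>" "\<xi> < b" "(stein_sol z has_real_derivative l) (at \<xi>)"
    "stein_sol z b - stein_sol z a = (b - a) * l"
    using MVT[OF assms(1) continuous_stein_sol] d real_differentiable_def by blast
  then show ?thesis
    using that d DERIV_unique by blast
qed

text \<open>The modulus of continuity of the derivative is measured by a monotone function; under an
  exchangeable pair such an increment can be evaluated exactly.\<close>

definition stein_modulus :: "real \<Rightarrow> real \<Rightarrow> real" where
  "stein_modulus z w = w * stein_sol z w - of_bool (w \<le> z)"

lemma stein_modulus_mono: "a \<le> b \<Longrightarrow> stein_modulus z a \<le> stein_modulus z b"
  using mult_stein_sol_mono[of a b z] by (auto simp: stein_modulus_def)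

lemma abs_stein_modulus_le: "\<bar>stein_modulus z w\<bar> \<le> 2"
  using abs_mult_stein_sol_le[of w z] by (auto simp: stein_modulus_def)

lemma abs_stein_sol_deriv_diff_le:
  assumes "x \<le> y"
  shows "\<bar>stein_sol_deriv z y - stein_sol_deriv z x\<bar> \<le> stein_modulus z y - stein_modulus z x"
  using mult_stein_sol_mono[OF assms, of z] assms
  by (auto simp: stein_sol_deriv_def stein_modulus_def)

text \<open>Both factors on the right change sign with the order of a and b, so one formula covers
  both orders. The intermediate derivative differs from the one at b by at most the increment of the
  modulus.\<close>

lemma stein_sol_taylor:
  "\<bar>stein_sol z b - stein_sol z a - (b - a) * stein_sol_deriv z b\<bar>
    \<le> (b - a) * (stein_modulus z b - stein_modulus z a)"
proof -
  let ?f = "stein_sol z" and ?d = "stein_sol_deriv z" and ?m = "stein_modulus z"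
  \<comment> \<open>The expansion point \<open>c\<close> may be either endpoint, because the point b
    of the claim is the right endpoint or the left one according to the order. The modulus is
    already taken over the larger interval from a to b.\<close>
  have piece: "\<bar>?f v - ?f u - (v - u) * ?d c\<bar> \<le> (v - u) * (?m b - ?m a)"
    if "u \<le> v" "a \<le> u" "v \<le> b" "v \<le> z \<or> z \<le> u" "c = a \<or> c = b" for u v a b c
  proof (cases "u = v")
    case False
    then have "u < v" using that by simp
    from stein_sol_mvt[OF this that(4)]
    obtain \<xi> where \<xi>: "u < \<xi>" "\<xi> < v" "?f v - ?f u = (v - u) * ?d \<xi>" .
    have le: "a \<le> \<xi>" "\<xi> \<le> b" using \<xi> that by auto
    have "\<bar>?d \<xi> - ?d c\<bar> \<le> ?m b - ?m a"
      using that(5) abs_stein_sol_deriv_diff_le[OF le(1), of z] abs_stein_sol_deriv_diff_le[OF le(2), of z]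
        stein_modulus_mono[OF le(1), of z] stein_modulus_mono[OF le(2), of z]
      by (elim disjE) simp_all
    then have "(v - u) * \<bar>?d \<xi> - ?d c\<bar> \<le> (v - u) * (?m b - ?m a)"
      using that(1) by (intro mult_left_mono) simp_all
    moreover have "?f v - ?f u - (v - u) * ?d c = (v - u) * (?d \<xi> - ?d c)"
      using \<xi> by (simp add: algebra_simps)
    ultimately show ?thesis
      using that(1) by (simp add: abs_mult)
  qed simp
  have full: "\<bar>?f b - ?f a - (b - a) * ?d c\<bar> \<le> (b - a) * (?m b - ?m a)"
    if "a \<le> b" "c = a \<or> c = b" for a b c
  proof (cases "b \<le> z \<or> z \<le> a")
    case True
    then show ?thesis using piece[of a b a b c] that by auto
  next
    case False
    \<comment> \<open>The kink lies strictly inside, so the error is split there; both halves carry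
      the same modulus increment and their lengths add up.\<close>
    then have "\<bar>?f z - ?f a - (z - a) * ?d c\<bar> \<le> (z - a) * (?m b - ?m a)"
      "\<bar>?f b - ?f z - (b - z) * ?d c\<bar> \<le> (b - z) * (?m b - ?m a)"
      using piece[of a z a b c] piece[of z b a b c] that by auto
    then show ?thesis by (simp add: algebra_simps)
  qed
  have eq: "\<bar>?f b - ?f a - (b - a) * d\<bar> = \<bar>?f a - ?f b - (a - b) * d\<bar>"
    "(b - a) * (?m b - ?m a) = (a - b) * (?m a - ?m b)" for d
    by (auto simp: algebra_simps abs_if)
  show ?thesis
    using full[of a b b] full[of b a b] eq(1)[of "?d b"] eq(2) by (cases "a \<le> b") simp_all
qed

lemma borel_measurable_stein_sol [measurable]: "stein_sol z \<in> borel_measurable borel"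
  by (rule borel_measurable_continuous_onI[OF continuous_stein_sol])

lemma borel_measurable_stein_sol_deriv [measurable]: "stein_sol_deriv z \<in> borel_measurable borel"
  unfolding stein_sol_deriv_def[abs_def] by measurable

lemma borel_measurable_stein_modulus [measurable]: "stein_modulus z \<in> borel_measurable borel"
  unfolding stein_modulus_def[abs_def] by measurable

section \<open>Normal approximation by exchangeable pairs\<close>

lemma (in prob_space) integrable_bounded_real:
  fixes f :: "'a \<Rightarrow> real"
  assumes "f \<in> borel_measurable M" "\<And>x. x \<in> space M \<Longrightarrow> \<bar>f x\<bar> \<le> B"
  shows "integrable M f"
  using assms by (intro integrable_const_bound[of f B] AE_I2) auto

lemma (in prob_space) integrable_mult_bounded:
  fixes u v :: "'a \<Rightarrow> real"
  assumes [measurable]: "u \<in> borel_measurable M" "v \<in> borel_measurable M"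
    and "\<And>\<omega>. \<omega> \<in> space M \<Longrightarrow> \<bar>u \<omega>\<bar> \<le> B" "\<And>\<omega>. \<omega> \<in> space M \<Longrightarrow> \<bar>v \<omega>\<bar> \<le> C"
  shows "integrable M (\<lambda>\<omega>. u \<omega> * v \<omega>)"
proof (rule integrable_bounded_real)
  fix \<omega> assume "\<omega> \<in> space M"
  then show "\<bar>u \<omega> * v \<omega>\<bar> \<le> B * C"
    using assms(3,4)[of \<omega>] by (auto simp: abs_mult intro!: mult_mono)
qed measurable

lemma integrable_bounded_mult:
  fixes f g :: "'a \<Rightarrow> real"
  assumes [measurable]: "f \<in> borel_measurable M" and f: "\<And>x. x \<in> space M \<Longrightarrow> \<bar>f x\<bar> \<le> B" and g: "integrable M g"
  shows "integrable M (\<lambda>x. f x * g x)"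
proof (rule Bochner_Integration.integrable_bound)
  show "integrable M (\<lambda>x. B * \<bar>g x\<bar>)" using g by simp
  have "\<bar>f x * g x\<bar> \<le> \<bar>B * \<bar>g x\<bar>\<bar>" if "x \<in> space M" for x
    using order.trans[OF mult_right_mono[OF f[OF that] abs_ge_zero] abs_ge_self, of "g x"]
    by (simp add: abs_mult)
  then show "AE x in M. norm (f x * g x) \<le> norm (B * \<bar>g x\<bar>)"
    by (intro AE_I2) simp
qed (use g in measurable)

lemma (in prob_space) abs_expectation_mult_le:
  fixes f g :: "'a \<Rightarrow> real"
  assumes [measurable]: "f \<in> borel_measurable M" and f: "\<And>x. x \<in> space M \<Longrightarrow> \<bar>f x\<bar> \<le> B"
    and g: "integrable M g"
  shows "\<bar>expectation (\<lambda>x. f x * g x)\<bar> \<le> B * expectation (\<lambda>x. \<bar>g x\<bar>)"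
proof -
  have [measurable]: "g \<in> borel_measurable M" using g by auto
  have le: "\<bar>f x * g x\<bar> \<le> B * \<bar>g x\<bar>" if "x \<in> space M" for x
    using f[OF that] by (simp add: abs_mult mult_right_mono)
  have "integrable M (\<lambda>x. f x * g x)"
    by (rule integrable_bounded_mult[OF assms(1) f g])
  then have "\<bar>expectation (\<lambda>x. f x * g x)\<bar> \<le> expectation (\<lambda>x. \<bar>f x * g x\<bar>)"
    using integral_norm_bound[of M "\<lambda>x. f x * g x"] by simp
  also have "\<dots> \<le> expectation (\<lambda>x. B * \<bar>g x\<bar>)"
    using g le \<open>integrable M (\<lambda>x. f x * g x)\<close> by (intro integral_mono) auto
  finally show ?thesis using g by simp
qed

lemma (in prob_space) integral_distr_self:
  fixes f :: "'a \<Rightarrow> real"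
  assumes "s \<in> measurable M M" "distr M M s = M" "f \<in> borel_measurable M"
  shows "expectation (\<lambda>x. f (s x)) = expectation f"
  using integral_distr[of s M M f] assms by simp

text \<open>In the application \<open>s i\<close> resamples the \<open>i\<close>-th coordinate. The functions \<open>L\<close>, \<open>V\<close> and \<open>V'\<close> play
  the role of conditional expectations given a \<open>\<sigma>\<close>-algebra that makes \<open>W\<close> measurable.\<close>

theorem (in prob_space) exchangeable_pair_normal_approximation:
  fixes W L V V' :: "'a \<Rightarrow> real" and D :: "'i \<Rightarrow> 'a \<Rightarrow> real" and s :: "'i \<Rightarrow> 'a \<Rightarrow> 'a"
  assumes fin: "finite I"
    and W_meas [measurable]: "W \<in> borel_measurable M" and W_bound: "\<And>\<omega>. \<omega> \<in> space M \<Longrightarrow> \<bar>W \<omega>\<bar> \<le> b"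
    and D_meas [measurable]: "\<And>i. i \<in> I \<Longrightarrow> D i \<in> borel_measurable M"
    and D_bound: "\<And>i \<omega>. i \<in> I \<Longrightarrow> \<omega> \<in> space M \<Longrightarrow> \<bar>D i \<omega>\<bar> \<le> b"
    and int: "integrable M L" "integrable M V" "integrable M V'"
    and s_meas [measurable]: "\<And>i. i \<in> I \<Longrightarrow> s i \<in> measurable M M"
    and s_distr: "\<And>i. i \<in> I \<Longrightarrow> distr M M (s i) = M"
    and W_s: "\<And>i \<omega>. i \<in> I \<Longrightarrow> \<omega> \<in> space M \<Longrightarrow> W (s i (s i \<omega>)) = W \<omega>"
    and D_s: "\<And>i \<omega>. i \<in> I \<Longrightarrow> \<omega> \<in> space M \<Longrightarrow> D i (s i \<omega>) = - D i \<omega>"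
    and L: "\<And>\<psi> c. \<psi> \<in> borel_measurable borel \<Longrightarrow> (\<And>x. \<bar>\<psi> x\<bar> \<le> c) \<Longrightarrow>
      expectation (\<lambda>\<omega>. \<psi> (W \<omega>) * (\<Sum>i\<in>I. D i \<omega>)) = expectation (\<lambda>\<omega>. \<psi> (W \<omega>) * L \<omega>)"
    and V: "\<And>\<psi> c. \<psi> \<in> borel_measurable borel \<Longrightarrow> (\<And>x. \<bar>\<psi> x\<bar> \<le> c) \<Longrightarrow>
      expectation (\<lambda>\<omega>. \<psi> (W \<omega>) * (\<Sum>i\<in>I. D i \<omega> * (W \<omega> - W (s i \<omega>)))) = expectation (\<lambda>\<omega>. \<psi> (W \<omega>) * V \<omega>)"
    and V': "\<And>\<psi> c. \<psi> \<in> borel_measurable borel \<Longrightarrow> (\<And>x. \<bar>\<psi> x\<bar> \<le> c) \<Longrightarrow>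
      expectation (\<lambda>\<omega>. \<psi> (W \<omega>) * (\<Sum>i\<in>I. \<bar>D i \<omega>\<bar> * (W \<omega> - W (s i \<omega>)))) = expectation (\<lambda>\<omega>. \<psi> (W \<omega>) * V' \<omega>)"
  shows "\<bar>prob {\<omega> \<in> space M. W \<omega> \<le> z} - \<Phi> z\<bar> \<le>
    2 * expectation (\<lambda>\<omega>. \<bar>1 - V \<omega> / 2\<bar>) + 2 * expectation (\<lambda>\<omega>. \<bar>V' \<omega>\<bar>) + 2 * expectation (\<lambda>\<omega>. \<bar>W \<omega> - L \<omega>\<bar>)"
proof -
  let ?f = "stein_sol z" and ?p = "stein_sol_deriv z" and ?m = "stein_modulus z"
  have W_s_bound: "\<bar>W (s i \<omega>)\<bar> \<le> b" if "i \<in> I" "\<omega> \<in> space M" for i \<omega>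
    using W_bound measurable_space[OF s_meas] that by blast

  have [measurable]: "L \<in> borel_measurable M" "V \<in> borel_measurable M" "V' \<in> borel_measurable M"
    using int by auto
  have D_diff_bound: "\<bar>D i \<omega> * (W \<omega> - W (s i \<omega>))\<bar> \<le> b * (2 * b)"
    "\<bar>\<bar>D i \<omega>\<bar> * (W \<omega> - W (s i \<omega>))\<bar> \<le> b * (2 * b)" if "i \<in> I" "\<omega> \<in> space M" for i \<omega>
    using D_bound[OF that] W_bound[OF that(2)] W_s_bound[OF that]
    by (auto simp: abs_mult intro!: mult_mono)

  \<comment> \<open>Since \<open>D i\<close> is odd under the swap, twice the expectation on the
    left is that of an increment of the Stein solution times \<open>D i\<close>. Its Taylor error is
    bounded by an increment of the modulus times the odd weight
    \<open>\<bar>D i \<omega>\<bar> * (W \<omega> - W (s i \<omega>))\<close>, and the swap turns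
    that increment back into twice a single term.\<close>
  have err: "\<bar>2 * expectation (\<lambda>\<omega>. ?f (W \<omega>) * D i \<omega>)
        - expectation (\<lambda>\<omega>. ?p (W \<omega>) * (D i \<omega> * (W \<omega> - W (s i \<omega>))))\<bar>
      \<le> 2 * expectation (\<lambda>\<omega>. ?m (W \<omega>) * (\<bar>D i \<omega>\<bar> * (W \<omega> - W (s i \<omega>))))" if i: "i \<in> I" for i
  proof -
    note [measurable] = D_meas[OF i] s_meas[OF i]
    have int1: "integrable M (\<lambda>\<omega>. ?f (W \<omega>) * D i \<omega>)" "integrable M (\<lambda>\<omega>. ?f (W (s i \<omega>)) * D i \<omega>)"
      by (rule integrable_mult_bounded[where B = 2 and C = b]; use D_bound[OF i] abs_stein_sol_le in simp)+
    have int2: "integrable M (\<lambda>\<omega>. ?p (W \<omega>) * (D i \<omega> * (W \<omega> - W (s i \<omega>))))"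
      by (rule integrable_mult_bounded[where B = 2 and C = "b * (2 * b)"]; use D_diff_bound[OF i] abs_stein_sol_deriv_le in simp)
    have int3: "integrable M (\<lambda>\<omega>. ?m (W \<omega>) * (\<bar>D i \<omega>\<bar> * (W \<omega> - W (s i \<omega>))))"
      "integrable M (\<lambda>\<omega>. ?m (W (s i \<omega>)) * (\<bar>D i \<omega>\<bar> * (W \<omega> - W (s i \<omega>))))"
      by (rule integrable_mult_bounded[where B = 2 and C = "b * (2 * b)"]; use D_diff_bound(2)[OF i] abs_stein_modulus_le in simp)+
    have "expectation (\<lambda>\<omega>. ?f (W (s i \<omega>)) * D i \<omega>) =
        expectation (\<lambda>\<omega>. ?f (W (s i (s i \<omega>))) * D i (s i \<omega>))"
      using integral_distr_self[OF s_meas[OF i] s_distr[OF i], of "\<lambda>\<omega>. ?f (W (s i \<omega>)) * D i \<omega>"] by simp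
    also have "\<dots> = expectation (\<lambda>\<omega>. - (?f (W \<omega>) * D i \<omega>))"
      by (rule Bochner_Integration.integral_cong) (simp_all add: W_s[OF i] D_s[OF i])
    finally have f: "2 * expectation (\<lambda>\<omega>. ?f (W \<omega>) * D i \<omega>) =
        expectation (\<lambda>\<omega>. ?f (W \<omega>) * D i \<omega> - ?f (W (s i \<omega>)) * D i \<omega>)"
      using int1 by simp
    have "expectation (\<lambda>\<omega>. ?m (W (s i \<omega>)) * (\<bar>D i \<omega>\<bar> * (W \<omega> - W (s i \<omega>)))) =
        expectation (\<lambda>\<omega>. ?m (W (s i (s i \<omega>))) * (\<bar>D i (s i \<omega>)\<bar> * (W (s i \<omega>) - W (s i (s i \<omega>)))))"
      using integral_distr_self[OF s_meas[OF i] s_distr[OF i],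
          of "\<lambda>\<omega>. ?m (W (s i \<omega>)) * (\<bar>D i \<omega>\<bar> * (W \<omega> - W (s i \<omega>)))"] by simp
    also have "\<dots> = expectation (\<lambda>\<omega>. - (?m (W \<omega>) * (\<bar>D i \<omega>\<bar> * (W \<omega> - W (s i \<omega>)))))"
      by (rule Bochner_Integration.integral_cong) (simp_all add: W_s[OF i] D_s[OF i] algebra_simps)
    finally have m: "2 * expectation (\<lambda>\<omega>. ?m (W \<omega>) * (\<bar>D i \<omega>\<bar> * (W \<omega> - W (s i \<omega>)))) =
        expectation (\<lambda>\<omega>. ?m (W \<omega>) * (\<bar>D i \<omega>\<bar> * (W \<omega> - W (s i \<omega>)))
          - ?m (W (s i \<omega>)) * (\<bar>D i \<omega>\<bar> * (W \<omega> - W (s i \<omega>))))"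
      using int3 by simp
    have "\<bar>expectation (\<lambda>\<omega>. ?f (W \<omega>) * D i \<omega> - ?f (W (s i \<omega>)) * D i \<omega> - ?p (W \<omega>) * (D i \<omega> * (W \<omega> - W (s i \<omega>))))\<bar>
      \<le> expectation (\<lambda>\<omega>. \<bar>?f (W \<omega>) * D i \<omega> - ?f (W (s i \<omega>)) * D i \<omega> - ?p (W \<omega>) * (D i \<omega> * (W \<omega> - W (s i \<omega>)))\<bar>)"
      by (rule integral_abs_bound)
    also have "\<dots> \<le> expectation (\<lambda>\<omega>. ?m (W \<omega>) * (\<bar>D i \<omega>\<bar> * (W \<omega> - W (s i \<omega>)))
          - ?m (W (s i \<omega>)) * (\<bar>D i \<omega>\<bar> * (W \<omega> - W (s i \<omega>))))"
    proof (rule integral_mono)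
      fix \<omega>
      have "\<bar>D i \<omega>\<bar> * \<bar>?f (W \<omega>) - ?f (W (s i \<omega>)) - (W \<omega> - W (s i \<omega>)) * ?p (W \<omega>)\<bar>
          \<le> \<bar>D i \<omega>\<bar> * ((W \<omega> - W (s i \<omega>)) * (?m (W \<omega>) - ?m (W (s i \<omega>))))"
        by (intro mult_left_mono stein_sol_taylor) simp
      then show "\<bar>?f (W \<omega>) * D i \<omega> - ?f (W (s i \<omega>)) * D i \<omega> - ?p (W \<omega>) * (D i \<omega> * (W \<omega> - W (s i \<omega>)))\<bar>
          \<le> ?m (W \<omega>) * (\<bar>D i \<omega>\<bar> * (W \<omega> - W (s i \<omega>))) - ?m (W (s i \<omega>)) * (\<bar>D i \<omega>\<bar> * (W \<omega> - W (s i \<omega>)))"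
        unfolding abs_mult[symmetric] by (simp add: algebra_simps)
    qed (use int1 int2 int3 in auto)
    finally show ?thesis
      unfolding f m using int1 int2 by simp
  qed

  have sum_int: "expectation (\<lambda>\<omega>. \<psi> (W \<omega>) * (\<Sum>i\<in>I. T i \<omega>)) = (\<Sum>i\<in>I. expectation (\<lambda>\<omega>. \<psi> (W \<omega>) * T i \<omega>))"
    if "\<psi> \<in> borel_measurable borel" "\<And>x. \<bar>\<psi> x\<bar> \<le> 2" "\<And>i. i \<in> I \<Longrightarrow> T i \<in> borel_measurable M"
      "\<And>i \<omega>. i \<in> I \<Longrightarrow> \<omega> \<in> space M \<Longrightarrow> \<bar>T i \<omega>\<bar> \<le> C" for \<psi> T and C :: real
  proof -
    note [measurable] = that(1)
    show ?thesis
      unfolding sum_distrib_left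
      by (rule Bochner_Integration.integral_sum, rule integrable_mult_bounded[where B = 2 and C = C])
         (use that in auto)
  qed
  have "\<bar>2 * expectation (\<lambda>\<omega>. ?f (W \<omega>) * L \<omega>) - expectation (\<lambda>\<omega>. ?p (W \<omega>) * V \<omega>)\<bar>
    = \<bar>2 * expectation (\<lambda>\<omega>. ?f (W \<omega>) * (\<Sum>i\<in>I. D i \<omega>))
        - expectation (\<lambda>\<omega>. ?p (W \<omega>) * (\<Sum>i\<in>I. D i \<omega> * (W \<omega> - W (s i \<omega>))))\<bar>"
    by (subst L[of _ 2], simp, rule abs_stein_sol_le, subst V[of _ 2], simp, rule abs_stein_sol_deriv_le, rule refl)
  also have "\<dots> = \<bar>\<Sum>i\<in>I. 2 * expectation (\<lambda>\<omega>. ?f (W \<omega>) * D i \<omega>)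
        - expectation (\<lambda>\<omega>. ?p (W \<omega>) * (D i \<omega> * (W \<omega> - W (s i \<omega>))))\<bar>"
    using D_bound D_diff_bound abs_stein_sol_le abs_stein_sol_deriv_le
    by (subst sum_int[of _ _ b], simp_all, subst sum_int[of _ _ "b * (2 * b)"])
       (simp_all add: sum_subtractf sum_distrib_left)
  also have "\<dots> \<le> (\<Sum>i\<in>I. 2 * expectation (\<lambda>\<omega>. ?m (W \<omega>) * (\<bar>D i \<omega>\<bar> * (W \<omega> - W (s i \<omega>)))))"
    by (rule order.trans[OF sum_abs sum_mono]) (rule err)
  also have "\<dots> = 2 * expectation (\<lambda>\<omega>. ?m (W \<omega>) * (\<Sum>i\<in>I. \<bar>D i \<omega>\<bar> * (W \<omega> - W (s i \<omega>))))"
    using D_diff_bound abs_stein_modulus_le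
    by (subst sum_int[of _ _ "b * (2 * b)"]) (simp_all add: sum_distrib_left)
  also have "\<dots> = 2 * expectation (\<lambda>\<omega>. ?m (W \<omega>) * V' \<omega>)"
    by (subst V'[of _ 2], simp, rule abs_stein_modulus_le, rule refl)
  also have "\<dots> \<le> 2 * (2 * expectation (\<lambda>\<omega>. \<bar>V' \<omega>\<bar>))"
    using abs_expectation_mult_le[of "\<lambda>\<omega>. ?m (W \<omega>)" 2 V'] int abs_stein_modulus_le by simp
  finally have main: "\<bar>2 * expectation (\<lambda>\<omega>. ?f (W \<omega>) * L \<omega>) - expectation (\<lambda>\<omega>. ?p (W \<omega>) * V \<omega>)\<bar>
    \<le> 4 * expectation (\<lambda>\<omega>. \<bar>V' \<omega>\<bar>)" by simp

  have int_W: "integrable M W"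
    by (rule integrable_bounded_real[OF W_meas W_bound])
  have b1: "\<bar>expectation (\<lambda>\<omega>. ?p (W \<omega>) * (1 - V \<omega> / 2))\<bar> \<le> 2 * expectation (\<lambda>\<omega>. \<bar>1 - V \<omega> / 2\<bar>)"
    using int abs_stein_sol_deriv_le by (intro abs_expectation_mult_le) auto
  have b2: "\<bar>expectation (\<lambda>\<omega>. ?f (W \<omega>) * (W \<omega> - L \<omega>))\<bar> \<le> 2 * expectation (\<lambda>\<omega>. \<bar>W \<omega> - L \<omega>\<bar>)"
    using int int_W abs_stein_sol_le by (intro abs_expectation_mult_le) auto
  have mult_int: "integrable M (\<lambda>\<omega>. h (W \<omega>) * g \<omega>)"
    if "integrable M g" "h \<in> borel_measurable borel" "\<And>x. \<bar>h x\<bar> \<le> 2" for g h :: "_ \<Rightarrow> real"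
  proof -
    note [measurable] = that(2)
    show ?thesis
      by (rule integrable_bounded_mult[OF _ _ that(1), where B = 2]) (use that in auto)
  qed
  have "prob {\<omega> \<in> space M. W \<omega> \<le> z} - \<Phi> z = expectation (\<lambda>\<omega>. of_bool (W \<omega> \<le> z) - \<Phi> z)"
  proof -
    have "expectation (\<lambda>\<omega>. of_bool (W \<omega> \<le> z) :: real) = expectation (indicator {\<omega> \<in> space M. W \<omega> \<le> z})"
      by (rule Bochner_Integration.integral_cong) (auto simp: indicator_def)
    moreover have "integrable M (\<lambda>\<omega>. of_bool (W \<omega> \<le> z) :: real)"
      by (rule integrable_bounded_real[where B = 1]) auto
    ultimately show ?thesis
      by (simp add: prob_space)
  qed
  \<comment> \<open>Stein's equation for the centred indicator, with 1 split into (1 - V/2) + V/2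
    and W into L + (W - L). The two terms with \<open>V\<close> and \<open>L\<close> alone are those
    compared in \<open>main\<close>.\<close>
  also have "\<dots> = expectation (\<lambda>\<omega>. ?p (W \<omega>) * (1 - V \<omega> / 2) + ?p (W \<omega>) * V \<omega> / 2
      - ?f (W \<omega>) * L \<omega> - ?f (W \<omega>) * (W \<omega> - L \<omega>))"
    by (rule Bochner_Integration.integral_cong) (simp_all add: stein_sol_deriv_def field_simps)
  also have "\<dots> = expectation (\<lambda>\<omega>. ?p (W \<omega>) * (1 - V \<omega> / 2)) + expectation (\<lambda>\<omega>. ?p (W \<omega>) * V \<omega>) / 2
      - expectation (\<lambda>\<omega>. ?f (W \<omega>) * L \<omega>) - expectation (\<lambda>\<omega>. ?f (W \<omega>) * (W \<omega> - L \<omega>))"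
    using mult_int[of "\<lambda>\<omega>. 1 - V \<omega> / 2" ?p] mult_int[of V ?p] mult_int[of L ?f] mult_int[of "\<lambda>\<omega>. W \<omega> - L \<omega>" ?f]
      int int_W abs_stein_sol_le abs_stein_sol_deriv_le
    by simp
  finally show ?thesis
    using main b1 b2 by linarith
qed

section \<open>Resampling coordinates of a product space\<close>

context finite_product_prob_space
begin

lemma measurable_resample:
  assumes j: "j \<in> I"
  shows "(\<lambda>(u, x). u(j := x)) \<in> measurable (Pi\<^sub>M I M \<Otimes>\<^sub>M M j) (Pi\<^sub>M I M)"
  unfolding split_beta'
  by (rule measurable_fun_upd[where J = I]) (use j in auto)

lemma measurable_resample_const:
  assumes j: "j \<in> I" and x: "x \<in> space (M j)"
  shows "(\<lambda>u. u(j := x)) \<in> measurable (Pi\<^sub>M I M) (Pi\<^sub>M I M)"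
  by (rule measurable_fun_upd[where J = I]) (use j x in auto)

lemma measurable_mix:
  "(\<lambda>(u, v). \<lambda>j\<in>I. if j \<in> K then v j else u j) \<in> measurable (Pi\<^sub>M I M \<Otimes>\<^sub>M Pi\<^sub>M I M) (Pi\<^sub>M I M)"
  unfolding split_beta'
proof (rule measurable_restrict)
  fix j assume "j \<in> I"
  then show "(\<lambda>x. if j \<in> K then snd x j else fst x j) \<in> measurable (Pi\<^sub>M I M \<Otimes>\<^sub>M Pi\<^sub>M I M) (M j)"
    by (cases "j \<in> K") simp_all
qed

text \<open>The preimage of a rectangle is a product of two rectangles. Each coordinate is
  constrained in exactly one of them and contributes a full space of measure 1 to the other.\<close>

lemma distr_mix:
  "distr (Pi\<^sub>M I M \<Otimes>\<^sub>M Pi\<^sub>M I M) (Pi\<^sub>M I M) (\<lambda>(u, v). \<lambda>j\<in>I. if j \<in> K then v j else u j) = Pi\<^sub>M I M"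
  (is "distr ?Q _ ?f = _")
proof (rule PiM_eqI)
  fix A assume A: "\<And>i. i \<in> I \<Longrightarrow> A i \<in> sets (M i)"
  define B where "B i = (if i \<in> K then space (M i) else A i)" for i
  define C where "C i = (if i \<in> K then A i else space (M i))" for i
  have BC: "i \<in> I \<Longrightarrow> B i \<in> sets (M i)" "i \<in> I \<Longrightarrow> C i \<in> sets (M i)" for i
    using A by (auto simp: B_def C_def)
  have "?f -` (\<Pi>\<^sub>E i\<in>I. A i) \<inter> space ?Q = (\<Pi>\<^sub>E i\<in>I. B i) \<times> (\<Pi>\<^sub>E i\<in>I. C i)"
    using A[THEN sets.sets_into_space]
    by (auto simp: B_def C_def space_pair_measure space_PiM PiE_iff split: if_splits) blast+
  then have "distr ?Q (Pi\<^sub>M I M) ?f (\<Pi>\<^sub>E i\<in>I. A i) = emeasure ?Q ((\<Pi>\<^sub>E i\<in>I. B i) \<times> (\<Pi>\<^sub>E i\<in>I. C i))"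
    using A by (subst emeasure_distr) (auto intro!: measurable_mix sets_PiM_I_finite finite_index)
  also have "\<dots> = emeasure (Pi\<^sub>M I M) (\<Pi>\<^sub>E i\<in>I. B i) * emeasure (Pi\<^sub>M I M) (\<Pi>\<^sub>E i\<in>I. C i)"
    using BC by (intro emeasure_pair_measure_Times) (auto intro!: sets_PiM_I_finite finite_index)
  also have "\<dots> = (\<Prod>i\<in>I. emeasure (M i) (B i)) * (\<Prod>i\<in>I. emeasure (M i) (C i))"
    using BC by (simp add: measure_times)
  also have "\<dots> = (\<Prod>i\<in>I. emeasure (M i) (A i))"
    unfolding prod.distrib[symmetric]
    by (rule prod.cong) (auto simp: B_def C_def M.emeasure_space_1)
  finally show "distr ?Q (Pi\<^sub>M I M) ?f (\<Pi>\<^sub>E i\<in>I. A i) = (\<Prod>i\<in>I. emeasure (M i) (A i))" .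
qed (auto intro: finite_index)

lemma distr_resample:
  assumes j: "j \<in> I"
  shows "distr (Pi\<^sub>M I M \<Otimes>\<^sub>M M j) (Pi\<^sub>M I M) (\<lambda>(u, x). u(j := x)) = Pi\<^sub>M I M"
  (is "distr ?Q _ ?f = _")
proof (rule PiM_eqI)
  fix A assume A: "\<And>i. i \<in> I \<Longrightarrow> A i \<in> sets (M i)"
  define B where "B i = (if i = j then space (M i) else A i)" for i
  have B: "i \<in> I \<Longrightarrow> B i \<in> sets (M i)" for i
    using A by (auto simp: B_def)
  have "?f -` (\<Pi>\<^sub>E i\<in>I. A i) \<inter> space ?Q = (\<Pi>\<^sub>E i\<in>I. B i) \<times> A j"
    using A[THEN sets.sets_into_space] j
    by (auto simp: B_def space_pair_measure space_PiM PiE_iff extensional_def split: if_splits) blast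
  then have "distr ?Q (Pi\<^sub>M I M) ?f (\<Pi>\<^sub>E i\<in>I. A i) = emeasure ?Q ((\<Pi>\<^sub>E i\<in>I. B i) \<times> A j)"
    using A j by (subst emeasure_distr) (auto intro!: measurable_resample sets_PiM_I_finite finite_index)
  also have "\<dots> = emeasure (Pi\<^sub>M I M) (\<Pi>\<^sub>E i\<in>I. B i) * emeasure (M j) (A j)"
    using A B j by (intro M.emeasure_pair_measure_Times) (auto intro!: sets_PiM_I_finite finite_index)
  also have "\<dots> = (\<Prod>i\<in>I. emeasure (M i) (B i)) * emeasure (M j) (A j)"
    using B by (simp add: measure_times)
  also have "\<dots> = (\<Prod>i\<in>I. emeasure (M i) (A i))"
  proof -
    have "(\<Prod>i\<in>I. emeasure (M i) (B i)) = (\<Prod>i\<in>I - {j}. emeasure (M i) (A i))"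
      using j finite_index by (subst prod.remove[of I j]) (auto simp: B_def M.emeasure_space_1)
    then show ?thesis
      using j finite_index by (subst prod.remove[of I j]) (auto simp: mult.commute)
  qed
  finally show "distr ?Q (Pi\<^sub>M I M) ?f (\<Pi>\<^sub>E i\<in>I. A i) = (\<Prod>i\<in>I. emeasure (M i) (A i))" .
qed (auto intro: finite_index)

lemma measurable_exchange:
  assumes j: "j \<in> I"
  shows "(\<lambda>(u, x). (u(j := x), u j)) \<in> measurable (Pi\<^sub>M I M \<Otimes>\<^sub>M M j) (Pi\<^sub>M I M \<Otimes>\<^sub>M M j)"
  using measurable_resample[OF j] j by (auto simp: split_beta')

text \<open>The source of exchangeability: the map trades coordinate j for the fresh value and is an
  involution. On a rectangle the claim reduces to the independence of \<open>u(j := x)\<close> and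
  \<open>u j\<close>.\<close>

lemma distr_exchange:
  assumes j: "j \<in> I"
  shows "distr (Pi\<^sub>M I M \<Otimes>\<^sub>M M j) (Pi\<^sub>M I M \<Otimes>\<^sub>M M j) (\<lambda>(u, x). (u(j := x), u j)) = Pi\<^sub>M I M \<Otimes>\<^sub>M M j"
  (is "distr ?Q _ ?s = _")
proof (rule sym, rule pair_measure_eqI)
  interpret Q: pair_sigma_finite "Pi\<^sub>M I M" "M j" ..
  fix A B assume AB: "A \<in> sets (Pi\<^sub>M I M)" "B \<in> sets (M j)"
  let ?r = "\<lambda>(u, x). u(j := x)"
  have mA: "(\<lambda>z. indicator A (?r z) :: ennreal) \<in> borel_measurable ?Q"
    by (rule measurable_compose[OF measurable_resample[OF j] borel_measurable_indicator[OF AB(1)]])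
  have mA': "(\<lambda>u. indicator A (u(j := x)) :: ennreal) \<in> borel_measurable (Pi\<^sub>M I M)" if "x \<in> space (M j)" for x
    by (rule measurable_compose[OF measurable_resample_const[OF j that] borel_measurable_indicator[OF AB(1)]])
  have mB: "(\<lambda>u. indicator B (u j) :: ennreal) \<in> borel_measurable (Pi\<^sub>M I M)"
    using measurable_compose[where f = "\<lambda>u. u j", OF measurable_component_singleton[where M = M, OF j] borel_measurable_indicator[OF AB(2)]] .
  have mB': "(\<lambda>z. indicator B (fst z j) :: ennreal) \<in> borel_measurable ?Q"
    by (rule measurable_compose[OF measurable_fst mB])
  have mAB: "(\<lambda>z. indicator A (?r z) * indicator B (fst z j) :: ennreal) \<in> borel_measurable ?Q"
    by (rule borel_measurable_times_ennreal[OF mA mB'])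
  \<comment> \<open>For fixed x the set A is tested on a vector that forgets coordinate j, so
    resampling that coordinate separates the two factors.\<close>
  have inner: "(\<integral>\<^sup>+u. indicator A (u(j := x)) * indicator B (u j) \<partial>Pi\<^sub>M I M)
      = (\<integral>\<^sup>+u. indicator A (u(j := x)) \<partial>Pi\<^sub>M I M) * emeasure (M j) B" if x: "x \<in> space (M j)" for x
  proof -
    have m: "(\<lambda>u. indicator A (u(j := x)) * indicator B (u j) :: ennreal) \<in> borel_measurable (Pi\<^sub>M I M)"
      by (rule borel_measurable_times_ennreal[OF mA'[OF x] mB])
    have m': "(\<lambda>z. indicator A ((fst z)(j := x)) * indicator B (snd z) :: ennreal) \<in> borel_measurable ?Q"
      by (intro borel_measurable_times_ennreal measurable_compose[OF measurable_fst mA'[OF x]]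
          measurable_compose[OF measurable_snd borel_measurable_indicator] AB)
    have "(\<integral>\<^sup>+u. indicator A (u(j := x)) * indicator B (u j) \<partial>Pi\<^sub>M I M)
        = (\<integral>\<^sup>+z. indicator A ((?r z)(j := x)) * indicator B ((?r z) j) \<partial>?Q)"
      using nn_integral_distr[OF measurable_resample[OF j], of "\<lambda>u. indicator A (u(j := x)) * indicator B (u j)"] m
      by (simp add: distr_resample[OF j])
    also have "\<dots> = (\<integral>\<^sup>+z. indicator A ((fst z)(j := x)) * indicator B (snd z) \<partial>?Q)"
      by (rule nn_integral_cong) (simp add: split_beta')
    also have "\<dots> = (\<integral>\<^sup>+u. (\<integral>\<^sup>+y. indicator A (u(j := x)) * indicator B y \<partial>M j) \<partial>Pi\<^sub>M I M)"
      using M.nn_integral_fst[OF m'] by simp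
    also have "\<dots> = (\<integral>\<^sup>+u. indicator A (u(j := x)) * emeasure (M j) B \<partial>Pi\<^sub>M I M)"
      using AB by (simp add: nn_integral_cmult)
    also have "\<dots> = (\<integral>\<^sup>+u. indicator A (u(j := x)) \<partial>Pi\<^sub>M I M) * emeasure (M j) B"
      by (rule nn_integral_multc[OF mA'[OF x]])
    finally show ?thesis .
  qed
  have "emeasure (distr ?Q ?Q ?s) (A \<times> B) = (\<integral>\<^sup>+z. indicator (A \<times> B) (?s z) \<partial>?Q)"
    using nn_integral_distr[OF measurable_exchange[OF j], of "indicator (A \<times> B)"] AB by simp
  also have "\<dots> = (\<integral>\<^sup>+z. indicator A (?r z) * indicator B (fst z j) \<partial>?Q)"
    by (rule nn_integral_cong) (simp add: indicator_times split_beta')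
  also have "\<dots> = (\<integral>\<^sup>+x. (\<integral>\<^sup>+u. indicator A (u(j := x)) * indicator B (u j) \<partial>Pi\<^sub>M I M) \<partial>M j)"
    using Q.nn_integral_snd[OF mAB] by simp
  also have "\<dots> = (\<integral>\<^sup>+x. (\<integral>\<^sup>+u. indicator A (u(j := x)) \<partial>Pi\<^sub>M I M) * emeasure (M j) B \<partial>M j)"
    by (rule nn_integral_cong) (rule inner)
  also have "\<dots> = (\<integral>\<^sup>+x. (\<integral>\<^sup>+u. indicator A (u(j := x)) \<partial>Pi\<^sub>M I M) \<partial>M j) * emeasure (M j) B"
    using borel_measurable_nn_integral_fst[OF measurable_pair_swap[OF mA]] by (intro nn_integral_multc) simp
  also have "(\<integral>\<^sup>+x. (\<integral>\<^sup>+u. indicator A (u(j := x)) \<partial>Pi\<^sub>M I M) \<partial>M j) = (\<integral>\<^sup>+z. indicator A (?r z) \<partial>?Q)"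
    using Q.nn_integral_snd[OF mA] by simp
  also have "\<dots> = emeasure (Pi\<^sub>M I M) A"
    using nn_integral_distr[OF measurable_resample[OF j], of "indicator A"] AB by (simp add: distr_resample[OF j])
  finally show "emeasure (Pi\<^sub>M I M) A * emeasure (M j) B = emeasure (distr ?Q ?Q ?s) (A \<times> B)" ..
qed (auto intro: sigma_finite_measure_axioms M.sigma_finite_measure_axioms)

text \<open>The coordinates in \<open>S - {j}\<close> are replaced by an independent copy: this leaves \<open>g\<close> unchanged and
  averages \<open>h\<close> to zero.\<close>

lemma integral_mult_eq_0:
  fixes h g :: "_ \<Rightarrow> real"
  assumes j: "j \<in> I"
    and [measurable]: "h \<in> borel_measurable (Pi\<^sub>M I M)" "g \<in> borel_measurable (Pi\<^sub>M I M)"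
    and bounded: "\<And>u. u \<in> space (Pi\<^sub>M I M) \<Longrightarrow> \<bar>h u\<bar> \<le> B" "\<And>u. u \<in> space (Pi\<^sub>M I M) \<Longrightarrow> \<bar>g u\<bar> \<le> B"
    and h: "\<And>u v. u \<in> space (Pi\<^sub>M I M) \<Longrightarrow> v \<in> space (Pi\<^sub>M I M) \<Longrightarrow> (\<And>i. i \<in> S \<Longrightarrow> u i = v i) \<Longrightarrow> h u = h v"
    and g: "\<And>u v. u \<in> space (Pi\<^sub>M I M) \<Longrightarrow> v \<in> space (Pi\<^sub>M I M) \<Longrightarrow> (\<And>i. i \<in> S' \<Longrightarrow> u i = v i) \<Longrightarrow> g u = g v"
    and S: "S \<subseteq> I" "S' \<subseteq> I" "S \<inter> S' \<subseteq> {j}"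
    and zero: "\<And>x. x \<in> space (M j) \<Longrightarrow> (\<integral>u. h (u(j := x)) \<partial>Pi\<^sub>M I M) = 0"
  shows "(\<integral>u. h u * g u \<partial>Pi\<^sub>M I M) = 0"
proof -
  interpret Q: pair_prob_space "Pi\<^sub>M I M" "Pi\<^sub>M I M" ..
  define f where "f = (\<lambda>(u, v). \<lambda>i\<in>I. if i \<in> S - {j} then v i else (u i :: 'b))"
  note [measurable] = measurable_mix[of "S - {j}", folded f_def]
  have B: "0 \<le> B"
    using bounded(1) not_empty order.trans[OF abs_ge_zero] by blast
  have f_space: "f (u, v) \<in> space (Pi\<^sub>M I M)" if "u \<in> space (Pi\<^sub>M I M)" "v \<in> space (Pi\<^sub>M I M)" for u v
    using that by (auto simp: f_def space_PiM)
  have bnd: "\<bar>h u * g u\<bar> \<le> B * B" if "u \<in> space (Pi\<^sub>M I M)" for u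
    using bounded[OF that] B by (auto simp: abs_mult intro!: mult_mono)
  have "(\<integral>u. h u * g u \<partial>Pi\<^sub>M I M) = (\<integral>z. h (f z) * g (f z) \<partial>(Pi\<^sub>M I M \<Otimes>\<^sub>M Pi\<^sub>M I M))"
    by (subst distr_mix[of "S - {j}", folded f_def, symmetric], subst integral_distr) auto
  also have "\<dots> = (\<integral>u. (\<integral>v. h (f (u, v)) * g (f (u, v)) \<partial>Pi\<^sub>M I M) \<partial>Pi\<^sub>M I M)"
  proof (rule Q.integral_fst'[symmetric], rule Q.integrable_const_bound[where B = "B * B"])
    show "AE z in Pi\<^sub>M I M \<Otimes>\<^sub>M Pi\<^sub>M I M. norm (h (f z) * g (f z)) \<le> B * B"
      using bnd f_space by (intro AE_I2) (auto simp: space_pair_measure)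
  qed simp
  also have "\<dots> = (\<integral>u. 0 \<partial>Pi\<^sub>M I M)"
  proof (rule Bochner_Integration.integral_cong[OF refl])
    fix u assume u: "u \<in> space (Pi\<^sub>M I M)"
    have uj: "u j \<in> space (M j)" using u j by (auto simp: space_PiM)
    have "(\<integral>v. h (f (u, v)) * g (f (u, v)) \<partial>Pi\<^sub>M I M) = (\<integral>v. h (v(j := u j)) * g u \<partial>Pi\<^sub>M I M)"
    proof (rule Bochner_Integration.integral_cong[OF refl])
      fix v assume v: "v \<in> space (Pi\<^sub>M I M)"
      have "v(j := u j) \<in> space (Pi\<^sub>M I M)"
        using measurable_space[OF measurable_resample_const[OF j uj] v] .
      \<comment> \<open>On S both arguments take coordinate j from u and the others from v. The
        kernel g reads S', which avoids every replaced coordinate.\<close>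
      then have "h (f (u, v)) = h (v(j := u j))"
        using f_space[OF u v] S j by (intro h) (auto simp: f_def)
      moreover have "g (f (u, v)) = g u"
        using f_space[OF u v] u S by (intro g) (auto simp: f_def)
      ultimately show "h (f (u, v)) * g (f (u, v)) = h (v(j := u j)) * g u" by simp
    qed
    then show "(\<integral>v. h (f (u, v)) * g (f (u, v)) \<partial>Pi\<^sub>M I M) = 0"
      using zero[OF uj] by simp
  qed
  finally show ?thesis by simp
qed

end

section \<open>A Berry-Esseen bound for generalized U-statistics\<close>

lemma card_supersets:
  assumes "finite S" "D \<subseteq> S" "card D \<le> k"
  shows "card {A. A \<subseteq> S \<and> card A = k \<and> D \<subseteq> A} = (card S - card D) choose (k - card D)"
proof -
  have fD: "finite D" using assms finite_subset by blast
  have "bij_betw (\<lambda>A. A - D) {A. A \<subseteq> S \<and> card A = k \<and> D \<subseteq> A} {A. A \<subseteq> S - D \<and> card A = k - card D}"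
  proof (rule bij_betw_byWitness[where f' = "\<lambda>A. A \<union> D"])
    show "(\<lambda>A. A - D) ` {A. A \<subseteq> S \<and> card A = k \<and> D \<subseteq> A} \<subseteq> {A. A \<subseteq> S - D \<and> card A = k - card D}"
      using fD by (auto simp: card_Diff_subset)
    show "(\<lambda>A. A \<union> D) ` {A. A \<subseteq> S - D \<and> card A = k - card D} \<subseteq> {A. A \<subseteq> S \<and> card A = k \<and> D \<subseteq> A}"
    proof safe
      fix A assume A: "A \<subseteq> S - D" "card A = k - card D"
      have "card (A \<union> D) = card A + card D"
        using A fD finite_subset[of A S] assms by (intro card_Un_disjoint) auto
      then show "card (A \<union> D) = k" using A assms by simp
    qed (use assms in auto)
  qed auto
  then have "card {A. A \<subseteq> S \<and> card A = k \<and> D \<subseteq> A} = card {A. A \<subseteq> S - D \<and> card A = k - card D}"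
    by (rule bij_betw_same_card)
  also have "\<dots> = card (S - D) choose (k - card D)"
    using assms by (intro n_subsets) auto
  finally show ?thesis using assms fD by (simp add: card_Diff_subset)
qed

lemma card_k_subsets_containing:
  fixes n k :: nat
  assumes "i \<in> {1..n}" "1 \<le> k"
  shows "real (card {A. A \<subseteq> {1..n} \<and> card A = k \<and> i \<in> A}) * n = real (n choose k) * k"
proof -
  have "card {A. A \<subseteq> {1..n} \<and> card A = k \<and> i \<in> A} = (n - 1) choose (k - 1)"
    using card_supersets[of "{1..n}" "{i}" k] assms by simp
  moreover have "k * (n choose k) = n * ((n - 1) choose (k - 1))"
    using assms by (intro times_binomial_minus1_eq) simp
  ultimately show ?thesis
    unfolding of_nat_mult[symmetric] of_nat_eq_iff by (simp add: mult.commute)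
qed

text \<open>Written without division and with real subtraction, so that k = 1 fits the same formula
  with both sides zero.\<close>

lemma card_k_subsets_containing_two:
  fixes n k :: nat
  assumes "i \<in> {1..n}" "j \<in> {1..n}" "i \<noteq> j" "1 \<le> k"
  shows "real (card {A. A \<subseteq> {1..n} \<and> card A = k \<and> i \<in> A \<and> j \<in> A}) * (real n * (real n - 1)) =
    real (n choose k) * (real k * (real k - 1))"
proof (cases "k = 1")
  case True
  then have "{A. A \<subseteq> {1..n} \<and> card A = k \<and> i \<in> A \<and> j \<in> A} = {}"
    using assms(3) by (auto simp: card_1_singleton_iff)
  with True show ?thesis by (simp only: card.empty) simp
next
  case False
  have n2: "2 \<le> n" using assms by (cases "n < 2") auto
  have "card {A. A \<subseteq> {1..n} \<and> card A = k \<and> i \<in> A \<and> j \<in> A} = (n - 2) choose (k - 2)"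
    using card_supersets[of "{1..n}" "{i, j}" k] assms False by (simp add: numeral_2_eq_2)
  moreover have "k * (n choose k) = n * ((n - 1) choose (k - 1))"
    using assms by (intro times_binomial_minus1_eq) simp
  moreover have "(k - 1) * ((n - 1) choose (k - 1)) = (n - 1) * ((n - 2) choose (k - 2))"
    using assms False times_binomial_minus1_eq[of "k - 1" "n - 1"] by (simp add: numeral_2_eq_2)
  ultimately have "card {A. A \<subseteq> {1..n} \<and> card A = k \<and> i \<in> A \<and> j \<in> A} * (n * (n - 1)) = (n choose k) * (k * (k - 1))"
    by (metis mult.assoc mult.commute)
  then have "real (card {A. A \<subseteq> {1..n} \<and> card A = k \<and> i \<in> A \<and> j \<in> A} * (n * (n - 1))) = real ((n choose k) * (k * (k - 1)))"
    by (rule arg_cong)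
  then show ?thesis using assms(4) n2 by (simp add: of_nat_diff)
qed

lemma ex_ne_if_two_le_card:
  assumes "2 \<le> card A"
  shows "\<exists>j\<in>A. j \<noteq> i"
proof (rule ccontr)
  assume "\<not> ?thesis"
  then have "A \<subseteq> {i}" by blast
  then have "card A \<le> card {i}" by (intro card_mono) auto
  then show False using assms by simp
qed

lemma sum_filter_of_bool:
  "finite A \<Longrightarrow> (\<Sum>a\<in>{a \<in> A. Q a}. f a) = (\<Sum>a\<in>A. of_bool (Q a) * (f a :: real))"
  by (simp only: sum.inter_filter) (rule sum.cong, auto)

lemma sum_swap3:
  "(\<Sum>a\<in>A. \<Sum>b\<in>B. \<Sum>i\<in>C. f a b i) = (\<Sum>i\<in>C. \<Sum>a\<in>A. \<Sum>b\<in>B. (f a b i :: real))"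
proof -
  have "(\<Sum>a\<in>A. \<Sum>b\<in>B. \<Sum>i\<in>C. f a b i) = (\<Sum>a\<in>A. \<Sum>i\<in>C. \<Sum>b\<in>B. f a b i)"
    by (rule sum.cong[OF refl], rule sum.swap)
  also have "\<dots> = (\<Sum>i\<in>C. \<Sum>a\<in>A. \<Sum>b\<in>B. f a b i)"
    by (rule sum.swap)
  finally show ?thesis .
qed

text \<open>\<open>I\<close> may contain more coordinates than nodes; \<open>coords a\<close> is
  what the kernel \<open>\<phi> a\<close> reads, and \<open>supp a\<close> is its set of nodes.
  \<open>coords_Int\<close> says that kernels with at most one common node have no further
  coordinate in common. \<open>\<phi>_proj\<close> asks for one projection \<open>f1\<close>, the
  same for all kernels and all their nodes; this is where the symmetry of a U-statistic
  enters.\<close>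

locale u_statistic = finite_product_prob_space M I
  for M :: "'i \<Rightarrow> 'b measure" and I :: "'i set" +
  fixes U :: "'b measure" and node :: "nat \<Rightarrow> 'i" and n k :: nat
    and idx :: "'c set" and supp :: "'c \<Rightarrow> nat set" and coords :: "'c \<Rightarrow> 'i set"
    and \<phi> :: "'c \<Rightarrow> ('i \<Rightarrow> 'b) \<Rightarrow> real" and f1 :: "'b \<Rightarrow> real" and B :: real
  assumes inj_node: "inj_on node {1..n}"
    and node_in: "\<And>i. i \<in> {1..n} \<Longrightarrow> node i \<in> I"
    and M_node: "\<And>i. i \<in> {1..n} \<Longrightarrow> M (node i) = U"
    and k_pos: "1 \<le> k" and k_le: "k \<le> n"
    and supp_bij: "bij_betw supp idx {A. A \<subseteq> {1..n} \<and> card A = k}"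
    and coords_sub: "\<And>a. a \<in> idx \<Longrightarrow> coords a \<subseteq> I"
    and node_coords: "\<And>a i. a \<in> idx \<Longrightarrow> i \<in> {1..n} \<Longrightarrow> node i \<in> coords a \<longleftrightarrow> i \<in> supp a"
    and coords_Int: "\<And>a b i. a \<in> idx \<Longrightarrow> b \<in> idx \<Longrightarrow> i \<in> {1..n} \<Longrightarrow> supp a \<inter> supp b \<subseteq> {i} \<Longrightarrow>
      coords a \<inter> coords b \<subseteq> {node i}"
    and \<phi>_meas: "\<And>a. a \<in> idx \<Longrightarrow> \<phi> a \<in> borel_measurable (Pi\<^sub>M I M)"
    and \<phi>_bound: "\<And>a u. a \<in> idx \<Longrightarrow> u \<in> space (Pi\<^sub>M I M) \<Longrightarrow> \<bar>\<phi> a u\<bar> \<le> B"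
    and \<phi>_coords: "\<And>a u v. a \<in> idx \<Longrightarrow> u \<in> space (Pi\<^sub>M I M) \<Longrightarrow> v \<in> space (Pi\<^sub>M I M) \<Longrightarrow>
      (\<And>j. j \<in> coords a \<Longrightarrow> u j = v j) \<Longrightarrow> \<phi> a u = \<phi> a v"
    and \<phi>_proj: "\<And>a i x. a \<in> idx \<Longrightarrow> i \<in> supp a \<Longrightarrow> x \<in> space U \<Longrightarrow> (\<integral>u. \<phi> a (u(node i := x)) \<partial>Pi\<^sub>M I M) = f1 x"
    and f1_meas: "f1 \<in> borel_measurable U"
    and f1_bound: "\<And>x. x \<in> space U \<Longrightarrow> \<bar>f1 x\<bar> \<le> B"
begin

abbreviation "P \<equiv> Pi\<^sub>M I M"

lemma one_in: "1 \<in> {1..n}"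
  using k_pos k_le by simp

lemma prob_space_U: "prob_space U"
  using M.prob_space_axioms[of "node 1"] M_node[OF one_in] by simp

lemma measurable_node [measurable]: "i \<in> {1..n} \<Longrightarrow> (\<lambda>u. u (node i)) \<in> measurable P U"
  using measurable_component_singleton[OF node_in, of i M] M_node[of i] by simp

lemma integral_node:
  fixes f :: "'b \<Rightarrow> real"
  assumes i: "i \<in> {1..n}" and f: "f \<in> borel_measurable U"
  shows "(\<integral>u. f (u (node i)) \<partial>P) = integral\<^sup>L U f"
proof -
  have "distr P U (\<lambda>u. u (node i)) = U"
    using distr_PiM_component[of I M "node i"] M.prob_space_axioms node_in[OF i] M_node[OF i] finite_index
    by simp
  then show ?thesis
    using integral_distr[OF measurable_node[OF i] f] by simp
qed

lemma node_space: "u \<in> space P \<Longrightarrow> i \<in> {1..n} \<Longrightarrow> u (node i) \<in> space U"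
  using measurable_space[OF measurable_node] by blast

lemma resample_space:
  "u \<in> space P \<Longrightarrow> i \<in> {1..n} \<Longrightarrow> x \<in> space U \<Longrightarrow> u(node i := x) \<in> space P"
  using measurable_space[OF measurable_resample_const[OF node_in]] M_node by blast

lemma supp_sub: "a \<in> idx \<Longrightarrow> supp a \<subseteq> {1..n}"
  using bij_betwE[OF supp_bij] by blast

lemma finite_supp: "a \<in> idx \<Longrightarrow> finite (supp a)"
  using supp_sub finite_subset by blast

lemma card_supp: "a \<in> idx \<Longrightarrow> card (supp a) = k"
  using bij_betwE[OF supp_bij] by blast

lemma finite_idx: "finite idx"
  using bij_betw_finite[OF supp_bij] by simp

lemma card_idx: "card idx = n choose k"
  using bij_betw_same_card[OF supp_bij] n_subsets[of "{1..n}" k] by simp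

lemma card_idx_supp: "card {a \<in> idx. Q (supp a)} = card {A. A \<subseteq> {1..n} \<and> card A = k \<and> Q A}"
proof -
  have "bij_betw supp {a \<in> idx. Q (supp a)} {A. A \<subseteq> {1..n} \<and> card A = k \<and> Q A}"
  proof (rule bij_betw_imageI)
    show "inj_on supp {a \<in> idx. Q (supp a)}"
      using supp_bij by (auto simp: bij_betw_def intro: inj_on_subset)
    show "supp ` {a \<in> idx. Q (supp a)} = {A. A \<subseteq> {1..n} \<and> card A = k \<and> Q A}"
    proof
      show "{A. A \<subseteq> {1..n} \<and> card A = k \<and> Q A} \<subseteq> supp ` {a \<in> idx. Q (supp a)}"
      proof
        fix A assume A: "A \<in> {A. A \<subseteq> {1..n} \<and> card A = k \<and> Q A}"
        then have "A \<in> supp ` idx" using supp_bij by (simp add: bij_betw_def)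
        with A show "A \<in> supp ` {a \<in> idx. Q (supp a)}" by blast
      qed
    qed (use supp_sub card_supp in auto)
  qed
  then show ?thesis by (rule bij_betw_same_card)
qed

section \<open>The Hoeffding remainder and its orthogonality\<close>

definition mu :: real where "mu = integral\<^sup>L U f1"

definition sd :: real where "sd = sqrt (\<integral>x. (f1 x - mu)\<^sup>2 \<partial>U)"

text \<open>What is left of a kernel after its mean and its first-order Hoeffding terms; the
  dependence on coordinates other than nodes is entirely in here.\<close>

definition rem_kernel :: "'c \<Rightarrow> ('i \<Rightarrow> 'b) \<Rightarrow> real" where
  "rem_kernel a u = \<phi> a u - mu - (\<Sum>i\<in>supp a. f1 (u (node i)) - mu)"

lemma B_nonneg: "0 \<le> B"
proof -
  interpret U: prob_space U by (rule prob_space_U)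
  show ?thesis using f1_bound U.not_empty order.trans[OF abs_ge_zero] by blast
qed

lemma abs_mu_le: "\<bar>mu\<bar> \<le> B"
proof -
  interpret U: prob_space U by (rule prob_space_U)
  show ?thesis
    using U.abs_expectation_mult_le[OF f1_meas f1_bound, of "\<lambda>_. 1"] by (simp add: mu_def U.prob_space)
qed

lemma abs_f1_centered_le: "x \<in> space U \<Longrightarrow> \<bar>f1 x - mu\<bar> \<le> 2 * B"
  using f1_bound[of x] abs_mu_le by simp

lemma integrable_f1: "integrable U f1"
proof -
  interpret U: prob_space U by (rule prob_space_U)
  show ?thesis by (rule U.integrable_bounded_real[OF f1_meas f1_bound])
qed

lemma rem_kernel_meas [measurable]: "a \<in> idx \<Longrightarrow> rem_kernel a \<in> borel_measurable P"
proof -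
  assume a: "a \<in> idx"
  have "(\<lambda>u. f1 (u (node i))) \<in> borel_measurable P" if "i \<in> supp a" for i
    using measurable_compose[OF measurable_node f1_meas] supp_sub[OF a] that by blast
  then show ?thesis
    unfolding rem_kernel_def[abs_def] using \<phi>_meas[OF a] by simp
qed

lemma abs_rem_kernel_le:
  assumes "a \<in> idx" "u \<in> space P"
  shows "\<bar>rem_kernel a u\<bar> \<le> 2 * B * (real k + 1)"
proof -
  have "\<bar>\<Sum>i\<in>supp a. f1 (u (node i)) - mu\<bar> \<le> (\<Sum>i\<in>supp a. 2 * B)"
    using assms supp_sub node_space
    by (intro order.trans[OF sum_abs sum_mono] abs_f1_centered_le) blast
  then show ?thesis
    using \<phi>_bound[OF assms] abs_mu_le card_supp[OF assms(1)]
    by (simp add: rem_kernel_def algebra_simps)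
qed

lemma rem_kernel_coords:
  assumes a: "a \<in> idx" and "u \<in> space P" "v \<in> space P" "\<And>j. j \<in> coords a \<Longrightarrow> u j = v j"
  shows "rem_kernel a u = rem_kernel a v"
proof -
  have "u (node i) = v (node i)" if "i \<in> supp a" for i
    using assms(4) node_coords[OF a, of i] supp_sub[OF a] that by blast
  then show ?thesis
    unfolding rem_kernel_def using \<phi>_coords[OF assms] by simp
qed

text \<open>With node i fixed, the kernel averages to \<open>f1 x\<close>; among the linear terms
  that of i is fixed at \<open>f1 x - mu\<close> and the others average to zero, so everything
  cancels.\<close>

lemma rem_kernel_proj:
  assumes a: "a \<in> idx" and i: "i \<in> supp a" and x: "x \<in> space U"
  shows "(\<integral>u. rem_kernel a (u(node i := x)) \<partial>P) = 0"
proof -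
  have i': "i \<in> {1..n}" using supp_sub[OF a] i by blast
  have x': "x \<in> space (M (node i))" using x M_node[OF i'] by simp
  note m = measurable_resample_const[OF node_in[OF i'] x']
  have int_\<phi>: "integrable P (\<lambda>u. \<phi> a (u(node i := x)))"
    using measurable_compose[OF m \<phi>_meas[OF a]] \<phi>_bound[OF a measurable_space[OF m]]
    by (intro integrable_bounded_real[of _ B]) auto
  have f1_upd: "f1 ((u(node i := x)) (node j)) = (if j = i then f1 x else f1 (u (node j)))"
    if "j \<in> supp a" for u j
  proof -
    have "j \<in> {1..n}" using supp_sub[OF a] that by blast
    then show ?thesis using inj_on_eq_iff[OF inj_node _ i', of j] by simp
  qed
  have int_node: "integrable P (\<lambda>u. f1 (u (node j)))" if "j \<in> supp a" for j
  proof -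
    have j': "j \<in> {1..n}" using supp_sub[OF a] that by blast
    show ?thesis
      by (rule integrable_bounded_real[where B = B, OF measurable_compose[OF measurable_node[OF j'] f1_meas]])
         (rule f1_bound[OF node_space[OF _ j']])
  qed
  have int_f1: "integrable P (\<lambda>u. f1 ((u(node i := x)) (node j)) - mu)" if "j \<in> supp a" for j
    unfolding f1_upd[OF that] using int_node[OF that] by (cases "j = i") simp_all
  have f1_int: "(\<integral>u. f1 ((u(node i := x)) (node j)) - mu \<partial>P) = (if j = i then f1 x - mu else 0)" if "j \<in> supp a" for j
  proof -
    have j': "j \<in> {1..n}" using supp_sub[OF a] that by blast
    show ?thesis unfolding f1_upd[OF that]
      using integral_node[OF j' f1_meas] int_node[OF that] by (cases "j = i") (simp_all add: P.prob_space mu_def)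
  qed
  have "(\<integral>u. rem_kernel a (u(node i := x)) \<partial>P) =
      (\<integral>u. \<phi> a (u(node i := x)) \<partial>P) - mu - (\<Sum>j\<in>supp a. \<integral>u. f1 ((u(node i := x)) (node j)) - mu \<partial>P)"
    unfolding rem_kernel_def using int_\<phi> int_f1 by (simp add: P.prob_space Bochner_Integration.integral_sum)
  also have "\<dots> = f1 x - mu - (\<Sum>j\<in>supp a. if j = i then f1 x - mu else 0)"
    by (simp only: \<phi>_proj[OF a i x] f1_int cong: sum.cong)
  also have "\<dots> = 0" using i finite_supp[OF a] by simp
  finally show ?thesis .
qed

text \<open>Given the single common node, or an arbitrary node of \<open>supp a\<close> when there
  is none, the two kernels are independent and the first has mean zero.\<close>

lemma rem_kernel_orthogonal:
  assumes a: "a \<in> idx" and b: "b \<in> idx" and c: "card (supp a \<inter> supp b) \<le> 1"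
  shows "(\<integral>u. rem_kernel a u * rem_kernel b u \<partial>P) = 0"
proof -
  have "\<exists>i\<in>supp a. supp a \<inter> supp b \<subseteq> {i}"
  proof (cases "supp a \<inter> supp b = {}")
    case True
    moreover have "supp a \<noteq> {}" using card_supp[OF a] k_pos by auto
    ultimately show ?thesis by blast
  next
    case False
    then have "card (supp a \<inter> supp b) = 1"
      using c finite_supp[OF a] by (simp add: le_Suc_eq)
    then show ?thesis by (metis Int_iff card_1_singletonE insertI1 subset_refl)
  qed
  then obtain i where i: "i \<in> supp a" "supp a \<inter> supp b \<subseteq> {i}" by blast
  have i': "i \<in> {1..n}" using supp_sub[OF a] i by blast
  show ?thesis
  proof (rule integral_mult_eq_0)
    show "coords a \<inter> coords b \<subseteq> {node i}" by (rule coords_Int[OF a b i' i(2)])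
    show "(\<integral>u. rem_kernel a (u(node i := x)) \<partial>P) = 0" if "x \<in> space (M (node i))" for x
      using rem_kernel_proj[OF a i(1)] that M_node[OF i'] by simp
  qed (fact node_in[OF i'] rem_kernel_meas[OF a] rem_kernel_meas[OF b] abs_rem_kernel_le[OF a]
      abs_rem_kernel_le[OF b] rem_kernel_coords[OF a] rem_kernel_coords[OF b] coords_sub[OF a] coords_sub[OF b])+
qed

abbreviation overlap :: "'c \<Rightarrow> 'c \<Rightarrow> real" where
  "overlap a b \<equiv> of_bool (2 \<le> card (supp a \<inter> supp b))"

text \<open>After expanding the square only overlapping pairs survive, each at most the squared sup
  bound. The set \<open>J\<close> is left open because the bound is applied to all kernels and to
  those containing one node.\<close>

lemma expectation_rem_sum_square_le:
  assumes J: "J \<subseteq> idx"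
  shows "(\<integral>u. (\<Sum>a\<in>J. rem_kernel a u)\<^sup>2 \<partial>P) \<le>
    (2 * B * (real k + 1))\<^sup>2 * (\<Sum>a\<in>J. \<Sum>b\<in>J. overlap a b)"
proof -
  let ?H = "2 * B * (real k + 1)"
  have int: "integrable P (\<lambda>u. rem_kernel a u * rem_kernel b u)" if "a \<in> J" "b \<in> J" for a b
    using that J abs_rem_kernel_le by (intro integrable_mult_bounded[where B = ?H and C = ?H]) auto
  have le: "(\<integral>u. rem_kernel a u * rem_kernel b u \<partial>P) \<le> ?H\<^sup>2 * overlap a b"
    if ab: "a \<in> J" "b \<in> J" for a b
  proof (cases "card (supp a \<inter> supp b) \<le> 1")
    case True
    moreover have "a \<in> idx" "b \<in> idx" using ab J by auto
    ultimately show ?thesis using rem_kernel_orthogonal[of a b] by simp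
  next
    case False
    have "(\<integral>u. rem_kernel a u * rem_kernel b u \<partial>P) \<le> (\<integral>u. ?H\<^sup>2 \<partial>P)"
    proof (rule integral_mono)
      fix u assume u: "u \<in> space P"
      have "\<bar>rem_kernel a u * rem_kernel b u\<bar> \<le> ?H * ?H"
        unfolding abs_mult using ab J u B_nonneg by (intro mult_mono abs_rem_kernel_le) auto
      then show "rem_kernel a u * rem_kernel b u \<le> ?H\<^sup>2" by (simp add: power2_eq_square)
    qed (use int ab in auto)
    then show ?thesis using False by (simp add: P.prob_space)
  qed
  have "(\<integral>u. (\<Sum>a\<in>J. rem_kernel a u)\<^sup>2 \<partial>P) = (\<Sum>a\<in>J. \<Sum>b\<in>J. \<integral>u. rem_kernel a u * rem_kernel b u \<partial>P)"
    using int by (simp add: power2_eq_square sum_product Bochner_Integration.integral_sum)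
  also have "\<dots> \<le> (\<Sum>a\<in>J. \<Sum>b\<in>J. ?H\<^sup>2 * overlap a b)"
    by (intro sum_mono le)
  finally show ?thesis by (simp add: sum_distrib_left)
qed

text \<open>The number of kernels containing two given distinct nodes, as a real closed form
  convenient for cancellation; for n = 1 it is 0.\<close>

definition pair_count :: real where
  "pair_count = real (n choose k) * (real k * (real k - 1)) / (real n * (real n - 1))"

lemma card_idx_two:
  assumes "i \<in> {1..n}" "j \<in> {1..n}" "i \<noteq> j"
  shows "real (card {a \<in> idx. i \<in> supp a \<and> j \<in> supp a}) = pair_count"
proof -
  have "n \<noteq> 0" "n \<noteq> 1" using assms by auto
  then have "real n * (real n - 1) \<noteq> 0" by simp
  from nonzero_eq_divide_eq[OF this] card_k_subsets_containing_two[OF assms k_pos]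
  show ?thesis
    unfolding pair_count_def card_idx_supp[of "\<lambda>A. i \<in> A \<and> j \<in> A"] by blast
qed

text \<open>Two overlapping supports through i share some further node j. Summing over j, the pairs
  through i and j number the square of \<open>pair_count\<close>.\<close>

lemma sum_pairs_containing_le:
  assumes i: "i \<in> {1..n}"
  shows "(\<Sum>a\<in>{a\<in>idx. i \<in> supp a}. \<Sum>b\<in>{a\<in>idx. i \<in> supp a}. overlap a b)
    \<le> (real n - 1) * pair_count\<^sup>2"
proof -
  let ?J = "{a\<in>idx. i \<in> supp a}"
  have "(\<Sum>a\<in>?J. \<Sum>b\<in>?J. overlap a b)
     \<le> (\<Sum>a\<in>?J. \<Sum>b\<in>?J. \<Sum>j\<in>{1..n} - {i}. of_bool (j \<in> supp a) * of_bool (j \<in> supp b) :: real)"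
  proof (intro sum_mono)
    fix a b assume ab: "a \<in> ?J" "b \<in> ?J"
    show "overlap a b \<le> (\<Sum>j\<in>{1..n} - {i}. of_bool (j \<in> supp a) * of_bool (j \<in> supp b) :: real)"
    proof (cases "2 \<le> card (supp a \<inter> supp b)")
      case True
      from ex_ne_if_two_le_card[OF this, of i]
      obtain j where j: "j \<in> supp a \<inter> supp b" "j \<noteq> i" by (elim bexE)
      have "j \<in> {1..n}" using j ab supp_sub by blast
      then have "of_bool (j \<in> supp a) * of_bool (j \<in> supp b) \<le> (\<Sum>j\<in>{1..n} - {i}. of_bool (j \<in> supp a) * of_bool (j \<in> supp b) :: real)"
        by (intro member_le_sum) (use j in auto)
      then show ?thesis using j by simp
    qed (simp add: sum_nonneg)
  qed
  also have "\<dots> = (\<Sum>j\<in>{1..n} - {i}. (\<Sum>a\<in>?J. of_bool (j \<in> supp a))\<^sup>2)"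
    unfolding power2_eq_square sum_product
    by (rule sum_swap3)
  also have "\<dots> = (\<Sum>j\<in>{1..n} - {i}. pair_count\<^sup>2)"
  proof (rule sum.cong)
    fix j assume j: "j \<in> {1..n} - {i}"
    have "(\<Sum>a\<in>?J. of_bool (j \<in> supp a)) = real (card {a \<in> idx. i \<in> supp a \<and> j \<in> supp a})"
      using finite_idx by (simp add: of_bool_def sum.If_cases Int_def conj_assoc)
    then show "(\<Sum>a\<in>?J. of_bool (j \<in> supp a))\<^sup>2 = pair_count\<^sup>2"
      using card_idx_two[OF i, of j] j by simp
  qed simp
  also have "\<dots> = (real n - 1) * pair_count\<^sup>2"
    using i by (simp add: of_nat_diff)
  finally show ?thesis .
qed

text \<open>Every overlapping pair has a common node i, so a union bound over i reduces to the pairs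
  through one node.\<close>

lemma sum_pairs_le:
  "(\<Sum>a\<in>idx. \<Sum>b\<in>idx. overlap a b) \<le> real n * (real n - 1) * pair_count\<^sup>2"
proof -
  have "(\<Sum>a\<in>idx. \<Sum>b\<in>idx. overlap a b :: real)
    \<le> (\<Sum>a\<in>idx. \<Sum>b\<in>idx. \<Sum>i\<in>{1..n}. of_bool (i \<in> supp a) * (of_bool (i \<in> supp b) * overlap a b))"
  proof (intro sum_mono)
    fix a b assume ab: "a \<in> idx" "b \<in> idx"
    show "overlap a b \<le>
      (\<Sum>i\<in>{1..n}. of_bool (i \<in> supp a) * (of_bool (i \<in> supp b) * overlap a b) :: real)"
    proof (cases "2 \<le> card (supp a \<inter> supp b)")
      case True
      from ex_ne_if_two_le_card[OF this, of 0]
      obtain j where j: "j \<in> supp a \<inter> supp b" by (elim bexE)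
      have "j \<in> {1..n}" using j ab supp_sub by blast
      then have "of_bool (j \<in> supp a) * (of_bool (j \<in> supp b) * overlap a b) \<le>
        (\<Sum>i\<in>{1..n}. of_bool (i \<in> supp a) * (of_bool (i \<in> supp b) * overlap a b) :: real)"
        by (intro member_le_sum) auto
      then show ?thesis using j True by simp
    qed (simp add: sum_nonneg)
  qed
  also have "\<dots> = (\<Sum>i\<in>{1..n}. \<Sum>a\<in>idx. \<Sum>b\<in>idx. of_bool (i \<in> supp a) * (of_bool (i \<in> supp b) * overlap a b))"
    by (rule sum_swap3)
  also have "\<dots> = (\<Sum>i\<in>{1..n}. \<Sum>a\<in>{a\<in>idx. i \<in> supp a}. \<Sum>b\<in>{a\<in>idx. i \<in> supp a}. overlap a b)"
    unfolding sum_distrib_left[symmetric] sum_filter_of_bool[OF finite_idx] ..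
  also have "\<dots> \<le> (\<Sum>i\<in>{1..n}. (real n - 1) * pair_count\<^sup>2)"
    by (intro sum_mono sum_pairs_containing_le)
  finally show ?thesis by simp
qed

end

section \<open>First and second moment bounds\<close>

lemma (in prob_space) expectation_abs_le:
  fixes X :: "'a \<Rightarrow> real"
  assumes [measurable]: "X \<in> borel_measurable M" and "\<And>x. x \<in> space M \<Longrightarrow> \<bar>X x\<bar> \<le> b"
    and "expectation (\<lambda>x. (X x)\<^sup>2) \<le> c\<^sup>2" "0 \<le> c"
  shows "expectation (\<lambda>x. \<bar>X x\<bar>) \<le> c"
proof -
  have i1: "integrable M (\<lambda>x. \<bar>X x\<bar>)"
    using assms(2) by (intro integrable_bounded_real[where B = b]) auto
  have "integrable M (\<lambda>x. \<bar>X x\<bar> * \<bar>X x\<bar>)"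
    using assms(2) by (intro integrable_mult_bounded[where B = b and C = b]) auto
  then have i2: "integrable M (\<lambda>x. \<bar>X x\<bar>\<^sup>2)"
    by (simp add: power2_eq_square)
  \<comment> \<open>Jensen's inequality for the square, in the form that the variance of the
    absolute value is nonnegative.\<close>
  have "0 \<le> expectation (\<lambda>x. \<bar>X x\<bar>\<^sup>2) - (expectation (\<lambda>x. \<bar>X x\<bar>))\<^sup>2"
    using variance_eq[OF i1 i2] variance_positive[of "\<lambda>x. \<bar>X x\<bar>"] by simp
  then have "(expectation (\<lambda>x. \<bar>X x\<bar>))\<^sup>2 \<le> c\<^sup>2"
    using assms(3) by simp
  then show ?thesis
    using assms(4) by (rule power2_le_imp_le)
qed

lemma integral_sum_square:
  fixes f :: "'i \<Rightarrow> 'a \<Rightarrow> real"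
  assumes "\<And>i j. i \<in> J \<Longrightarrow> j \<in> J \<Longrightarrow> integrable M (\<lambda>x. f i x * f j x)"
  shows "(\<integral>x. (\<Sum>i\<in>J. f i x)\<^sup>2 \<partial>M) = (\<Sum>i\<in>J. \<Sum>j\<in>J. \<integral>x. f i x * f j x \<partial>M)"
  using assms by (simp add: power2_eq_square sum_product Bochner_Integration.integral_sum)

text \<open>The tower property: \<open>g\<close> is the average of \<open>h\<close> over the second
  component, and a factor that reads only the first component passes through.\<close>

lemma (in pair_prob_space) integral_fst_mult:
  fixes f :: "'a \<Rightarrow> real" and h :: "'a \<times> 'b \<Rightarrow> real"
  assumes [measurable]: "f \<in> borel_measurable M1" "h \<in> borel_measurable (M1 \<Otimes>\<^sub>M M2)"
    and f: "\<And>u. u \<in> space M1 \<Longrightarrow> \<bar>f u\<bar> \<le> a" and h: "\<And>z. z \<in> space (M1 \<Otimes>\<^sub>M M2) \<Longrightarrow> \<bar>h z\<bar> \<le> b"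
    and g: "\<And>u. u \<in> space M1 \<Longrightarrow> (\<integral>x. h (u, x) \<partial>M2) = g u"
  shows "(\<integral>z. f (fst z) * h z \<partial>(M1 \<Otimes>\<^sub>M M2)) = (\<integral>z. f (fst z) * g (fst z) \<partial>(M1 \<Otimes>\<^sub>M M2))"
proof -
  have gm: "(\<lambda>u. \<integral>x. h (u, x) \<partial>M2) \<in> borel_measurable M1"
    by measurable
  have gm' [measurable]: "g \<in> borel_measurable M1"
    using gm by (subst measurable_cong[where g = "\<lambda>u. \<integral>x. h (u, x) \<partial>M2"]) (auto simp: g)
  have gb: "\<bar>g u\<bar> \<le> b" if "u \<in> space M1" for u
  proof -
    have "(\<lambda>x. h (u, x)) \<in> borel_measurable M2" using that by measurable
    then have "\<bar>\<integral>x. h (u, x) * 1 \<partial>M2\<bar> \<le> b * (\<integral>x. \<bar>1\<bar> \<partial>M2)"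
      using that h by (intro M2.abs_expectation_mult_le) (auto simp: space_pair_measure)
    then show ?thesis using g[OF that] by (simp add: M2.prob_space)
  qed
  have "(\<integral>z. f (fst z) * h z \<partial>(M1 \<Otimes>\<^sub>M M2)) = (\<integral>u. (\<integral>x. f u * h (u, x) \<partial>M2) \<partial>M1)"
    using f h integrable_mult_bounded[of "\<lambda>z. f (fst z)" h a b]
    by (subst integral_fst'[symmetric]) (auto simp: space_pair_measure)
  also have "\<dots> = (\<integral>u. f u * g u \<partial>M1)"
    by (rule Bochner_Integration.integral_cong) (simp_all add: g)
  also have "\<dots> = (\<integral>u. (\<integral>x. f u * g u \<partial>M2) \<partial>M1)"
    by (simp add: M2.prob_space)
  also have "\<dots> = (\<integral>z. f (fst z) * g (fst z) \<partial>(M1 \<Otimes>\<^sub>M M2))"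
    using f gb integrable_mult_bounded[of "\<lambda>z. f (fst z)" "\<lambda>z. g (fst z)" a b]
    by (subst integral_fst'[symmetric]) (auto simp: space_pair_measure)
  finally show ?thesis .
qed

lemma (in pair_prob_space) integral_comp_fst:
  fixes f :: "'a \<Rightarrow> real"
  assumes "f \<in> borel_measurable M1"
  shows "(\<integral>z. f (fst z) \<partial>(M1 \<Otimes>\<^sub>M M2)) = integral\<^sup>L M1 f"
  using integral_distr[of fst "M1 \<Otimes>\<^sub>M M2" M1 f] assms M2.distr_pair_fst[of M1] by simp

context u_statistic
begin

text \<open>Distinct nodes are independent and centred, so the second moment is at most n times the
  squared bound; this gives the square root of n instead of n.\<close>

lemma expectation_abs_sum_node_le:
  fixes f :: "'b \<Rightarrow> real"
  assumes [measurable]: "f \<in> borel_measurable U" and f: "\<And>x. x \<in> space U \<Longrightarrow> \<bar>f x\<bar> \<le> m" and "integral\<^sup>L U f = 0"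
  shows "(\<integral>u. \<bar>\<Sum>i=1..n. f (u (node i))\<bar> \<partial>P) \<le> sqrt (real n) * m"
proof -
  interpret U: prob_space U by (rule prob_space_U)
  have m: "0 \<le> m"
    using f U.not_empty order.trans[OF abs_ge_zero] by blast
  have f_node [measurable]: "(\<lambda>u. f (u (node i))) \<in> borel_measurable P" if "i \<in> {1..n}" for i
    using measurable_compose[OF measurable_node[OF that] assms(1)] .
  have fb: "\<bar>f (u (node i))\<bar> \<le> m" if "i \<in> {1..n}" "u \<in> space P" for u i
    using f node_space that by blast
  have int: "integrable P (\<lambda>u. f (u (node i)) * f (u (node j)))" if "i \<in> {1..n}" "j \<in> {1..n}" for i j
    using that fb by (intro integrable_mult_bounded[where B = m and C = m]) auto
  have le: "(\<integral>u. f (u (node i)) * f (u (node j)) \<partial>P) \<le> of_bool (i = j) * m\<^sup>2"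
    if ij: "i \<in> {1..n}" "j \<in> {1..n}" for i j
  proof (cases "i = j")
    case True
    have "(\<integral>u. f (u (node i)) * f (u (node j)) \<partial>P) \<le> (\<integral>u. m\<^sup>2 \<partial>P)"
    proof (rule integral_mono)
      fix u assume u: "u \<in> space P"
      have "\<bar>f (u (node i)) * f (u (node j))\<bar> \<le> m * m"
        unfolding abs_mult by (intro mult_mono fb ij u m abs_ge_zero)
      then show "f (u (node i)) * f (u (node j)) \<le> m\<^sup>2" by (simp add: power2_eq_square)
    qed (use int ij in auto)
    then show ?thesis using True by (simp add: P.prob_space)
  next
    case False
    then have ne: "node i \<noteq> node j"
      using inj_on_eq_iff[OF inj_node, of i j] ij by simp
    have "(\<integral>u. f (u (node i)) * f (u (node j)) \<partial>P) = 0"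
    proof (rule integral_mult_eq_0[where j = "node j" and S = "{node i}" and S' = "{node j}" and B = m])
      show "(\<integral>u. f ((u(node j := x)) (node i)) \<partial>P) = 0" if "x \<in> space (M (node j))" for x
        using ne integral_node[OF ij(1) assms(1)] assms(3) by simp
    qed (use ij ne fb node_in in auto)
    then show ?thesis using False by simp
  qed
  have "(\<integral>u. (\<Sum>i=1..n. f (u (node i)))\<^sup>2 \<partial>P) = (\<Sum>i=1..n. \<Sum>j=1..n. \<integral>u. f (u (node i)) * f (u (node j)) \<partial>P)"
    by (rule integral_sum_square[OF int])
  also have "\<dots> \<le> (\<Sum>i=1..n. \<Sum>j=1..n. of_bool (i = j) * m\<^sup>2)"
    by (intro sum_mono le)
  also have "\<dots> = (\<Sum>i=1..n. m\<^sup>2)"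
    by (intro sum.cong refl) (simp add: sum_distrib_right[symmetric] of_bool_def)
  also have "\<dots> = (sqrt (real n) * m)\<^sup>2"
    by (simp add: power_mult_distrib)
  finally have sq: "(\<integral>u. (\<Sum>i=1..n. f (u (node i)))\<^sup>2 \<partial>P) \<le> (sqrt (real n) * m)\<^sup>2" .
  show ?thesis
  proof (rule expectation_abs_le[OF _ _ sq])
    show "\<bar>\<Sum>i=1..n. f (u (node i))\<bar> \<le> (\<Sum>i=1..n. m)" if "u \<in> space P" for u
      by (intro order.trans[OF sum_abs sum_mono] fb that) auto
  qed (use m in auto)
qed

section \<open>The standardized statistic, its linear part and its remainder\<close>

definition norm_const :: real where
  "norm_const = sqrt (real n) / (real k * sd) * inverse (real (n choose k))"

definition W :: "('i \<Rightarrow> 'b) \<Rightarrow> real" where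
  "W u = norm_const * ((\<Sum>a\<in>idx. \<phi> a u) - real (n choose k) * mu)"

text \<open>Scaled so that the second moment is 1/n, which gives \<open>L\<close> unit
  variance.\<close>

definition G :: "'b \<Rightarrow> real" where
  "G x = (f1 x - mu) / (sd * sqrt (real n))"

definition L :: "('i \<Rightarrow> 'b) \<Rightarrow> real" where
  "L u = (\<Sum>i=1..n. G (u (node i)))"

text \<open>The share of the remainder of \<open>W\<close> that reacts to node i: when node i is
  resampled, the nonlinear change of \<open>W\<close> is the change of \<open>R i\<close>.\<close>

definition R :: "nat \<Rightarrow> ('i \<Rightarrow> 'b) \<Rightarrow> real" where
  "R i u = norm_const * (\<Sum>a\<in>{a\<in>idx. i \<in> supp a}. rem_kernel a u)"

text \<open>n times the bound on the second moment of \<open>W - L\<close>: the squared sup bound of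
  the remainder kernels times the factor \<open>2 * k^2 / sd^2\<close> from
  \<open>norm_const_pair_count\<close>. It is free of n.\<close>

definition rem_const :: real where
  "rem_const = 2 * (2 * B * (real k + 1))\<^sup>2 * (real k)\<^sup>2 / sd\<^sup>2"

lemma choose_pos: "0 < real (n choose k)"
  using k_le by simp

lemma n_pos: "0 < real n"
  using k_pos k_le by simp

text \<open>Double counting: every node lies in the same number of supports, namely
  \<open>(n choose k) * k / n\<close>, and so its linear term is collected that often.\<close>

lemma sum_\<phi>_centered:
  "(\<Sum>a\<in>idx. \<phi> a u) - real (n choose k) * mu =
    (\<Sum>a\<in>idx. rem_kernel a u) + real (n choose k) * real k / real n * (\<Sum>i=1..n. f1 (u (node i)) - mu)"
proof -
  define S where "S a = (\<Sum>i\<in>supp a. f1 (u (node i)) - mu)" for a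
  have "(\<Sum>a\<in>idx. S a) = (\<Sum>a\<in>idx. \<Sum>i\<in>{1..n}. of_bool (i \<in> supp a) * (f1 (u (node i)) - mu))"
  proof (rule sum.cong[OF refl])
    fix a assume "a \<in> idx"
    then have "supp a = {i \<in> {1..n}. i \<in> supp a}" using supp_sub by blast
    then have "(\<Sum>i\<in>supp a. f1 (u (node i)) - mu) = (\<Sum>i\<in>{i \<in> {1..n}. i \<in> supp a}. f1 (u (node i)) - mu)"
      by simp
    also have "\<dots> = (\<Sum>i\<in>{1..n}. of_bool (i \<in> supp a) * (f1 (u (node i)) - mu))"
      by (rule sum_filter_of_bool) simp
    finally show "S a = \<dots>" unfolding S_def .
  qed
  also have "\<dots> = (\<Sum>i\<in>{1..n}. (\<Sum>a\<in>idx. of_bool (i \<in> supp a)) * (f1 (u (node i)) - mu))"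
    by (subst sum.swap) (simp add: sum_distrib_right)
  also have "\<dots> = (\<Sum>i\<in>{1..n}. real (n choose k) * real k / real n * (f1 (u (node i)) - mu))"
  proof (rule sum.cong[OF refl])
    fix i assume i: "i \<in> {1..n}"
    have "(\<Sum>a\<in>idx. of_bool (i \<in> supp a)) = real (card {a \<in> idx. i \<in> supp a})"
      using finite_idx by (simp add: of_bool_def sum.If_cases Int_def)
    then have "(\<Sum>a\<in>idx. of_bool (i \<in> supp a)) = real (n choose k) * real k / real n"
      using card_k_subsets_containing[OF i k_pos] card_idx_supp[of "\<lambda>A. i \<in> A"] n_pos
      by (simp add: field_simps)
    then show "(\<Sum>a\<in>idx. of_bool (i \<in> supp a)) * (f1 (u (node i)) - mu) =
        real (n choose k) * real k / real n * (f1 (u (node i)) - mu)" by simp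
  qed
  finally have "(\<Sum>a\<in>idx. S a) = real (n choose k) * real k / real n * (\<Sum>i=1..n. f1 (u (node i)) - mu)"
    by (simp only: sum_distrib_left)
  moreover have "rem_kernel a u = \<phi> a u - mu - S a" for a
    by (simp add: rem_kernel_def S_def)
  ultimately show ?thesis
    by (simp add: sum_subtractf card_idx)
qed

context
  assumes sd_pos: "0 < sd"
begin

lemma W_decomp: "W u = L u + norm_const * (\<Sum>a\<in>idx. rem_kernel a u)"
proof -
  have "norm_const * (real (n choose k) * real k / real n) = 1 / (sd * sqrt (real n))"
  proof -
    define s where "s = sqrt (real n)"
    have "0 < s" "real n = s * s" using n_pos by (auto simp: s_def)
    then show ?thesis
      using sd_pos choose_pos k_pos by (simp add: norm_const_def s_def[symmetric] field_simps)
  qed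
  then have "norm_const * (real (n choose k) * real k / real n) * (\<Sum>i=1..n. f1 (u (node i)) - mu) = L u"
    by (simp add: L_def G_def sum_divide_distrib)
  then show ?thesis
    unfolding W_def sum_\<phi>_centered distrib_left mult.assoc[symmetric] by (simp add: mult.assoc)
qed

lemma norm_const_pair_count: "norm_const\<^sup>2 * (real n * (real n - 1) * pair_count\<^sup>2) \<le> 2 * (real k)\<^sup>2 / (sd\<^sup>2 * real n)"
proof (cases "n = 1")
  case False
  then have n2: "2 \<le> real n" using n_pos by (cases "n = 0") auto
  have cancel: "(sqrt x / (w * s) * inverse c)\<^sup>2 * (x * y * (c * (w * v) / (x * y))\<^sup>2) = v\<^sup>2 / (s\<^sup>2 * y)"
    if "0 < x" "0 < y" "0 < c" "0 < w" "0 < s" for x y c w v s :: real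
    using that by (simp add: power_mult_distrib power_divide field_simps power2_eq_square)
  have "norm_const\<^sup>2 * (real n * (real n - 1) * pair_count\<^sup>2) = (real k - 1)\<^sup>2 / (sd\<^sup>2 * (real n - 1))"
    unfolding norm_const_def pair_count_def
    by (rule cancel) (use n2 choose_pos sd_pos k_pos in auto)
  \<comment> \<open>All binomial coefficients have cancelled. For n at least 2, n - 1 is at least
    n/2; this is the factor 2 in \<open>rem_const\<close>.\<close>
  also have "\<dots> \<le> (real k)\<^sup>2 / (sd\<^sup>2 * (real n / 2))"
    using n2 sd_pos k_pos by (intro frac_le mult_left_mono power_mono) auto
  finally show ?thesis by (simp add: mult.commute)
qed (use sd_pos in simp)

lemma expectation_rem_square_le:
  "(\<integral>u. (norm_const * (\<Sum>a\<in>idx. rem_kernel a u))\<^sup>2 \<partial>P) \<le> (sqrt rem_const / sqrt (real n))\<^sup>2"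
proof -
  let ?H = "(2 * B * (real k + 1))\<^sup>2"
  have "(\<integral>u. (norm_const * (\<Sum>a\<in>idx. rem_kernel a u))\<^sup>2 \<partial>P) = norm_const\<^sup>2 * (\<integral>u. (\<Sum>a\<in>idx. rem_kernel a u)\<^sup>2 \<partial>P)"
    by (simp add: power_mult_distrib)
  also have "\<dots> \<le> norm_const\<^sup>2 * (?H * (real n * (real n - 1) * pair_count\<^sup>2))"
    by (intro mult_left_mono order.trans[OF expectation_rem_sum_square_le[OF order_refl]] sum_pairs_le) auto
  also have "\<dots> = ?H * (norm_const\<^sup>2 * (real n * (real n - 1) * pair_count\<^sup>2))"
    by simp
  also have "\<dots> \<le> ?H * (2 * (real k)\<^sup>2 / (sd\<^sup>2 * real n))"
    by (intro mult_left_mono norm_const_pair_count) simp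
  finally show ?thesis
    by (simp add: rem_const_def power_divide mult_ac)
qed

text \<open>Fixing a node saves a further factor n over the whole remainder. This is what lets the
  sum over all n nodes of \<open>\<bar>D i\<bar>\<close> times increments of \<open>R i\<close> stay
  of order n to the -1/2.\<close>

lemma expectation_R_square_le:
  assumes i: "i \<in> {1..n}"
  shows "(\<integral>u. (R i u)\<^sup>2 \<partial>P) \<le> (sqrt rem_const / real n)\<^sup>2"
proof -
  let ?H = "(2 * B * (real k + 1))\<^sup>2"
  have "(\<integral>u. (R i u)\<^sup>2 \<partial>P) = norm_const\<^sup>2 * (\<integral>u. (\<Sum>a\<in>{a\<in>idx. i \<in> supp a}. rem_kernel a u)\<^sup>2 \<partial>P)"
    by (simp add: R_def power_mult_distrib)
  also have "\<dots> \<le> norm_const\<^sup>2 * (?H * ((real n - 1) * pair_count\<^sup>2))"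
    by (intro mult_left_mono order.trans[OF expectation_rem_sum_square_le] sum_pairs_containing_le i) auto
  also have "\<dots> = ?H * (norm_const\<^sup>2 * (real n * (real n - 1) * pair_count\<^sup>2)) / real n"
    using n_pos by simp
  also have "\<dots> \<le> ?H * (2 * (real k)\<^sup>2 / (sd\<^sup>2 * real n)) / real n"
    by (intro divide_right_mono mult_left_mono norm_const_pair_count) auto
  finally show ?thesis
    by (simp add: rem_const_def power_divide power2_eq_square[of "real n"] mult_ac)
qed

lemma G_meas [measurable]: "G \<in> borel_measurable U"
  using f1_meas unfolding G_def[abs_def] by measurable

lemma abs_G_le: "x \<in> space U \<Longrightarrow> \<bar>G x\<bar> \<le> 2 * B / (sd * sqrt (real n))"
  using abs_f1_centered_le[of x] sd_pos n_pos
  by (simp add: G_def divide_right_mono)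

lemma integral_G: "integral\<^sup>L U G = 0"
proof -
  interpret U: prob_space U by (rule prob_space_U)
  show ?thesis
    unfolding G_def[abs_def] using integrable_f1 by (simp add: mu_def U.prob_space)
qed

lemma integral_G_square: "(\<integral>x. (G x)\<^sup>2 \<partial>U) = 1 / real n"
proof -
  have sq: "sd\<^sup>2 = (\<integral>x. (f1 x - mu)\<^sup>2 \<partial>U)"
    unfolding sd_def by (rule real_sqrt_pow2) (simp add: integral_nonneg_AE)
  then show ?thesis
    unfolding G_def using sd_pos n_pos by (simp add: power_divide power_mult_distrib sq[symmetric])
qed

lemma G_node_meas [measurable]: "i \<in> {1..n} \<Longrightarrow> (\<lambda>u. G (u (node i))) \<in> borel_measurable P"
  using measurable_compose[OF measurable_node G_meas] .

lemma rem_sum_meas [measurable]: "J \<subseteq> idx \<Longrightarrow> (\<lambda>u. \<Sum>a\<in>J. rem_kernel a u) \<in> borel_measurable P"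
  by (rule borel_measurable_sum) auto

lemma abs_rem_sum_le:
  assumes "J \<subseteq> idx" "u \<in> space P"
  shows "\<bar>norm_const * (\<Sum>a\<in>J. rem_kernel a u)\<bar> \<le> \<bar>norm_const\<bar> * (real (card J) * (2 * B * (real k + 1)))"
proof -
  have "\<bar>\<Sum>a\<in>J. rem_kernel a u\<bar> \<le> (\<Sum>a\<in>J. 2 * B * (real k + 1))"
    using assms by (intro order.trans[OF sum_abs sum_mono] abs_rem_kernel_le) auto
  then show ?thesis by (simp add: abs_mult mult_left_mono)
qed

lemma R_meas [measurable]: "R i \<in> borel_measurable P"
  unfolding R_def[abs_def] by (intro borel_measurable_times rem_sum_meas) auto

lemma abs_R_le: "u \<in> space P \<Longrightarrow>
    \<bar>R i u\<bar> \<le> \<bar>norm_const\<bar> * (real (card {a \<in> idx. i \<in> supp a}) * (2 * B * (real k + 1)))"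
  unfolding R_def by (rule abs_rem_sum_le) auto

lemma rem_const_nonneg: "0 \<le> rem_const"
  by (simp add: rem_const_def)

lemma expectation_abs_R_le:
  assumes "i \<in> {1..n}"
  shows "(\<integral>u. \<bar>R i u\<bar> \<partial>P) \<le> sqrt rem_const / real n"
  by (rule expectation_abs_le[OF R_meas abs_R_le expectation_R_square_le[OF assms]])
     (auto simp: rem_const_nonneg)

lemma expectation_abs_W_minus_L_le: "(\<integral>u. \<bar>W u - L u\<bar> \<partial>P) \<le> sqrt rem_const / sqrt (real n)"
  unfolding W_decomp
  by (simp, rule expectation_abs_le[OF _ abs_rem_sum_le[OF order_refl] expectation_rem_square_le])
     (auto simp: rem_const_nonneg intro!: borel_measurable_times)

lemma W_meas [measurable]: "W \<in> borel_measurable P"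
  unfolding W_def[abs_def] using \<phi>_meas by measurable

lemma abs_W_le: "u \<in> space P \<Longrightarrow> \<bar>W u\<bar> \<le> \<bar>norm_const\<bar> * (2 * (real (n choose k) * B))"
proof -
  assume u: "u \<in> space P"
  have "\<bar>\<Sum>a\<in>idx. \<phi> a u\<bar> \<le> (\<Sum>a\<in>idx. B)"
    using u by (intro order.trans[OF sum_abs sum_mono] \<phi>_bound) auto
  moreover have "\<bar>real (n choose k) * mu\<bar> \<le> real (n choose k) * B"
    using abs_mu_le by (simp add: abs_mult mult_left_mono)
  ultimately have "\<bar>(\<Sum>a\<in>idx. \<phi> a u) - real (n choose k) * mu\<bar> \<le> 2 * (real (n choose k) * B)"
    by (simp add: card_idx)
  then show ?thesis
    unfolding W_def abs_mult by (rule mult_left_mono) simp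
qed

lemma W_resample_diff:
  assumes i: "i \<in> {1..n}" and u: "u \<in> space P" and x: "x \<in> space U"
  shows "W u - W (u(node i := x)) = G (u (node i)) - G x + (R i u - R i (u(node i := x)))"
proof -
  let ?v = "u(node i := x)"
  have v: "?v \<in> space P" by (rule resample_space[OF u i x])
  have node_eq: "?v (node j) = (if j = i then x else u (node j))" if "j \<in> {1..n}" for j
    using inj_on_eq_iff[OF inj_node that i] by simp
  have "L u - L ?v = (\<Sum>j=1..n. G (u (node j)) - G (?v (node j)))"
    by (simp add: L_def sum_subtractf)
  also have "\<dots> = (\<Sum>j=1..n. if j = i then G (u (node i)) - G x else 0)"
    by (rule sum.cong) (auto simp: node_eq simp del: fun_upd_apply)
  also have "\<dots> = G (u (node i)) - G x"
    using i by simp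
  finally have L: "L u - L ?v = G (u (node i)) - G x" .
  \<comment> \<open>A kernel whose support misses i does not read the resampled coordinate, so only
    the kernels collected in \<open>R i\<close> move.\<close>
  have "(\<Sum>a\<in>idx. rem_kernel a u - rem_kernel a ?v) = (\<Sum>a\<in>{a\<in>idx. i \<in> supp a}. rem_kernel a u - rem_kernel a ?v)"
  proof (rule sum.mono_neutral_right[OF finite_idx])
    show "\<forall>a\<in>idx - {a \<in> idx. i \<in> supp a}. rem_kernel a u - rem_kernel a ?v = 0"
    proof
      fix a assume a: "a \<in> idx - {a \<in> idx. i \<in> supp a}"
      then have "node i \<notin> coords a" using node_coords[of a i] i by auto
      then have "rem_kernel a u = rem_kernel a ?v"
        using a u v by (intro rem_kernel_coords) auto
      then show "rem_kernel a u - rem_kernel a ?v = 0" by simp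
    qed
  qed auto
  then have "norm_const * (\<Sum>a\<in>idx. rem_kernel a u) - norm_const * (\<Sum>a\<in>idx. rem_kernel a ?v) = R i u - R i ?v"
    by (simp add: R_def sum_subtractf right_diff_distrib[symmetric])
  with L show ?thesis
    unfolding W_decomp by simp
qed

text \<open>The signed square \<open>\<bar>D i\<bar> * D i\<close> averaged over the fresh value, as
  a function of the node value alone.\<close>

definition J :: "'b \<Rightarrow> real" where
  "J y = (\<integral>x. \<bar>G y - G x\<bar> * (G y - G x) \<partial>U)"

lemma abs_G_diff_le:
  assumes "x \<in> space U" "y \<in> space U"
  shows "\<bar>G y - G x\<bar> \<le> 4 * B / (sd * sqrt (real n))"
  using abs_G_le[OF assms(1)] abs_G_le[OF assms(2)] by simp

lemma J_meas [measurable]: "J \<in> borel_measurable U"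
proof -
  interpret U: prob_space U by (rule prob_space_U)
  show ?thesis unfolding J_def[abs_def] by measurable
qed

lemma abs_J_le:
  assumes y: "y \<in> space U"
  shows "\<bar>J y\<bar> \<le> (4 * B / (sd * sqrt (real n)))\<^sup>2"
proof -
  interpret U: prob_space U by (rule prob_space_U)
  have "\<bar>\<integral>x. (\<bar>G y - G x\<bar> * (G y - G x)) * 1 \<partial>U\<bar> \<le> (4 * B / (sd * sqrt (real n)))\<^sup>2 * (\<integral>x. \<bar>1\<bar> \<partial>U)"
  proof (rule U.abs_expectation_mult_le)
    fix x assume x: "x \<in> space U"
    have "\<bar>G y - G x\<bar> * \<bar>G y - G x\<bar> \<le> (4 * B / (sd * sqrt (real n))) * (4 * B / (sd * sqrt (real n)))"
      using abs_G_diff_le[OF x y] by (intro mult_mono) auto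
    then show "\<bar>\<bar>G y - G x\<bar> * (G y - G x)\<bar> \<le> (4 * B / (sd * sqrt (real n)))\<^sup>2"
      by (simp add: abs_mult power2_eq_square)
  qed auto
  then show ?thesis by (simp add: J_def U.prob_space)
qed

text \<open>The integrand is antisymmetric in its two variables, so exchanging the order of
  integration equates the integral with its negative.\<close>

lemma integral_J: "integral\<^sup>L U J = 0"
proof -
  interpret U: pair_prob_space U U
    using prob_space_U by (simp add: pair_prob_space_def pair_sigma_finite_def prob_space_imp_sigma_finite)
  let ?h = "\<lambda>(y, x). \<bar>G y - G x\<bar> * (G y - G x)"
  have int: "integrable (U \<Otimes>\<^sub>M U) ?h"
    unfolding split_beta'
  proof (rule U.integrable_mult_bounded)
    show "\<bar>\<bar>G (fst z) - G (snd z)\<bar>\<bar> \<le> 4 * B / (sd * sqrt (real n))"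
      "\<bar>G (fst z) - G (snd z)\<bar> \<le> 4 * B / (sd * sqrt (real n))" if "z \<in> space (U \<Otimes>\<^sub>M U)" for z
      using abs_G_diff_le that by (auto simp: space_pair_measure)
  qed auto
  have "integral\<^sup>L U J = (\<integral>y. (\<integral>x. \<bar>G y - G x\<bar> * (G y - G x) \<partial>U) \<partial>U)"
    unfolding J_def ..
  also have "\<dots> = (\<integral>x. (\<integral>y. \<bar>G y - G x\<bar> * (G y - G x) \<partial>U) \<partial>U)"
    by (rule U.Fubini_integral[symmetric]) (rule int)
  also have "\<dots> = (\<integral>x. - J x \<partial>U)"
    unfolding J_def integral_minus[symmetric]
    by (intro Bochner_Integration.integral_cong refl) (simp add: abs_minus_commute algebra_simps)
  also have "\<dots> = - integral\<^sup>L U J" by simp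
  finally show ?thesis by simp
qed

end

lemma integral_\<phi>:
  assumes a: "a \<in> idx"
  shows "integral\<^sup>L P (\<phi> a) = mu"
proof -
  interpret U: prob_space U by (rule prob_space_U)
  interpret Q: pair_prob_space P U ..
  have "supp a \<noteq> {}" using card_supp[OF a] k_pos by auto
  then obtain i where i: "i \<in> supp a" by blast
  have i': "i \<in> {1..n}" using supp_sub[OF a] i by blast
  note m = measurable_resample[OF node_in[OF i'], unfolded M_node[OF i']]
  note m\<phi> = measurable_compose[OF m \<phi>_meas[OF a]]
  have "integral\<^sup>L P (\<phi> a) = (\<integral>z. \<phi> a ((\<lambda>(u, x). u(node i := x)) z) \<partial>(P \<Otimes>\<^sub>M U))"
    using integral_distr[OF m \<phi>_meas[OF a]] distr_resample[OF node_in[OF i']] M_node[OF i'] by simp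
  also have "\<dots> = (\<integral>x. (\<integral>u. \<phi> a (u(node i := x)) \<partial>P) \<partial>U)"
  proof -
    have "integrable (P \<Otimes>\<^sub>M U) (\<lambda>z. \<phi> a ((\<lambda>(u, x). u(node i := x)) z))"
      by (rule Q.integrable_bounded_real[OF m\<phi>, where B = B])
         (rule \<phi>_bound[OF a measurable_space[OF m]])
    then show ?thesis
      using Q.integral_snd[of "\<lambda>u x. \<phi> a (u(node i := x))"] by (simp add: split_beta')
  qed
  also have "\<dots> = (\<integral>x. f1 x \<partial>U)"
    by (rule Bochner_Integration.integral_cong) (simp_all add: \<phi>_proj[OF a i])
  finally show ?thesis by (simp add: mu_def)
qed

text \<open>The probability space is enlarged by one fresh copy of \<open>U\<close>. The
  exchangeable pair theorem is applied there, and its three error terms become moments over the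
  original space.\<close>

theorem berry_esseen:
  assumes sd_pos: "0 < sd"
  shows "\<bar>measure P {u \<in> space P. W u \<le> z} - \<Phi> z\<bar> \<le>
    (36 * B\<^sup>2 / sd\<^sup>2 + 1 + 24 * B * sqrt rem_const / sd + 2 * sqrt rem_const) / sqrt (real n)"
proof -
  interpret U: prob_space U by (rule prob_space_U)
  interpret Q: pair_prob_space P U ..
  let ?Q = "P \<Otimes>\<^sub>M U"
  define m where "m = 4 * B / (sd * sqrt (real n))"
  define r where "r = sqrt rem_const / real n"
  \<comment> \<open>The swap of node i with the fresh coordinate; an involution that preserves the
    product measure.\<close>
  define s where "s i = (\<lambda>(u, x). (u(node i := x), u (node i) :: 'b))" for i
  define D where "D i z = G (fst z (node i)) - G (snd z)" for i and z :: "('i \<Rightarrow> 'b) \<times> 'b"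
  define \<delta> where "\<delta> i z = R i (fst z) - R i (fst (s i z))" for i z
  have m_nonneg: "0 \<le> m" using B_nonneg sd_pos by (simp add: m_def)
  have s_meas [measurable]: "s i \<in> measurable ?Q ?Q" if "i \<in> {1..n}" for i
    using measurable_exchange[OF node_in[OF that]] M_node[OF that] unfolding s_def by simp
  have s_distr: "distr ?Q ?Q (s i) = ?Q" if "i \<in> {1..n}" for i
    using distr_exchange[OF node_in[OF that]] M_node[OF that] unfolding s_def by simp
  have s_s: "s i (s i z) = z" for i z
    by (cases z) (simp add: s_def)
  have G_fst [measurable]: "(\<lambda>z. G (fst z (node i))) \<in> borel_measurable ?Q" if "i \<in> {1..n}" for i
    using measurable_compose[OF measurable_fst G_node_meas[OF sd_pos that]] .
  have G_snd [measurable]: "(\<lambda>z. G (snd z)) \<in> borel_measurable ?Q"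
    using measurable_compose[OF measurable_snd G_meas[OF sd_pos]] .
  have D_meas [measurable]: "D i \<in> borel_measurable ?Q" if "i \<in> {1..n}" for i
    unfolding D_def[abs_def] by (intro borel_measurable_diff G_fst G_snd that)
  have D_bound: "\<bar>D i z\<bar> \<le> m" if "i \<in> {1..n}" "z \<in> space ?Q" for i z
    using abs_G_diff_le[OF sd_pos, of "snd z" "fst z (node i)"] node_space that
    by (auto simp: D_def m_def space_pair_measure)
  have R_fst [measurable]: "(\<lambda>z. R i (fst z)) \<in> borel_measurable ?Q" for i
    using measurable_compose[OF measurable_fst R_meas] sd_pos by blast
  have R_s: "(\<lambda>z. R i (fst (s i z))) \<in> borel_measurable ?Q" if "i \<in> {1..n}" for i
    using measurable_compose[OF s_meas[OF that] R_fst] .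
  have \<delta>_meas [measurable]: "\<delta> i \<in> borel_measurable ?Q" if "i \<in> {1..n}" for i
    unfolding \<delta>_def[abs_def] by (intro borel_measurable_diff R_fst R_s that)
  have W_diff: "W (fst z) - W (fst (s i z)) = D i z + \<delta> i z" if "i \<in> {1..n}" "z \<in> space ?Q" for i z
    using W_resample_diff[OF sd_pos that(1), of "fst z" "snd z"] that(2)
    by (cases z) (simp add: s_def D_def \<delta>_def space_pair_measure)
  have int_R: "integrable ?Q (\<lambda>z. R i (fst z))" for i
    by (rule Q.integrable_bounded_real[OF R_fst abs_R_le[OF sd_pos]]) (auto simp: space_pair_measure)
  have int_R_s: "integrable ?Q (\<lambda>z. R i (fst (s i z)))" if "i \<in> {1..n}" for i
    using int_R integrable_distr_eq[OF s_meas[OF that] R_fst] s_distr[OF that] by simp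
  have int_\<delta>: "integrable ?Q (\<delta> i)" if "i \<in> {1..n}" for i
    unfolding \<delta>_def[abs_def] by (intro Bochner_Integration.integrable_diff int_R int_R_s that)
  have E_\<delta>: "Q.expectation (\<lambda>z. \<bar>\<delta> i z\<bar>) \<le> 2 * r" if i: "i \<in> {1..n}" for i
  proof -
    have "Q.expectation (\<lambda>z. \<bar>R i (fst (s i z))\<bar>) = Q.expectation (\<lambda>z. \<bar>R i (fst z)\<bar>)"
      using Q.integral_distr_self[OF s_meas[OF i] s_distr[OF i], of "\<lambda>z. \<bar>R i (fst z)\<bar>"] by simp
    also have "\<dots> = (\<integral>u. \<bar>R i u\<bar> \<partial>P)"
      using R_meas[OF sd_pos, of i] by (intro Q.integral_comp_fst) simp
    also have "\<dots> \<le> r"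
      unfolding r_def by (rule expectation_abs_R_le[OF sd_pos i])
    finally have "Q.expectation (\<lambda>z. \<bar>R i (fst (s i z))\<bar>) \<le> r" "Q.expectation (\<lambda>z. \<bar>R i (fst z)\<bar>) \<le> r"
      using \<open>Q.expectation (\<lambda>z. \<bar>R i (fst z)\<bar>) = _\<close> \<open>_ \<le> r\<close> by auto
    moreover have "Q.expectation (\<lambda>z. \<bar>\<delta> i z\<bar>) \<le> Q.expectation (\<lambda>z. \<bar>R i (fst z)\<bar> + \<bar>R i (fst (s i z))\<bar>)"
      using int_R int_R_s[OF i] int_\<delta>[OF i] by (intro integral_mono) (auto simp: \<delta>_def)
    ultimately show ?thesis
      using int_R int_R_s[OF i] by simp
  qed
  have D_\<delta>: "integrable ?Q (\<lambda>z. h z * \<delta> i z)" "Q.expectation (\<lambda>z. \<bar>h z * \<delta> i z\<bar>) \<le> m * (2 * r)"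
    if i: "i \<in> {1..n}" and [measurable]: "h \<in> borel_measurable ?Q" and h: "\<And>z. z \<in> space ?Q \<Longrightarrow> \<bar>h z\<bar> \<le> m" for h i
  proof -
    have le: "\<bar>h z * \<delta> i z\<bar> \<le> m * \<bar>\<delta> i z\<bar>" if "z \<in> space ?Q" for z
      using h[OF that] by (simp add: abs_mult mult_right_mono)
    show "integrable ?Q (\<lambda>z. h z * \<delta> i z)"
      by (rule integrable_bounded_mult[OF that(2) h int_\<delta>[OF i]])
    then have "Q.expectation (\<lambda>z. \<bar>h z * \<delta> i z\<bar>) \<le> Q.expectation (\<lambda>z. m * \<bar>\<delta> i z\<bar>)"
      using int_\<delta>[OF i] le by (intro integral_mono) auto
    also have "\<dots> \<le> m * (2 * r)"
      using E_\<delta>[OF i] m_nonneg by (simp add: mult_left_mono)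
    finally show "Q.expectation (\<lambda>z. \<bar>h z * \<delta> i z\<bar>) \<le> m * (2 * r)" .
  qed
  have D_\<delta>1: "integrable ?Q (\<lambda>z. D i z * \<delta> i z)" "Q.expectation (\<lambda>z. \<bar>D i z * \<delta> i z\<bar>) \<le> m * (2 * r)"
    and D_\<delta>2: "integrable ?Q (\<lambda>z. \<bar>D i z\<bar> * \<delta> i z)" "Q.expectation (\<lambda>z. \<bar>\<bar>D i z\<bar> * \<delta> i z\<bar>) \<le> m * (2 * r)"
    if i: "i \<in> {1..n}" for i
    using D_\<delta>[OF i, of "D i"] D_\<delta>[OF i, of "\<lambda>z. \<bar>D i z\<bar>"] D_meas[OF i] D_bound[OF i] by auto

  define A where "A u = (\<Sum>i=1..n. (G (u (node i)))\<^sup>2 - 1 / real n)" for u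
  define J' where "J' u = (\<Sum>i=1..n. J (u (node i)))" for u
  \<comment> \<open>Averaged over the fresh value, \<open>(D i z)^2\<close> becomes
    \<open>G^2 + 1 / n\<close>. Summed over n nodes with \<open>A\<close> centred this leaves the
    constant 2, so \<open>1 - V / 2\<close> has no deterministic part. The products with
    \<open>\<delta>\<close> stay unaveraged, since their L1 size already suffices.\<close>
  define V where "V z = A (fst z) + 2 + (\<Sum>i=1..n. D i z * \<delta> i z)" for z
  define V' where "V' z = J' (fst z) + (\<Sum>i=1..n. \<bar>D i z\<bar> * \<delta> i z)" for z
  have A_meas: "A \<in> borel_measurable P"
    unfolding A_def[abs_def] using G_node_meas[OF sd_pos] by (intro borel_measurable_sum) auto
  have J_node_meas: "(\<lambda>u. J (u (node i))) \<in> borel_measurable P" if "i \<in> {1..n}" for i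
    using measurable_compose[OF measurable_node[OF that] J_meas[OF sd_pos]] .
  have J'_meas: "J' \<in> borel_measurable P"
    unfolding J'_def[abs_def] using J_node_meas by (intro borel_measurable_sum) auto
  have L_meas: "L \<in> borel_measurable P"
    unfolding L_def[abs_def] using G_node_meas[OF sd_pos] by (intro borel_measurable_sum) auto
  have abs_G_le_m: "\<bar>G x\<bar> \<le> m" if "x \<in> space U" for x
    by (rule order.trans[OF abs_G_le[OF sd_pos that]])
       (use B_nonneg sd_pos in \<open>simp add: m_def divide_right_mono\<close>)
  have G_sq_le: "(G x)\<^sup>2 \<le> m\<^sup>2" if "x \<in> space U" for x
    using power_mono[OF abs_G_le_m[OF that] abs_ge_zero, of 2] by simp
  have sum_le: "\<bar>\<Sum>i=1..n. t i\<bar> \<le> real n * c" if "\<And>i. i \<in> {1..n} \<Longrightarrow> \<bar>t i\<bar> \<le> c" for t :: "nat \<Rightarrow> real" and c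
  proof -
    have "\<bar>\<Sum>i=1..n. t i\<bar> \<le> (\<Sum>i=1..n. c)"
      by (intro order.trans[OF sum_abs sum_mono] that)
    then show ?thesis by simp
  qed
  have L_bound: "\<bar>L u\<bar> \<le> real n * m" if "u \<in> space P" for u
    unfolding L_def using that node_space by (intro sum_le abs_G_le_m) auto
  have sq_bound: "\<bar>(G x)\<^sup>2 - 1 / real n\<bar> \<le> (4 * B\<^sup>2 / sd\<^sup>2 + 1) / real n" if "x \<in> space U" for x
  proof -
    have "(G x)\<^sup>2 \<le> (2 * B / (sd * sqrt (real n)))\<^sup>2"
      using power_mono[OF abs_G_le[OF sd_pos that] abs_ge_zero, of 2] by simp
    also have "\<dots> = 4 * B\<^sup>2 / sd\<^sup>2 / real n"
      by (simp add: power_divide power_mult_distrib)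
    finally have "(G x)\<^sup>2 \<le> 4 * B\<^sup>2 / sd\<^sup>2 / real n" .
    moreover have "0 \<le> 1 / real n" "0 \<le> (G x)\<^sup>2" by simp_all
    ultimately show ?thesis unfolding add_divide_distrib abs_le_iff by linarith
  qed
  have A_bound: "\<bar>A u\<bar> \<le> real n * ((4 * B\<^sup>2 / sd\<^sup>2 + 1) / real n)" if "u \<in> space P" for u
    unfolding A_def using that node_space by (intro sum_le sq_bound) auto
  have J'_bound: "\<bar>J' u\<bar> \<le> real n * m\<^sup>2" if "u \<in> space P" for u
    unfolding J'_def m_def using that node_space by (intro sum_le abs_J_le[OF sd_pos]) auto
  have U_int: "integrable U G" "integrable U (\<lambda>x. (G x)\<^sup>2)"
  proof -
    show "integrable U G"
      by (rule U.integrable_bounded_real[OF G_meas[OF sd_pos] abs_G_le_m])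
    show "integrable U (\<lambda>x. (G x)\<^sup>2)"
      using G_meas[OF sd_pos] G_sq_le by (intro U.integrable_bounded_real[where B = "m\<^sup>2"]) auto
  qed
  have W_fst: "(\<lambda>z. W (fst z)) \<in> borel_measurable ?Q"
    using measurable_compose[OF measurable_fst W_meas[OF sd_pos]] .
  have space_fst: "fst z \<in> space P" if "z \<in> space ?Q" for z
    using that by (auto simp: space_pair_measure)

  \<comment> \<open>Only \<open>h\<close> is replaced by its mean over the fresh coordinate; the
    error term \<open>e\<close> is carried along as it is.\<close>
  have average: "Q.expectation (\<lambda>z. \<psi> (W (fst z)) * (h z + e z)) = Q.expectation (\<lambda>z. \<psi> (W (fst z)) * (g (fst z) + e z))"
    if [measurable]: "\<psi> \<in> borel_measurable borel" "h \<in> borel_measurable ?Q" "g \<in> borel_measurable P"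
      and b: "\<And>x. \<bar>\<psi> x\<bar> \<le> c" "\<And>z. z \<in> space ?Q \<Longrightarrow> \<bar>h z\<bar> \<le> C" "\<And>u. u \<in> space P \<Longrightarrow> \<bar>g u\<bar> \<le> C"
      and e: "integrable ?Q e" and g: "\<And>u. u \<in> space P \<Longrightarrow> (\<integral>x. h (u, x) \<partial>U) = g u"
    for \<psi> :: "real \<Rightarrow> real" and h e :: "('i \<Rightarrow> 'b) \<times> 'b \<Rightarrow> real" and g :: "('i \<Rightarrow> 'b) \<Rightarrow> real" and c C
  proof -
    note [measurable] = W_fst W_meas[OF sd_pos]
    have ie: "integrable ?Q (\<lambda>z. \<psi> (W (fst z)) * e z)"
      using b(1) by (intro integrable_bounded_mult[where B = c] e) auto
    have ih: "integrable ?Q (\<lambda>z. \<psi> (W (fst z)) * h z)"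
      using b by (intro Q.integrable_mult_bounded[where B = c and C = C]) auto
    have ig: "integrable ?Q (\<lambda>z. \<psi> (W (fst z)) * g (fst z))"
      using b space_fst by (intro Q.integrable_mult_bounded[where B = c and C = C]) auto
    have "Q.expectation (\<lambda>z. \<psi> (W (fst z)) * h z) = Q.expectation (\<lambda>z. \<psi> (W (fst z)) * g (fst z))"
      by (rule Q.integral_fst_mult[where f = "\<lambda>u. \<psi> (W u)" and a = c and b = C]) (use b g in auto)
    then show ?thesis using ie ih ig by (simp add: distrib_left)
  qed

  have bound: "\<bar>Q.prob {z \<in> space ?Q. W (fst z) \<le> z'} - \<Phi> z'\<bar> \<le>
    2 * Q.expectation (\<lambda>z. \<bar>1 - V z / 2\<bar>) + 2 * Q.expectation (\<lambda>z. \<bar>V' z\<bar>) + 2 * Q.expectation (\<lambda>z. \<bar>W (fst z) - L (fst z)\<bar>)" for z'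
  proof (rule Q.exchangeable_pair_normal_approximation[where I = "{1..n}" and D = D and s = s
        and b = "max m (\<bar>norm_const\<bar> * (2 * (real (n choose k) * B)))"])
    show "integrable ?Q (\<lambda>z. L (fst z))"
      using L_bound space_fst measurable_compose[OF measurable_fst L_meas]
      by (intro Q.integrable_bounded_real[where B = "real n * m"]) auto
    have "integrable ?Q (\<lambda>z. A (fst z))"
      using A_bound space_fst measurable_compose[OF measurable_fst A_meas]
      by (intro Q.integrable_bounded_real[where B = "real n * ((4 * B\<^sup>2 / sd\<^sup>2 + 1) / real n)"]) auto
    then show "integrable ?Q V"
      unfolding V_def[abs_def]
      by (intro Bochner_Integration.integrable_add Bochner_Integration.integrable_sum D_\<delta>1(1)) simp_all
    have "integrable ?Q (\<lambda>z. J' (fst z))"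
      using J'_bound space_fst measurable_compose[OF measurable_fst J'_meas]
      by (intro Q.integrable_bounded_real[where B = "real n * m\<^sup>2"]) auto
    then show "integrable ?Q V'"
      unfolding V'_def[abs_def]
      by (intro Bochner_Integration.integrable_add Bochner_Integration.integrable_sum D_\<delta>2(1)) simp_all
    show "D i (s i z) = - D i z" for i z
      by (simp add: D_def s_def split_beta')
    show "\<bar>W (fst z)\<bar> \<le> max m (\<bar>norm_const\<bar> * (2 * (real (n choose k) * B)))" if "z \<in> space ?Q" for z
      using abs_W_le[OF sd_pos space_fst[OF that]] by simp
    show "\<bar>D i z\<bar> \<le> max m (\<bar>norm_const\<bar> * (2 * (real (n choose k) * B)))" if "i \<in> {1..n}" "z \<in> space ?Q" for i z
      using D_bound[OF that] by simp
    fix \<psi> :: "real \<Rightarrow> real" and c assume \<psi>: "\<psi> \<in> borel_measurable borel" "\<And>x. \<bar>\<psi> x\<bar> \<le> c"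
    have "Q.expectation (\<lambda>z. \<psi> (W (fst z)) * ((\<Sum>i=1..n. D i z) + 0)) = Q.expectation (\<lambda>z. \<psi> (W (fst z)) * (L (fst z) + 0))"
    proof (rule average[OF \<psi>(1) _ L_meas \<psi>(2)])
      show "(\<integral>x. (\<Sum>i=1..n. D i (u, x)) \<partial>U) = L u" for u
        unfolding D_def L_def using U_int integral_G[OF sd_pos]
        by (simp add: Bochner_Integration.integral_sum U.prob_space)
      show "\<bar>\<Sum>i=1..n. D i z\<bar> \<le> real n * m" if "z \<in> space ?Q" for z
        using that by (intro sum_le D_bound)
    qed (use L_bound D_meas in \<open>auto intro!: borel_measurable_sum\<close>)
    then show "Q.expectation (\<lambda>z. \<psi> (W (fst z)) * (\<Sum>i=1..n. D i z)) = Q.expectation (\<lambda>z. \<psi> (W (fst z)) * L (fst z))"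
      by simp
    have "Q.expectation (\<lambda>z. \<psi> (W (fst z)) * (\<Sum>i=1..n. D i z * (W (fst z) - W (fst (s i z))))) =
        Q.expectation (\<lambda>z. \<psi> (W (fst z)) * ((\<Sum>i=1..n. (D i z)\<^sup>2) + (\<Sum>i=1..n. D i z * \<delta> i z)))"
      by (intro Bochner_Integration.integral_cong refl)
         (simp add: W_diff distrib_left power2_eq_square sum.distrib)
    also have "\<dots> = Q.expectation (\<lambda>z. \<psi> (W (fst z)) * ((A (fst z) + 2) + (\<Sum>i=1..n. D i z * \<delta> i z)))"
    proof (rule average[OF \<psi>(1) _ _ \<psi>(2)])
      show "(\<integral>x. (\<Sum>i=1..n. (D i (u, x))\<^sup>2) \<partial>U) = A u + 2" for u
      proof -
        have "(\<integral>x. (D i (u, x))\<^sup>2 \<partial>U) = (G (u (node i)))\<^sup>2 + 1 / real n" for i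
          unfolding D_def power2_diff fst_conv snd_conv using U_int integral_G[OF sd_pos] integral_G_square[OF sd_pos]
          by (simp add: U.prob_space)
        moreover have "integrable U (\<lambda>x. (D i (u, x))\<^sup>2)" for i
          unfolding D_def power2_diff fst_conv snd_conv using U_int by simp
        ultimately show ?thesis
          using n_pos by (simp add: Bochner_Integration.integral_sum A_def sum.distrib sum_subtractf)
      qed
      show "\<bar>\<Sum>i=1..n. (D i z)\<^sup>2\<bar> \<le> max (real n * m\<^sup>2) (real n * ((4 * B\<^sup>2 / sd\<^sup>2 + 1) / real n) + 2)"
        if z: "z \<in> space ?Q" for z
      proof -
        have "\<bar>\<Sum>i=1..n. (D i z)\<^sup>2\<bar> \<le> real n * m\<^sup>2"
          using power_mono[OF D_bound[OF _ z] abs_ge_zero, of _ 2] by (intro sum_le) auto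
        then show ?thesis by simp
      qed
      show "\<bar>A u + 2\<bar> \<le> max (real n * m\<^sup>2) (real n * ((4 * B\<^sup>2 / sd\<^sup>2 + 1) / real n) + 2)" if "u \<in> space P" for u
        using A_bound[OF that] by linarith
    qed (use A_meas D_meas D_\<delta>1(1) in \<open>auto intro!: borel_measurable_sum Bochner_Integration.integrable_sum\<close>)
    finally show "Q.expectation (\<lambda>z. \<psi> (W (fst z)) * (\<Sum>i=1..n. D i z * (W (fst z) - W (fst (s i z))))) =
        Q.expectation (\<lambda>z. \<psi> (W (fst z)) * V z)"
      unfolding V_def .
    have "Q.expectation (\<lambda>z. \<psi> (W (fst z)) * (\<Sum>i=1..n. \<bar>D i z\<bar> * (W (fst z) - W (fst (s i z))))) =
        Q.expectation (\<lambda>z. \<psi> (W (fst z)) * ((\<Sum>i=1..n. \<bar>D i z\<bar> * D i z) + (\<Sum>i=1..n. \<bar>D i z\<bar> * \<delta> i z)))"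
      by (intro Bochner_Integration.integral_cong refl)
         (simp add: W_diff distrib_left sum.distrib)
    also have "\<dots> = Q.expectation (\<lambda>z. \<psi> (W (fst z)) * (J' (fst z) + (\<Sum>i=1..n. \<bar>D i z\<bar> * \<delta> i z)))"
    proof (rule average[OF \<psi>(1) _ J'_meas \<psi>(2) _ J'_bound])
      show "\<bar>\<Sum>i=1..n. \<bar>D i z\<bar> * D i z\<bar> \<le> real n * m\<^sup>2" if "z \<in> space ?Q" for z
      proof (rule sum_le)
        fix i assume "i \<in> {1..n}"
        from power_mono[OF D_bound[OF this that] abs_ge_zero, of 2]
        show "\<bar>\<bar>D i z\<bar> * D i z\<bar> \<le> m\<^sup>2"
          by (simp add: abs_mult power2_eq_square)
      qed
      show "(\<integral>x. (\<Sum>i=1..n. \<bar>D i (u, x)\<bar> * D i (u, x)) \<partial>U) = J' u" if "u \<in> space P" for u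
      proof -
        have "integrable U (\<lambda>x. \<bar>D i (u, x)\<bar> * D i (u, x))" if i: "i \<in> {1..n}" for i
          using D_bound[OF i, of "(u, _)"] \<open>u \<in> space P\<close> G_meas[OF sd_pos]
          by (intro U.integrable_mult_bounded[where B = m and C = m]) (auto simp: space_pair_measure D_def)
        then show ?thesis
          by (subst Bochner_Integration.integral_sum) (auto simp: J'_def J_def[OF sd_pos] D_def)
      qed
    qed (use D_meas D_\<delta>2(1) in \<open>auto intro!: borel_measurable_sum borel_measurable_times borel_measurable_abs Bochner_Integration.integrable_sum\<close>)
    finally show "Q.expectation (\<lambda>z. \<psi> (W (fst z)) * (\<Sum>i=1..n. \<bar>D i z\<bar> * (W (fst z) - W (fst (s i z))))) =
        Q.expectation (\<lambda>z. \<psi> (W (fst z)) * V' z)"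
      unfolding V'_def .
  qed (use W_fst D_meas s_meas s_distr s_s in auto)

  have sum_E: "Q.expectation (\<lambda>z. \<bar>g (fst z) + (\<Sum>i=1..n. h i z * \<delta> i z)\<bar>) \<le> (\<integral>u. \<bar>g u\<bar> \<partial>P) + real n * (m * (2 * r))"
    if g: "g \<in> borel_measurable P" "\<And>u. u \<in> space P \<Longrightarrow> \<bar>g u\<bar> \<le> C"
      and h: "\<And>i. i \<in> {1..n} \<Longrightarrow> integrable ?Q (\<lambda>z. h i z * \<delta> i z)"
        "\<And>i. i \<in> {1..n} \<Longrightarrow> Q.expectation (\<lambda>z. \<bar>h i z * \<delta> i z\<bar>) \<le> m * (2 * r)"
    for g :: "('i \<Rightarrow> 'b) \<Rightarrow> real" and h :: "nat \<Rightarrow> ('i \<Rightarrow> 'b) \<times> 'b \<Rightarrow> real" and C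
  proof -
    have ig: "integrable ?Q (\<lambda>z. g (fst z))"
      using g space_fst measurable_compose[OF measurable_fst g(1)]
      by (intro Q.integrable_bounded_real[where B = C]) auto
    have ih: "integrable ?Q (\<lambda>z. \<Sum>i=1..n. h i z * \<delta> i z)"
      by (intro Bochner_Integration.integrable_sum h(1))
    have ih': "integrable ?Q (\<lambda>z. \<Sum>i=1..n. \<bar>h i z * \<delta> i z\<bar>)"
      by (intro Bochner_Integration.integrable_sum integrable_abs h(1))
    have "Q.expectation (\<lambda>z. \<bar>g (fst z) + (\<Sum>i=1..n. h i z * \<delta> i z)\<bar>) \<le>
        Q.expectation (\<lambda>z. \<bar>g (fst z)\<bar> + (\<Sum>i=1..n. \<bar>h i z * \<delta> i z\<bar>))"
    proof (rule integral_mono)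
      show "\<bar>g (fst z) + (\<Sum>i=1..n. h i z * \<delta> i z)\<bar> \<le> \<bar>g (fst z)\<bar> + (\<Sum>i=1..n. \<bar>h i z * \<delta> i z\<bar>)" for z
        using sum_abs[of "\<lambda>i. h i z * \<delta> i z" "{1..n}"] by linarith
    qed (use ig ih ih' in auto)
    also have "\<dots> = Q.expectation (\<lambda>z. \<bar>g (fst z)\<bar>) + (\<Sum>i=1..n. Q.expectation (\<lambda>z. \<bar>h i z * \<delta> i z\<bar>))"
      using ig ih' h(1) by (simp add: Bochner_Integration.integral_sum)
    also have "\<dots> \<le> (\<integral>u. \<bar>g u\<bar> \<partial>P) + (\<Sum>i=1..n. m * (2 * r))"
      using g(1) h(2) Q.integral_comp_fst[of "\<lambda>u. \<bar>g u\<bar>"] by (intro add_mono sum_mono) auto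
    finally show ?thesis by simp
  qed
  have "(\<lambda>x. (G x)\<^sup>2 - 1 / real n) \<in> borel_measurable U"
    using G_meas[OF sd_pos] by measurable
  then have EA: "(\<integral>u. \<bar>A u\<bar> \<partial>P) \<le> sqrt (real n) * ((4 * B\<^sup>2 / sd\<^sup>2 + 1) / real n)"
    unfolding A_def
    by (rule expectation_abs_sum_node_le[OF _ sq_bound])
       (use U_int integral_G_square[OF sd_pos] in \<open>simp_all add: U.prob_space\<close>)
  have EJ: "(\<integral>u. \<bar>J' u\<bar> \<partial>P) \<le> sqrt (real n) * m\<^sup>2"
    unfolding J'_def m_def
    by (rule expectation_abs_sum_node_le[OF J_meas[OF sd_pos] abs_J_le[OF sd_pos] integral_J[OF sd_pos]])
  have "Q.expectation (\<lambda>z. \<bar>A (fst z) + (\<Sum>i=1..n. D i z * \<delta> i z)\<bar>) \<le> (\<integral>u. \<bar>A u\<bar> \<partial>P) + real n * (m * (2 * r))"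
    by (rule sum_E[OF A_meas A_bound D_\<delta>1])
  also have "(\<lambda>z. \<bar>A (fst z) + (\<Sum>i=1..n. D i z * \<delta> i z)\<bar>) = (\<lambda>z. 2 * \<bar>1 - V z / 2\<bar>)"
    unfolding V_def by (rule ext) (simp add: abs_if field_simps)
  finally have EV: "2 * Q.expectation (\<lambda>z. \<bar>1 - V z / 2\<bar>) \<le> (\<integral>u. \<bar>A u\<bar> \<partial>P) + real n * (m * (2 * r))"
    by simp
  have EV': "Q.expectation (\<lambda>z. \<bar>V' z\<bar>) \<le> (\<integral>u. \<bar>J' u\<bar> \<partial>P) + real n * (m * (2 * r))"
    unfolding V'_def by (rule sum_E[OF J'_meas J'_bound D_\<delta>2])
  have EW: "Q.expectation (\<lambda>z. \<bar>W (fst z) - L (fst z)\<bar>) \<le> sqrt rem_const / sqrt (real n)"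
  proof -
    have "Q.expectation (\<lambda>z. \<bar>W (fst z) - L (fst z)\<bar>) = (\<integral>u. \<bar>W u - L u\<bar> \<partial>P)"
      using W_meas[OF sd_pos] L_meas by (intro Q.integral_comp_fst[of "\<lambda>u. \<bar>W u - L u\<bar>"]) auto
    then show ?thesis using expectation_abs_W_minus_L_le[OF sd_pos] by simp
  qed
  have prob_eq: "Q.prob {z' \<in> space ?Q. W (fst z') \<le> z} = measure P {u \<in> space P. W u \<le> z}"
  proof -
    have "{z' \<in> space ?Q. W (fst z') \<le> z} = fst -` {u \<in> space P. W u \<le> z} \<inter> space ?Q"
      by (auto simp: space_pair_measure)
    then have "Q.prob {z' \<in> space ?Q. W (fst z') \<le> z} = measure (distr ?Q P fst) {u \<in> space P. W u \<le> z}"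
      using W_meas[OF sd_pos] by (subst measure_distr) auto
    then show ?thesis by (simp add: U.distr_pair_fst)
  qed
  have "\<bar>measure P {u \<in> space P. W u \<le> z} - \<Phi> z\<bar> \<le>
      (sqrt (real n) * ((4 * B\<^sup>2 / sd\<^sup>2 + 1) / real n) + real n * (m * (2 * r)))
      + 2 * (sqrt (real n) * m\<^sup>2 + real n * (m * (2 * r))) + 2 * (sqrt rem_const / sqrt (real n))"
  proof -
    have "d \<le> p + x + 2 * (q + x) + 2 * w"
      if "d \<le> 2 * a + 2 * b + 2 * c" "2 * a \<le> a' + x" "b \<le> b' + x" "c \<le> w" "a' \<le> p" "b' \<le> q"
      for d p x q w a b c a' b' :: real
      using that by simp
    from this[OF bound[of z, unfolded prob_eq] EV EV' EW EA EJ] show ?thesis .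
  qed
  \<comment> \<open>36 is 4 from \<open>EA\<close> plus twice 16 from \<open>EJ\<close>, and the 1
    is the centring in \<open>A\<close>. The term \<open>real n * (m * (2 * r))\<close> equals
    \<open>8 * B * sqrt rem_const / sd / sqrt (real n)\<close> and occurs three times, hence
    24.\<close>
  also have "\<dots> = (36 * B\<^sup>2 / sd\<^sup>2 + 1 + 24 * B * sqrt rem_const / sd + 2 * sqrt rem_const) / sqrt (real n)"
  proof -
    define t where "t = sqrt (real n)"
    have t: "0 < t" "real n = t * t" using n_pos by (auto simp: t_def)
    show ?thesis
      using sd_pos t(1) unfolding m_def r_def t_def[symmetric] unfolding t(2)
      by (simp add: field_simps power2_eq_square)
  qed
  finally show ?thesis .
qed

end

section \<open>Copies of a graph under relabelling\<close>

definition index_pairs :: "nat \<Rightarrow> (nat \<times> nat) set" where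
  "index_pairs k = {(i, j). 1 \<le> i \<and> i < j \<and> j \<le> k}"

lemma finite_index_pairs [simp]: "finite (index_pairs k)"
  by (rule finite_subset[of _ "{1..k} \<times> {1..k}"]) (auto simp: index_pairs_def)

text \<open>\<open>b\<close> selects the induced count.\<close>

definition pair_factor :: "bool \<Rightarrow> bool \<Rightarrow> real \<Rightarrow> real" where
  "pair_factor b e y = (if e then y else if b then 1 - y else 1)"

text \<open>A product over all pairs, with trivial factors for non-edges in the injective case: the
  index set does not depend on H, and each pair occurs once, as the independence of the edges
  requires.\<close>

definition copy_prod :: "bool \<Rightarrow> nat pair_pre_digraph \<Rightarrow> nat \<Rightarrow> (nat \<Rightarrow> nat \<Rightarrow> real) \<Rightarrow> real" where
  "copy_prod b H k x = (\<Prod>(i, j)\<in>index_pairs k. pair_factor b ((i, j) \<in> parcs H) (x i j))"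

definition phi_gen :: "bool \<Rightarrow> 'v pair_pre_digraph \<Rightarrow> (nat \<Rightarrow> nat \<Rightarrow> real) \<Rightarrow> real" where
  "phi_gen b F x = (\<Sum>H\<in>copies F. copy_prod b H (num_nodes F) x)"

lemma copy_prod_eq:
  assumes "H \<in> copies F"
  shows "copy_prod b H (num_nodes F) x = (\<Prod>(i, j)\<in>edge_pairs H. x i j) *
    (if b then \<Prod>(i, j)\<in>nonedge_pairs H. 1 - x i j else 1)"
proof -
  have v: "pverts H = {1..num_nodes F}" using assms by (simp add: copies_def)
  have u: "index_pairs (num_nodes F) = edge_pairs H \<union> nonedge_pairs H"
    by (auto simp: index_pairs_def edge_pairs_def nonedge_pairs_def v)
  then have fin: "finite (edge_pairs H)" "finite (nonedge_pairs H)"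
    using finite_index_pairs[of "num_nodes F"] by simp_all
  have "edge_pairs H \<inter> nonedge_pairs H = {}"
    by (auto simp: edge_pairs_def nonedge_pairs_def)
  moreover have "(\<Prod>(i, j)\<in>edge_pairs H. pair_factor b ((i, j) \<in> parcs H) (x i j)) = (\<Prod>(i, j)\<in>edge_pairs H. x i j)"
    by (rule prod.cong) (auto simp: edge_pairs_def pair_factor_def)
  moreover have "(\<Prod>(i, j)\<in>nonedge_pairs H. pair_factor b ((i, j) \<in> parcs H) (x i j)) =
      (\<Prod>(i, j)\<in>nonedge_pairs H. if b then 1 - x i j else 1)"
    by (rule prod.cong) (auto simp: nonedge_pairs_def pair_factor_def)
  ultimately show ?thesis
    using fin by (cases b) (simp_all add: copy_prod_def u prod.union_disjoint)
qed

lemma phi_inj_eq: "phi_inj F = phi_gen False F"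
  by (rule ext) (simp add: phi_inj_def phi_gen_def copy_prod_eq cong: sum.cong)

lemma phi_ind_eq: "phi_ind F = phi_gen True F"
  by (rule ext) (simp add: phi_ind_def phi_gen_def copy_prod_eq cong: sum.cong)

lemma phi_gen_cong:
  assumes "\<And>i j. (i, j) \<in> index_pairs (num_nodes F) \<Longrightarrow> x i j = y i j"
  shows "phi_gen b F x = phi_gen b F y"
  unfolding phi_gen_def copy_prod_def using assms by (intro sum.cong prod.cong) auto

lemma abs_copy_prod_le_1:
  assumes "\<And>i j. (i, j) \<in> index_pairs k \<Longrightarrow> x i j \<in> {0..1}"
  shows "\<bar>copy_prod b H k x\<bar> \<le> 1"
  unfolding copy_prod_def abs_prod
  using assms by (intro prod_le_1) (auto simp: pair_factor_def)

lemma abs_phi_gen_le: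
  assumes "\<And>i j. (i, j) \<in> index_pairs (num_nodes F) \<Longrightarrow> x i j \<in> {0..1}"
  shows "\<bar>phi_gen b F x\<bar> \<le> real (card (copies F))"
proof -
  have "\<bar>phi_gen b F x\<bar> \<le> (\<Sum>H\<in>copies F. 1)"
    unfolding phi_gen_def by (intro order.trans[OF sum_abs sum_mono] abs_copy_prod_le_1 assms)
  then show ?thesis by simp
qed

text \<open>A permutation may reverse the order of a pair. The map \<open>r\<close> sorts the image
  again, which a symmetric \<open>t\<close> does not notice.\<close>

lemma prod_index_pairs_permute:
  fixes t :: "nat \<Rightarrow> nat \<Rightarrow> real"
  assumes p: "\<pi> permutes {1..k}" and sym: "\<And>i j. t i j = t j i"
  shows "(\<Prod>(i, j)\<in>index_pairs k. t (\<pi> i) (\<pi> j)) = (\<Prod>(i, j)\<in>index_pairs k. t i j)"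
proof -
  define r where "r \<sigma> = (\<lambda>(i :: nat, j). (min (\<sigma> i) (\<sigma> j :: nat), max (\<sigma> i) (\<sigma> j)))" for \<sigma>
  have r_in: "r \<sigma> q \<in> index_pairs k" if \<sigma>: "\<sigma> permutes {1..k}" and q: "q \<in> index_pairs k" for \<sigma> q
  proof -
    obtain i j where q': "q = (i, j)" "i \<in> {1..k}" "j \<in> {1..k}" "i \<noteq> j"
      using q by (auto simp: index_pairs_def)
    then have "\<sigma> i \<in> {1..k}" "\<sigma> j \<in> {1..k}" "\<sigma> i \<noteq> \<sigma> j"
      using permutes_in_image[OF \<sigma>] permutes_inj[OF \<sigma>] by (auto simp: inj_eq)
    then show ?thesis by (auto simp: q' r_def index_pairs_def min_def max_def)
  qed
  have r_inv: "r \<sigma>' (r \<sigma> q) = q" if "\<And>i. \<sigma>' (\<sigma> i) = i" and "q \<in> index_pairs k" for \<sigma> \<sigma>' q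
    using that by (auto simp: r_def index_pairs_def min_def max_def)
  show ?thesis
  proof (rule prod.reindex_bij_witness[of _ "r (inv \<pi>)" "r \<pi>"])
    fix q assume q: "q \<in> index_pairs k"
    show "r (inv \<pi>) (r \<pi> q) = q" "r \<pi> (r (inv \<pi>) q) = q"
      using q permutes_inverses[OF p] by (auto intro!: r_inv)
    show "r \<pi> q \<in> index_pairs k" "r (inv \<pi>) q \<in> index_pairs k"
      using r_in p permutes_inv[OF p] q by auto
    show "(case r \<pi> q of (i, j) \<Rightarrow> t i j) = (case q of (i, j) \<Rightarrow> t (\<pi> i) (\<pi> j))"
      using sym by (cases q) (auto simp: r_def min_def max_def)
  qed
qed

definition relabel :: "(nat \<Rightarrow> nat) \<Rightarrow> nat pair_pre_digraph \<Rightarrow> nat pair_pre_digraph" where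
  "relabel \<pi> H = \<lparr>pverts = \<pi> ` pverts H, parcs = map_prod \<pi> \<pi> ` parcs H\<rparr>"

lemma relabel_simps [simp]:
  "pverts (relabel \<pi> H) = \<pi> ` pverts H" "parcs (relabel \<pi> H) = map_prod \<pi> \<pi> ` parcs H"
  by (simp_all add: relabel_def)

lemma relabel_inverse: "(\<And>i. \<sigma> (\<pi> i) = i) \<Longrightarrow> relabel \<sigma> (relabel \<pi> H) = H"
  by (cases H) (simp add: relabel_def image_image map_prod_def split_beta')

lemma relabel_in_copies:
  assumes p: "\<pi> permutes {1..num_nodes F}" and H: "H \<in> copies F"
  shows "relabel \<pi> H \<in> copies F"
proof -
  have H': "pair_graph H" "pverts H = {1..num_nodes F}" "digraph_iso (with_proj H) (with_proj F)"
    using H by (auto simp: copies_def)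
  interpret H: pair_graph H by fact
  have inj: "inj \<pi>" using permutes_inj[OF p] .
  have "pair_graph (relabel \<pi> H)"
  proof
    show "symmetric (with_proj (relabel \<pi> H))"
      using H.pair_sym_arcs by (auto simp: symmetric_def sym_def)
  qed (use H.in_arcsD1 H.in_arcsD2 H.pair_finite_verts H.pair_finite_arcs H.pair_no_loops inj
      in \<open>auto simp: inj_eq intro!: imageI\<close>)
  moreover have "digraph_iso (with_proj H) (with_proj (relabel \<pi> H))"
  proof -
    define f where "f = \<lparr>iso_verts = \<pi>, iso_arcs = map_prod \<pi> \<pi>, iso_head = snd, iso_tail = fst\<rparr>"
    have "pre_digraph.digraph_isomorphism (with_proj H) f"
      unfolding pre_digraph.digraph_isomorphism_def
    proof (intro conjI)
      show "wf_digraph (with_proj H)" by (rule H.wf_digraph_axioms)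
      show "inj_on (iso_verts f) (verts (with_proj H))"
        unfolding f_def by (simp add: inj_on_subset[OF inj])
      show "inj_on (iso_arcs f) (arcs (with_proj H))"
        unfolding f_def by (simp add: inj_on_subset[OF prod.inj_map[OF inj inj]])
    qed (simp add: f_def)
    moreover have "with_proj (relabel \<pi> H) = app_iso f (with_proj H)"
      by (simp add: app_iso_def f_def with_proj_def)
    ultimately show ?thesis by (auto simp: digraph_iso_def)
  qed
  then have "digraph_iso (with_proj (relabel \<pi> H)) (with_proj F)"
    using digraph_iso_swap[OF H.wf_digraph_axioms] H'(3) digraph_iso_trans by blast
  ultimately show ?thesis
    using H'(2) permutes_image[OF p] by (simp add: copies_def)
qed

lemma copy_prod_relabel:
  assumes p: "\<pi> permutes {1..k}" and H: "pair_graph H" and x: "\<And>i j. x i j = x j i"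
  shows "copy_prod b (relabel \<pi> H) k x = copy_prod b H k (\<lambda>i j. x (\<pi> i) (\<pi> j))"
proof -
  interpret H: pair_graph H by fact
  have inj: "inj \<pi>" using permutes_inj[OF p] .
  have sym: "(i, j) \<in> parcs H \<longleftrightarrow> (j, i) \<in> parcs H" for i j
    using H.pair_sym_arcs by (auto simp: symmetric_def sym_def)
  define t where "t i j = pair_factor b ((i, j) \<in> parcs (relabel \<pi> H)) (x i j)" for i j
  have arcs_sym: "(j, i) \<in> parcs (relabel \<pi> H)" if "(i, j) \<in> parcs (relabel \<pi> H)" for i j
    using that sym by (auto intro: rev_image_eqI)
  have "t i j = t j i" for i j
    unfolding t_def x[of i j] using arcs_sym[of i j] arcs_sym[of j i]
    by (intro arg_cong2[where f = "pair_factor b"]) blast+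
  then have "copy_prod b (relabel \<pi> H) k x = (\<Prod>(i, j)\<in>index_pairs k. t (\<pi> i) (\<pi> j))"
    using prod_index_pairs_permute[OF p, of t] by (simp add: copy_prod_def t_def)
  moreover have "(\<pi> i, \<pi> j) \<in> parcs (relabel \<pi> H) \<longleftrightarrow> (i, j) \<in> parcs H" for i j
    using inj_image_mem_iff[OF prod.inj_map[OF inj inj], of "(i, j)" "parcs H"] by simp
  ultimately show ?thesis
    by (simp add: copy_prod_def t_def del: relabel_simps)
qed

text \<open>Relabelling permutes the copies of F. Consequently the kernel is symmetric in its nodes,
  and its projection does not depend on the position of the node that is fixed.\<close>

lemma phi_gen_permute:
  assumes p: "\<pi> permutes {1..num_nodes F}" and x: "\<And>i j. x i j = x j i"
  shows "phi_gen b F (\<lambda>i j. x (\<pi> i) (\<pi> j)) = phi_gen b F x"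
proof -
  have "phi_gen b F (\<lambda>i j. x (\<pi> i) (\<pi> j)) = (\<Sum>H\<in>copies F. copy_prod b (relabel \<pi> H) (num_nodes F) x)"
    unfolding phi_gen_def using copy_prod_relabel[OF p _ x]
    by (intro sum.cong) (auto simp: copies_def)
  also have "\<dots> = phi_gen b F x"
    unfolding phi_gen_def
  proof (rule sum.reindex_bij_witness[of _ "relabel (inv \<pi>)" "relabel \<pi>"])
    fix H assume H: "H \<in> copies F"
    show "relabel (inv \<pi>) (relabel \<pi> H) = H" "relabel \<pi> (relabel (inv \<pi>) H) = H"
      using permutes_inverses[OF p] by (auto intro!: relabel_inverse)
    show "relabel \<pi> H \<in> copies F" "relabel (inv \<pi>) H \<in> copies F"
      using relabel_in_copies H p permutes_inv[OF p] by auto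
  qed simp
  finally show ?thesis .
qed

section \<open>Increasing maps as k-element subsets\<close>

lemma increasing_maps_mono:
  "\<alpha> \<in> increasing_maps k n \<Longrightarrow> i \<in> {1..k} \<Longrightarrow> j \<in> {1..k} \<Longrightarrow> i < j \<Longrightarrow> \<alpha> i < \<alpha> j"
  by (auto simp: increasing_maps_def strict_mono_on_def)

lemma increasing_maps_inj_on: "\<alpha> \<in> increasing_maps k n \<Longrightarrow> inj_on \<alpha> {1..k}"
  using increasing_maps_mono by (metis linorder_inj_onI' less_irrefl)

lemma increasing_maps_in: "\<alpha> \<in> increasing_maps k n \<Longrightarrow> i \<in> {1..k} \<Longrightarrow> \<alpha> i \<in> {1..n}"
  by (auto simp: increasing_maps_def)

text \<open>An increasing map lists its image in sorted order, and a finite set has only one sorted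
  list; outside {1..k} the maps are fixed by extensionality.\<close>

lemma bij_betw_increasing_maps:
  "bij_betw (\<lambda>\<alpha>. \<alpha> ` {1..k}) (increasing_maps k n) {A. A \<subseteq> {1..n} \<and> card A = k}"
proof (rule bij_betw_imageI)
  show "inj_on (\<lambda>\<alpha>. \<alpha> ` {1..k}) (increasing_maps k n)"
  proof (rule inj_onI)
    fix \<alpha> \<beta> assume \<alpha>: "\<alpha> \<in> increasing_maps k n" and \<beta>: "\<beta> \<in> increasing_maps k n"
      and eq: "\<alpha> ` {1..k} = \<beta> ` {1..k}"
    have list: "sorted (map \<gamma> [1..<Suc k]) \<and> distinct (map \<gamma> [1..<Suc k])" if \<gamma>: "\<gamma> \<in> increasing_maps k n" for \<gamma>
    proof
      have "sorted_wrt (\<lambda>i j. \<gamma> i \<le> \<gamma> j) [1..<Suc k]"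
        by (rule sorted_wrt_mono_rel[OF _ sorted_wrt_upt])
           (use increasing_maps_mono[OF \<gamma>] in \<open>auto intro: less_imp_le\<close>)
      then show "sorted (map \<gamma> [1..<Suc k])" by (simp only: sorted_wrt_map)
      have "{1..<Suc k} = {1..k}" by auto
      then show "distinct (map \<gamma> [1..<Suc k])"
        using increasing_maps_inj_on[OF \<gamma>] by (simp only: distinct_map set_upt) simp
    qed
    have "{1..<Suc k} = {1..k}" by auto
    then have "map \<alpha> [1..<Suc k] = map \<beta> [1..<Suc k]"
      using list[OF \<alpha>] list[OF \<beta>] eq by (intro sorted_distinct_set_unique) (simp_all only: set_map set_upt)
    then have "\<alpha> i = \<beta> i" if "i \<in> {1..k}" for i
      using that by (simp only: map_eq_conv set_upt) simp
    then show "\<alpha> = \<beta>"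
      using \<alpha> \<beta> by (intro PiE_ext[of \<alpha> "{1..k}" "\<lambda>_. {1..n}"]) (auto simp: increasing_maps_def)
  qed
  show "(\<lambda>\<alpha>. \<alpha> ` {1..k}) ` increasing_maps k n = {A. A \<subseteq> {1..n} \<and> card A = k}"
  proof (intro subset_antisym subsetI)
    fix A assume A: "A \<in> {A. A \<subseteq> {1..n} \<and> card A = k}"
    then have fin: "finite A" using finite_subset by auto
    define xs where "xs = sorted_list_of_set A"
    have xs: "length xs = k" "set xs = A" "sorted_wrt (<) xs"
      using A fin by (simp_all add: xs_def)
    \<comment> \<open>Positions are counted from 1, list entries from 0.\<close>
    define \<alpha> where "\<alpha> = (\<lambda>i\<in>{1..k}. xs ! (i - 1))"
    have "\<alpha> \<in> increasing_maps k n"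
      unfolding increasing_maps_def
    proof (intro CollectI conjI strict_mono_onI)
      show "\<alpha> \<in> {1..k} \<rightarrow>\<^sub>E {1..n}"
      proof (rule PiE_I)
        fix i assume "i \<in> {1..k}"
        then have "\<alpha> i \<in> set xs" using xs(1) by (auto simp: \<alpha>_def)
        then show "\<alpha> i \<in> {1..n}" using xs(2) A by blast
      qed (auto simp: \<alpha>_def)
      fix i j assume "i \<in> {1..k}" "j \<in> {1..k}" "i < j"
      then show "\<alpha> i < \<alpha> j"
        using sorted_wrt_nth_less[OF xs(3), of "i - 1" "j - 1"] xs(1) by (auto simp: \<alpha>_def)
    qed
    moreover have "\<alpha> ` {1..k} = A"
    proof -
      have "(\<lambda>i. i - 1) ` {1..k} = {..<k}"
        by (auto simp: image_iff intro!: bexI[of _ "Suc _"])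
      then have "\<alpha> ` {1..k} = (!) xs ` {..<k}"
        by (simp add: \<alpha>_def image_image[symmetric, of "(!) xs" "\<lambda>i. i - 1"] del: One_nat_def)
      also have "\<dots> = A" using xs by (auto simp: set_conv_nth)
      finally show ?thesis .
    qed
    ultimately show "A \<in> (\<lambda>\<alpha>. \<alpha> ` {1..k}) ` increasing_maps k n" by blast
  next
    fix A assume "A \<in> (\<lambda>\<alpha>. \<alpha> ` {1..k}) ` increasing_maps k n"
    then obtain \<alpha> where \<alpha>: "\<alpha> \<in> increasing_maps k n" "A = \<alpha> ` {1..k}" by blast
    then show "A \<in> {A. A \<subseteq> {1..n} \<and> card A = k}"
      using increasing_maps_in[OF \<alpha>(1)] card_image[OF increasing_maps_inj_on[OF \<alpha>(1)]] by auto
  qed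
qed

section \<open>Completed measures and Borel versions\<close>

abbreviation unif :: "real measure" where
  "unif \<equiv> uniform_measure lborel {0..1}"

abbreviation unif_prod :: "'i set \<Rightarrow> ('i \<Rightarrow> real) measure" where
  "unif_prod J \<equiv> Pi\<^sub>M J (\<lambda>_. unif)"

lemma prob_space_unif: "prob_space unif"
  by (rule prob_space_uniform_measure) auto

lemma finite_product_prob_space_unif: "finite J \<Longrightarrow> finite_product_prob_space (\<lambda>_. unif) J"
  by (intro finite_product_prob_space.intro product_prob_space.intro product_sigma_finite.intro
      finite_product_sigma_finite.intro finite_product_sigma_finite_axioms.intro product_prob_space_axioms.intro
      prob_space_unif prob_space_imp_sigma_finite)

lemma unif_component_meas: "c \<in> J \<Longrightarrow> (\<lambda>u. u c) \<in> borel_measurable (unif_prod J)"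
  using measurable_component_singleton[of c J "\<lambda>_. unif"] by simp

text \<open>Almost every section of a planar null set is null, and the uniform law inherits null
  sets from Lebesgue measure on the unit interval. A measurable cover \<open>N\<close> replaces the
  exceptional set, so that the sections can be reassembled in the product.\<close>

lemma AE_unif_pair:
  fixes P :: "real \<times> real \<Rightarrow> bool"
  assumes "AE z in lborel. z \<in> {0..1} \<times> {0..1} \<longrightarrow> P z"
  shows "AE z in unif \<Otimes>\<^sub>M unif. z \<in> {0..1} \<times> {0..1} \<and> P z"
proof -
  interpret U: prob_space unif by (rule prob_space_unif)
  interpret UU: pair_prob_space unif unif ..
  obtain N where N: "{z \<in> space lborel. \<not> (z \<in> {0..1} \<times> {0..1} \<longrightarrow> P z)} \<subseteq> N" "emeasure lborel N = 0" "N \<in> sets lborel"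
    using AE_E[OF assms] by blast
  have "AE z in lborel \<Otimes>\<^sub>M lborel. z \<notin> N"
    unfolding lborel_prod using N by (intro AE_not_in) (auto simp: null_sets_def)
  then have "AE x in lborel. AE y in lborel. (x, y) \<notin> N"
    by (rule lborel_pair.AE_pair)
  moreover have unifI: "AE x in unif. R x" if "AE x in lborel. x \<in> {0..1} \<longrightarrow> R x" for R :: "real \<Rightarrow> bool"
    using that by (subst AE_uniform_measure) auto
  ultimately have "AE x in unif. AE y in unif. (x, y) \<in> {0..1} \<times> {0..1} - N"
    by (intro unifI) (auto elim!: eventually_mono intro!: unifI)
  moreover have "{0..1} \<times> {0..1} - N \<in> sets (unif \<Otimes>\<^sub>M unif)"
  proof -
    have "sets (unif \<Otimes>\<^sub>M unif) = sets (borel :: (real \<times> real) measure)"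
      unfolding borel_prod[symmetric] by (rule sets_pair_measure_cong) auto
    moreover have "{0..1} \<times> {0..1} \<in> sets (borel :: (real \<times> real) measure)"
      by (intro borel_closed closed_Times) auto
    ultimately show ?thesis using N(3) by auto
  qed
  ultimately have "AE z in unif \<Otimes>\<^sub>M unif. z \<in> {0..1} \<times> {0..1} - N"
  proof (intro UU.AE_pair_measure)
    have "{z \<in> space (unif \<Otimes>\<^sub>M unif). z \<in> {0..1} \<times> {0..1} - N} = {0..1} \<times> {0..1} - N"
      by (auto simp: space_pair_measure)
    moreover assume "{0..1} \<times> {0..1} - N \<in> sets (unif \<Otimes>\<^sub>M unif)"
    ultimately show "{z \<in> space (unif \<Otimes>\<^sub>M unif). z \<in> {0..1} \<times> {0..1} - N} \<in> sets (unif \<Otimes>\<^sub>M unif)"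
      by (simp only:)
  qed
  then show ?thesis
    by eventually_elim (use N(1) in auto)
qed

lemma AE_unif_pair_swap:
  assumes "AE z in unif \<Otimes>\<^sub>M unif. P z"
  shows "AE z in unif \<Otimes>\<^sub>M unif. P (prod.swap z)"
proof -
  interpret U: prob_space unif by (rule prob_space_unif)
  interpret UU: pair_prob_space unif unif ..
  have "AE z in distr (unif \<Otimes>\<^sub>M unif) (unif \<Otimes>\<^sub>M unif) (\<lambda>(x, y). (y, x)). P z"
    using assms by (simp only: UU.distr_pair_swap[symmetric])
  then have "AE z in unif \<Otimes>\<^sub>M unif. P ((\<lambda>(x, y). (y, x)) z)"
    by (rule AE_distrD[rotated]) simp
  then show ?thesis by (simp add: split_beta' prod.swap_def)
qed

text \<open>A Borel version \<open>g\<close> agrees with the graphon only almost everywhere, so its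
  range and symmetry may fail on a null set. Clamping to [0,1] and averaging with the swapped
  argument repairs both everywhere, without changing values where \<open>g\<close> agrees at z and
  at its mirror image.\<close>

lemma graphon_borel_version:
  assumes "graphon \<kappa>"
  obtains \<kappa>' where "\<kappa>' \<in> borel_measurable borel" "\<And>z. \<kappa>' z \<in> {0..1::real}" "\<And>x y. \<kappa>' (x, y) = \<kappa>' (y, x)"
    "AE z in unif \<Otimes>\<^sub>M unif. \<kappa> z = \<kappa>' z"
proof -
  let ?S = "{0..1} \<times> {0..1} :: (real \<times> real) set"
  have \<kappa>: "\<kappa> \<in> borel_measurable (lebesgue_on ?S)"
    "\<And>x y. x \<in> {0..1} \<Longrightarrow> y \<in> {0..1} \<Longrightarrow> \<kappa> (x, y) \<in> {0..1}"
    "\<And>x y. x \<in> {0..1} \<Longrightarrow> y \<in> {0..1} \<Longrightarrow> \<kappa> (x, y) = \<kappa> (y, x)"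
    using assms by (auto simp: graphon_def)
  have S: "?S \<in> sets lebesgue"
    by (intro sets_completionI_sets) (auto intro!: borel_closed closed_Times)
  have "(\<lambda>z. if z \<in> ?S then \<kappa> z else 0) \<in> borel_measurable lebesgue"
    using \<kappa>(1) S by (subst measurable_restrict_space_iff[symmetric]) auto
  then obtain g where g: "g \<in> borel_measurable lborel" "AE z in lborel. (if z \<in> ?S then \<kappa> z else 0) = g z"
    using completion_ex_borel_measurable_real by blast
  have [measurable]: "g \<in> borel_measurable borel" using g(1) by simp
  define c where "c t = max 0 (min 1 t)" for t :: real
  have [measurable]: "c \<in> borel_measurable borel" unfolding c_def[abs_def] by measurable
  define \<kappa>' where "\<kappa>' z = (c (g z) + c (g (prod.swap z))) / 2" for z
  have ae: "AE z in unif \<Otimes>\<^sub>M unif. z \<in> ?S \<and> \<kappa> z = g z"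
    by (rule AE_unif_pair) (use g(2) in \<open>auto elim: eventually_mono\<close>)
  show ?thesis
  proof
    have "prod.swap \<in> measurable borel (borel :: (real \<times> real) measure)"
      by (intro borel_measurable_continuous_onI continuous_on_swap)
    note [measurable] = this
    show "\<kappa>' \<in> borel_measurable borel"
      unfolding \<kappa>'_def[abs_def] by measurable
    show "\<kappa>' z \<in> {0..1}" for z
      by (auto simp: \<kappa>'_def c_def)
    show "\<kappa>' (x, y) = \<kappa>' (y, x)" for x y
      by (simp add: \<kappa>'_def)
    show "AE z in unif \<Otimes>\<^sub>M unif. \<kappa> z = \<kappa>' z"
      using ae AE_unif_pair_swap[OF ae]
    proof eventually_elim
      case (elim z)
      then have "g z = \<kappa> z" "g (prod.swap z) = \<kappa> z" "\<kappa> z \<in> {0..1}"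
        using \<kappa>(2)[of "fst z" "snd z"] \<kappa>(3)[of "fst z" "snd z"] by (auto simp: prod.swap_def)
      then show ?case by (simp add: \<kappa>'_def c_def)
    qed
  qed
qed

lemma (in finite_product_prob_space) distr_two_components:
  assumes ij: "i \<in> I" "j \<in> I" "i \<noteq> j"
  shows "distr (Pi\<^sub>M I M) (M i \<Otimes>\<^sub>M M j) (\<lambda>u. (u i, u j)) = M i \<Otimes>\<^sub>M M j"
proof (rule sym, rule pair_measure_eqI)
  fix A B assume A: "A \<in> sets (M i)" and B: "B \<in> sets (M j)"
  define C where "C l = (if l = i then A else if l = j then B else space (M l))" for l
  have C: "C l \<in> sets (M l)" for l using A B by (auto simp: C_def)
  have m: "(\<lambda>u. (u i, u j)) \<in> measurable (Pi\<^sub>M I M) (M i \<Otimes>\<^sub>M M j)"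
    using ij by (intro measurable_Pair measurable_component_singleton)
  have "(\<lambda>u. (u i, u j)) -` (A \<times> B) \<inter> space (Pi\<^sub>M I M) = (\<Pi>\<^sub>E l\<in>I. C l)"
  proof (intro subset_antisym subsetI)
    fix u assume "u \<in> (\<Pi>\<^sub>E l\<in>I. C l)"
    moreover from this have "u \<in> space (Pi\<^sub>M I M)"
      using sets.sets_into_space[OF C] by (auto simp: space_PiM PiE_iff)
    ultimately have "u i \<in> C i" "u j \<in> C j" "u \<in> space (Pi\<^sub>M I M)"
      using ij by (auto dest: PiE_mem)
    then show "u \<in> (\<lambda>u. (u i, u j)) -` (A \<times> B) \<inter> space (Pi\<^sub>M I M)"
      using ij by (simp add: C_def)
  qed (auto simp: C_def space_PiM PiE_iff)
  then have "emeasure (distr (Pi\<^sub>M I M) (M i \<Otimes>\<^sub>M M j) (\<lambda>u. (u i, u j))) (A \<times> B) = (\<Prod>l\<in>I. emeasure (M l) (C l))"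
    using A B C by (subst emeasure_distr[OF m]) (auto simp: measure_times)
  also have "\<dots> = emeasure (M i) A * emeasure (M j) B"
    using ij finite_index
    by (subst prod.remove[of I i], simp, simp, subst prod.remove[of "I - {i}" j])
       (auto simp: C_def M.emeasure_space_1)
  finally show "emeasure (M i) A * emeasure (M j) B =
      emeasure (distr (Pi\<^sub>M I M) (M i \<Otimes>\<^sub>M M j) (\<lambda>u. (u i, u j))) (A \<times> B)" ..
qed (auto intro: M.sigma_finite_measure_axioms)

text \<open>Distinct coordinates are essential: only then does the pair have the product law,
  whereas a repeated coordinate would stay on the diagonal, a null set.\<close>

lemma AE_unif_components:
  assumes J: "finite J" "i \<in> J" "j \<in> J" "i \<noteq> j" and ae: "AE z in unif \<Otimes>\<^sub>M unif. R z"
  shows "AE u in unif_prod J. R (u i, u j)"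
proof -
  interpret finite_product_prob_space "\<lambda>_. unif" J by (rule finite_product_prob_space_unif) fact
  have "AE z in distr (unif_prod J) (unif \<Otimes>\<^sub>M unif) (\<lambda>u. (u i, u j)). R z"
    using ae by (simp only: distr_two_components[OF J(2-4)])
  then show ?thesis
    by (rule AE_distrD[rotated]) (intro measurable_Pair measurable_component_singleton J)
qed

section \<open>Almost everywhere equality and completed measures\<close>

lemma pred_completion_AE:
  assumes "AE x in M. P x \<longleftrightarrow> Q x" "Measurable.pred M Q"
  shows "Measurable.pred (completion M) P"
proof -
  have "Measurable.pred (completion M) (\<lambda>x. P x \<noteq> Q x)"
    by (rule sets_completion_AE) (use assms(1) in auto)
  moreover have "Measurable.pred (completion M) Q"
    using measurable_completion[OF assms(2)] .
  \<comment> \<open>P is the exclusive or of Q with the exceptional null set.\<close>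
  ultimately have "Measurable.pred (completion M) (\<lambda>x. Q x \<noteq> (P x \<noteq> Q x))"
    by measurable
  then show ?thesis by (rule measurable_cong[THEN iffD1, rotated]) auto
qed

lemma borel_measurable_completion_AE:
  fixes f g :: "'a \<Rightarrow> real"
  assumes "AE x in M. f x = g x" and [measurable]: "g \<in> borel_measurable M"
  shows "f \<in> borel_measurable (completion M)"
  unfolding borel_measurable_iff_le
proof
  fix a
  have "Measurable.pred (completion M) (\<lambda>x. f x \<le> a)"
    by (rule pred_completion_AE[where Q = "\<lambda>x. g x \<le> a"]) (use assms(1) in auto)
  then show "{w \<in> space (completion M). f w \<le> a} \<in> sets (completion M)"
    by (simp add: pred_def)
qed

lemma integral_completion_AE:
  fixes f g :: "'a \<Rightarrow> real"
  assumes "AE x in M. f x = g x" "g \<in> borel_measurable M"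
  shows "integral\<^sup>L (completion M) f = integral\<^sup>L M g"
proof -
  have "integral\<^sup>L (completion M) f = integral\<^sup>L (completion M) g"
    using borel_measurable_completion_AE[OF assms] measurable_completion[OF assms(2)] AE_completion[OF assms(1)]
    by (rule integral_cong_AE)
  then show ?thesis using integral_completion[OF assms(2)] by simp
qed

lemma measure_completion_AE:
  assumes "AE x in M. P x \<longleftrightarrow> Q x" "Measurable.pred M Q"
  shows "measure (completion M) {x \<in> space M. P x} = measure M {x \<in> space M. Q x}"
proof -
  have "measure (completion M) {x \<in> space (completion M). P x} = measure (completion M) {x \<in> space (completion M). Q x}"
    using pred_completion_AE[OF assms] measurable_completion[OF assms(2)] AE_completion[OF assms(1)]
    by (intro measure_eq_AE) (auto simp: pred_def)
  then show ?thesis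
    using assms(2) by (simp add: pred_def)
qed

text \<open>By independence the other coordinates are averaged out: on the event that
  \<open>u j\<close> lies in D, coordinate j is resampled and Fubini yields the defining identity.
  \<open>Z\<close> is measurable for the completion only, so the computation runs through the
  version \<open>Z'\<close>.\<close>

lemma real_cond_exp_unif_component:
  fixes Z Z' :: "('i \<Rightarrow> real) \<Rightarrow> real" and J :: "'i set"
  defines "N \<equiv> unif_prod J"
  assumes J: "finite J" "j \<in> J" and Z': "Z' \<in> borel_measurable N" "\<And>u. \<bar>Z' u\<bar> \<le> B" and Z: "AE u in N. Z u = Z' u"
    and g_meas: "(\<lambda>x. \<integral>w. Z' (w(j := x)) \<partial>N) \<in> borel_measurable borel"
  shows "AE u in completion N. real_cond_exp (completion N) (vimage_algebra (space (completion N)) (\<lambda>u. u j) borel) Z u =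
    (\<integral>w. Z' (w(j := u j)) \<partial>N)"
proof -
  interpret N: finite_product_prob_space "\<lambda>_. unif" J by (rule finite_product_prob_space_unif) fact
  interpret Q: pair_prob_space N unif unfolding N_def ..
  define g where "g x = (\<integral>w. Z' (w(j := x)) \<partial>N)" for x
  let ?F = "vimage_algebra (space (completion N)) (\<lambda>u. u j) borel"
  have g [measurable]: "g \<in> borel_measurable borel" using g_meas by (simp add: g_def[abs_def])
  have comp [measurable]: "(\<lambda>u. u j) \<in> borel_measurable N"
    unfolding N_def by (rule unif_component_meas[OF J(2)])
  have sets_F: "sets ?F = {(\<lambda>u. u j) -` A \<inter> space N | A. A \<in> sets borel}"
    by (subst sets_vimage_algebra2) auto
  have sub: "subalgebra (completion N) ?F"
    unfolding subalgebra_def sets_F using measurable_sets[OF comp] by auto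
  have prob: "prob_space N" unfolding N_def by (rule N.prob_space_axioms)
  interpret C: prob_space "completion N"
    using prob by (intro prob_spaceI) (simp add: prob_space.emeasure_space_1)
  interpret finite_measure_subalgebra "completion N" ?F
    by standard (rule sub)
  have r_meas: "(\<lambda>(u, x). u(j := x)) \<in> measurable (N \<Otimes>\<^sub>M unif) N"
    unfolding N_def by (rule N.measurable_resample[OF J(2)])
  have r_distr: "distr (N \<Otimes>\<^sub>M unif) N (\<lambda>(u, x). u(j := x)) = N"
    unfolding N_def by (rule N.distr_resample[OF J(2)])
  have gb: "\<bar>g x\<bar> \<le> B" for x
  proof -
    have "x \<in> space unif" by simp
    from measurable_compose[OF N.measurable_resample_const[OF J(2) this] Z'(1)[unfolded N_def]]
    have "\<bar>\<integral>w. Z' (w(j := x)) * 1 \<partial>N\<bar> \<le> B * (\<integral>w. \<bar>1\<bar> \<partial>N)"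
      unfolding N_def using Z'(2) by (intro N.P.abs_expectation_mult_le) auto
    then show ?thesis using prob by (simp add: g_def prob_space.prob_space)
  qed
  have "AE u in completion N. real_cond_exp (completion N) ?F Z u = g (u j)"
  proof (rule real_cond_exp_charact)
    have "integrable N Z'"
      using prob Z' by (intro prob_space.integrable_bounded_real) auto
    then have "integrable (completion N) Z'"
      using integrable_completion[OF Z'(1)] by simp
    then show "integrable (completion N) Z"
      using integrable_cong_AE[OF borel_measurable_completion_AE[OF Z Z'(1)] measurable_completion[OF Z'(1)] AE_completion[OF Z]]
      by simp
    have gm: "(\<lambda>u. g (u j)) \<in> borel_measurable N" by measurable
    then show "integrable (completion N) (\<lambda>u. g (u j))"
      using gb by (intro C.integrable_bounded_real[OF measurable_completion])
    show "(\<lambda>u. g (u j)) \<in> borel_measurable ?F"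
      by (rule measurable_compose[OF measurable_vimage_algebra1 g]) auto
    fix A assume "A \<in> sets ?F"
    then obtain D where D: "A = (\<lambda>u. u j) -` D \<inter> space N" "D \<in> sets borel" unfolding sets_F by blast
    note [measurable] = D(2)
    have set_int: "(\<integral>u\<in>A. f u \<partial>completion N) = (\<integral>u. indicator D (u j) * f u \<partial>completion N)" for f :: "_ \<Rightarrow> real"
      unfolding set_lebesgue_integral_def
      by (rule Bochner_Integration.integral_cong) (auto simp: D(1) split: split_indicator)
    have im: "(\<lambda>u. indicator D (u j) * Z' u) \<in> borel_measurable N" using Z'(1) by measurable
    have "(\<integral>u\<in>A. Z u \<partial>completion N) = (\<integral>u. indicator D (u j) * Z' u \<partial>N)"
      unfolding set_int using Z by (intro integral_completion_AE im) auto
    also have "\<dots> = (\<integral>z. indicator D (snd z) * Z' ((fst z)(j := snd z)) \<partial>(N \<Otimes>\<^sub>M unif))"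
      using integral_distr[OF r_meas im] r_distr by (simp add: split_beta')
    also have "\<dots> = (\<integral>x. (\<integral>w. indicator D x * Z' (w(j := x)) \<partial>N) \<partial>unif)"
    proof -
      have "(\<lambda>z. Z' ((fst z)(j := snd z))) \<in> borel_measurable (N \<Otimes>\<^sub>M unif)"
        using measurable_compose[OF r_meas Z'(1)] by (simp add: split_beta')
      moreover have "(\<lambda>z. indicator D (snd z) :: real) \<in> borel_measurable (N \<Otimes>\<^sub>M unif)"
        using D(2) by (intro measurable_compose[OF measurable_snd] borel_measurable_indicator) simp
      ultimately have "integrable (N \<Otimes>\<^sub>M unif) (\<lambda>z. indicator D (snd z) * Z' ((fst z)(j := snd z)))"
        using Z'(2) by (intro Q.integrable_mult_bounded[where B = 1 and C = B]) (auto split: split_indicator)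
      then show ?thesis
        using Q.integral_snd[of "\<lambda>w x. indicator D x * Z' (w(j := x))"] by (simp add: split_beta')
    qed
    also have "\<dots> = (\<integral>x. indicator D x * g x \<partial>unif)"
      by (simp add: g_def)
    also have "\<dots> = (\<integral>u. indicator D (u j) * g (u j) \<partial>N)"
    proof -
      have "distr N unif (\<lambda>u. u j) = unif"
        unfolding N_def by (rule distr_PiM_component[OF prob_space_unif J(2)])
      moreover have "(\<lambda>x. indicator D x * g x) \<in> borel_measurable unif"
        by (subst measurable_cong_sets[where M' = borel and N' = borel]) (simp, simp, measurable)
      moreover have "(\<lambda>u. u j) \<in> measurable N unif"
        using comp by simp
      ultimately show ?thesis
        using integral_distr[of "\<lambda>u. u j" N unif "\<lambda>x. indicator D x * g x"] by (simp only:)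
    qed
    also have "\<dots> = (\<integral>u\<in>A. g (u j) \<partial>completion N)"
      unfolding set_int by (rule integral_completion[symmetric]) measurable
    finally show "(\<integral>u\<in>A. Z u \<partial>completion N) = (\<integral>u\<in>A. g (u j) \<partial>completion N)" .
  qed
  then show ?thesis by (simp add: g_def)
qed

section \<open>Subgraph counts as U-statistics\<close>

lemma borel_measurable_of_bool_le:
  fixes f g :: "'a \<Rightarrow> real"
  assumes [measurable]: "f \<in> borel_measurable M" "g \<in> borel_measurable M"
  shows "(\<lambda>x. of_bool (f x \<le> g x) :: real) \<in> borel_measurable M"
  by measurable

lemma integral_unif_of_bool_le:
  assumes "c \<in> {0..1}"
  shows "(\<integral>y. of_bool (y \<le> c) \<partial>unif) = (c :: real)"
proof -
  have "(\<integral>y. of_bool (y \<le> c) \<partial>unif) = (\<integral>y. indicator {..c} y \<partial>unif :: real)"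
    by (rule Bochner_Integration.integral_cong) (auto simp: indicator_def)
  also have "\<dots> = measure unif {..c}" by simp
  also have "\<dots> = measure lborel ({0..1} \<inter> {..c}) / measure lborel {0..1::real}"
    by (rule measure_uniform_measure) auto
  also have "{0..1} \<inter> {..c} = {0..c}" using assms by auto
  finally show ?thesis using assms by simp
qed

lemma integral_pair_factor:
  assumes "c \<in> {0..1}"
  shows "(\<integral>y. pair_factor b e (of_bool (y \<le> c)) \<partial>unif) = pair_factor b e c"
    and "integrable unif (\<lambda>y. pair_factor b e (of_bool (y \<le> c)))"
proof -
  interpret prob_space unif by (rule prob_space_unif)
  have int: "integrable unif (\<lambda>y. of_bool (y \<le> c) :: real)"
    by (rule integrable_bounded_real[where B = 1]) auto
  show "integrable unif (\<lambda>y. pair_factor b e (of_bool (y \<le> c)))"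
    using int by (cases e; cases b) (simp_all add: pair_factor_def)
  show "(\<integral>y. pair_factor b e (of_bool (y \<le> c)) \<partial>unif) = pair_factor b e c"
    using int integral_unif_of_bool_le[OF assms]
    by (cases e; cases b) (simp_all add: pair_factor_def prob_space del: of_bool_less_eq_iff)
qed

lemma borel_measurable_copy_prod:
  assumes "\<And>i j. (i, j) \<in> index_pairs k \<Longrightarrow> (\<lambda>u. x u i j) \<in> borel_measurable M"
  shows "(\<lambda>u. copy_prod b H k (x u)) \<in> borel_measurable M"
proof -
  have "(\<lambda>u. pair_factor b ((i, j) \<in> parcs H) (x u i j)) \<in> borel_measurable M"
    if "(i, j) \<in> index_pairs k" for i j
    using assms[OF that] by (cases "(i, j) \<in> parcs H"; cases b) (simp_all add: pair_factor_def)
  then show ?thesis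
    unfolding copy_prod_def by (intro borel_measurable_prod) auto
qed

lemma borel_measurable_phi_gen:
  assumes "\<And>i j. (i, j) \<in> index_pairs (num_nodes F) \<Longrightarrow> (\<lambda>u. x u i j) \<in> borel_measurable M"
  shows "(\<lambda>u. phi_gen b F (x u)) \<in> borel_measurable M"
  unfolding phi_gen_def by (intro borel_measurable_sum borel_measurable_copy_prod assms)

text \<open>Distinct coordinates are independent; \<open>e\<close> selects them, so that factors
  indexed by pairs can be read from edge coordinates.\<close>

lemma (in finite_product_prob_space) integral_prod_components:
  fixes g :: "'p \<Rightarrow> 'b \<Rightarrow> real"
  assumes e: "inj_on e A" "e \<in> A \<rightarrow> I" and A: "finite A"
    and int: "\<And>p. p \<in> A \<Longrightarrow> integrable (M (e p)) (g p)"
  shows "(\<integral>u. (\<Prod>p\<in>A. g p (u (e p))) \<partial>Pi\<^sub>M I M) = (\<Prod>p\<in>A. integral\<^sup>L (M (e p)) (g p))"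
proof -
  interpret A: product_sigma_finite "\<lambda>p. M (e p)"
    ..
  have [measurable]: "g p \<in> borel_measurable (M (e p))" if "p \<in> A" for p
    using int[OF that] by auto
  have m: "(\<lambda>u. \<lambda>p\<in>A. u (e p)) \<in> measurable (Pi\<^sub>M I M) (Pi\<^sub>M A (\<lambda>p. M (e p)))"
    using e(2) by (intro measurable_restrict measurable_component_singleton) auto
  have "(\<lambda>w. \<Prod>p\<in>A. g p (w p)) \<in> borel_measurable (Pi\<^sub>M A (\<lambda>p. M (e p)))"
    by measurable
  then have "(\<integral>u. (\<Prod>p\<in>A. g p ((\<lambda>p\<in>A. u (e p)) p)) \<partial>Pi\<^sub>M I M) =
      (\<integral>w. (\<Prod>p\<in>A. g p (w p)) \<partial>Pi\<^sub>M A (\<lambda>p. M (e p)))"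
    using integral_distr[OF m, of "\<lambda>w. \<Prod>p\<in>A. g p (w p)"] distr_PiM_reindex[of I M e A] e M.prob_space_axioms
    by simp
  also have "\<dots> = (\<Prod>p\<in>A. integral\<^sup>L (M (e p)) (g p))"
    by (rule A.product_integral_prod[OF A int])
  finally show ?thesis by (simp cong: prod.cong)
qed

text \<open>Here \<open>\<kappa>\<close> is the Borel version with its properties valid everywhere.
  The graphon that was given enters the lemmas of this locale as \<open>\<kappa>'\<close>, an almost
  everywhere equal function.\<close>

locale graphon_count =
  fixes \<kappa> :: "real \<times> real \<Rightarrow> real" and b :: bool and F :: "'v pair_pre_digraph" and n :: nat
  assumes \<kappa>_meas: "\<kappa> \<in> borel_measurable borel"
    and \<kappa>_range: "\<And>z. \<kappa> z \<in> {0..1}"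
    and \<kappa>_sym: "\<And>x y. \<kappa> (x, y) = \<kappa> (y, x)"
    and nodes_pos: "1 \<le> num_nodes F" and nodes_le: "num_nodes F \<le> n"
begin

abbreviation "k \<equiv> num_nodes F"

abbreviation kernel :: "(nat \<Rightarrow> real) \<Rightarrow> real" where
  "kernel x \<equiv> phi_gen b F (\<lambda>i j. \<kappa> (x i, x j))"

text \<open>Left summands carry the node variables X, right summands the edge variables Y.\<close>

definition coord_set :: "(nat + nat \<times> nat) set" where
  "coord_set = {1..n} <+> index_pairs n"

abbreviation "\<Omega> \<equiv> unif_prod coord_set"

definition adj :: "(nat + nat \<times> nat \<Rightarrow> real) \<Rightarrow> nat \<Rightarrow> nat \<Rightarrow> real" where
  "adj = adjacency \<kappa> (\<lambda>i u. u (Inl i)) (\<lambda>i j u. u (Inr (i, j)))"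

definition local_count :: "(nat \<Rightarrow> nat) \<Rightarrow> (nat + nat \<times> nat \<Rightarrow> real) \<Rightarrow> real" where
  "local_count \<alpha> u = phi_gen b F (\<lambda>i j. adj u (\<alpha> i) (\<alpha> j))"

definition coords_of :: "(nat \<Rightarrow> nat) \<Rightarrow> (nat + nat \<times> nat) set" where
  "coords_of \<alpha> = (let A = \<alpha> ` {1..k} in Inl ` A \<union> Inr ` {(i, j). i \<in> A \<and> j \<in> A \<and> i < j})"

text \<open>The concrete form of the conditional expectation defining f1, with the first node fixed
  at x; a Borel function defined everywhere.\<close>

definition proj :: "real \<Rightarrow> real" where
  "proj x = (\<integral>w. kernel (w(1 := x)) \<partial>unif_prod {1..k})"

lemma finite_coord_set: "finite coord_set"
  by (simp add: coord_set_def)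

sublocale \<Omega>: finite_product_prob_space "\<lambda>_. unif" coord_set
  by (rule finite_product_prob_space_unif[OF finite_coord_set])

sublocale cube: finite_product_prob_space "\<lambda>_. unif" "{1..k}"
  by (rule finite_product_prob_space_unif) simp

lemma Inl_in: "i \<in> {1..n} \<Longrightarrow> Inl i \<in> coord_set"
  by (auto simp: coord_set_def)

lemma adj_eq: "i < j \<Longrightarrow> adj u i j = of_bool (u (Inr (i, j)) \<le> \<kappa> (u (Inl i), u (Inl j)))"
  by (simp add: adj_def adjacency_def min_def max_def)

lemma pair_in:
  assumes "\<alpha> \<in> increasing_maps k n" "(i, j) \<in> index_pairs k"
  shows "\<alpha> i < \<alpha> j" "\<alpha> i \<in> {1..n}" "\<alpha> j \<in> {1..n}" "Inr (\<alpha> i, \<alpha> j) \<in> coord_set"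
    "Inl (\<alpha> i) \<in> coord_set" "Inl (\<alpha> j) \<in> coord_set"
proof -
  have ij: "i \<in> {1..k}" "j \<in> {1..k}" "i < j" using assms(2) by (auto simp: index_pairs_def)
  show 1: "\<alpha> i < \<alpha> j" by (rule increasing_maps_mono[OF assms(1) ij])
  show 2: "\<alpha> i \<in> {1..n}" "\<alpha> j \<in> {1..n}" using increasing_maps_in[OF assms(1)] ij by auto
  show "Inr (\<alpha> i, \<alpha> j) \<in> coord_set" "Inl (\<alpha> i) \<in> coord_set" "Inl (\<alpha> j) \<in> coord_set"
    using 1 2 by (auto simp: coord_set_def index_pairs_def)
qed

lemma \<kappa>_compose: "f \<in> borel_measurable M \<Longrightarrow> g \<in> borel_measurable M \<Longrightarrow> (\<lambda>u. \<kappa> (f u, g u)) \<in> borel_measurable M"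
  by (rule measurable_compose[OF borel_measurable_Pair \<kappa>_meas])

lemma coord_meas: "c \<in> coord_set \<Longrightarrow> (\<lambda>u. u c) \<in> borel_measurable \<Omega>"
  by (rule unif_component_meas)

lemma local_count_meas:
  assumes \<alpha>: "\<alpha> \<in> increasing_maps k n"
  shows "local_count \<alpha> \<in> borel_measurable \<Omega>"
  unfolding local_count_def[abs_def]
proof (rule borel_measurable_phi_gen)
  fix i j assume ij: "(i, j) \<in> index_pairs k"
  note p = pair_in[OF \<alpha> ij]
  show "(\<lambda>u. adj u (\<alpha> i) (\<alpha> j)) \<in> borel_measurable \<Omega>"
    unfolding adj_eq[OF p(1)] by (intro borel_measurable_of_bool_le coord_meas \<kappa>_compose p)
qed

lemma abs_local_count_le: "\<bar>local_count \<alpha> u\<bar> \<le> real (card (copies F))"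
  unfolding local_count_def by (rule abs_phi_gen_le) (simp add: adj_def adjacency_def)

lemma local_count_cong:
  assumes \<alpha>: "\<alpha> \<in> increasing_maps k n" and eq: "\<And>c. c \<in> coords_of \<alpha> \<Longrightarrow> u c = v c"
  shows "local_count \<alpha> u = local_count \<alpha> v"
  unfolding local_count_def
proof (rule phi_gen_cong)
  fix i j assume ij: "(i, j) \<in> index_pairs k"
  note p = pair_in[OF \<alpha> ij]
  have "Inl (\<alpha> i) \<in> coords_of \<alpha>" "Inl (\<alpha> j) \<in> coords_of \<alpha>" "Inr (\<alpha> i, \<alpha> j) \<in> coords_of \<alpha>"
    using ij p(1) by (auto simp: coords_of_def index_pairs_def Let_def)
  then show "adj u (\<alpha> i) (\<alpha> j) = adj v (\<alpha> i) (\<alpha> j)"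
    using eq by (simp add: adj_eq[OF p(1)])
qed

text \<open>With the node values fixed, the edge indicators are independent with means given by
  \<open>\<kappa>\<close>. Each pair enters a copy product through one affine factor, so averaging
  replaces the indicator by its mean.\<close>

lemma integral_edges:
  assumes \<alpha>: "\<alpha> \<in> increasing_maps k n"
  shows "(\<integral>v. phi_gen b F (\<lambda>i j. of_bool (v (Inr (\<alpha> i, \<alpha> j)) \<le> \<kappa> (x (\<alpha> i), x (\<alpha> j)))) \<partial>\<Omega>) =
    kernel (\<lambda>i. x (\<alpha> i))"
proof -
  let ?g = "\<lambda>(H :: nat pair_pre_digraph) (i, j) y. pair_factor b ((i, j) \<in> parcs H) (of_bool (y \<le> \<kappa> (x (\<alpha> i), x (\<alpha> j))))"
  let ?e = "\<lambda>(i, j). Inr (\<alpha> i, \<alpha> j) :: nat + nat \<times> nat"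
  have e: "inj_on ?e (index_pairs k)" "?e \<in> index_pairs k \<rightarrow> coord_set"
    using inj_onD[OF increasing_maps_inj_on[OF \<alpha>]] pair_in[OF \<alpha>]
    by (auto simp: inj_on_def index_pairs_def)
  have meas: "(\<lambda>v. \<Prod>p\<in>index_pairs k. ?g H p (v (?e p))) \<in> borel_measurable \<Omega>" for H
  proof (rule borel_measurable_prod)
    fix p assume p: "p \<in> index_pairs k"
    then have "(\<lambda>v. v (?e p)) \<in> borel_measurable \<Omega>"
      using e by (intro coord_meas) auto
    then have [measurable]: "(\<lambda>v. of_bool (v (?e p) \<le> \<kappa> (x (\<alpha> (fst p)), x (\<alpha> (snd p)))) :: real) \<in> borel_measurable \<Omega>"
      by (intro borel_measurable_of_bool_le) auto
    have "(\<lambda>v. pair_factor b (p \<in> parcs H) (of_bool (v (?e p) \<le> \<kappa> (x (\<alpha> (fst p)), x (\<alpha> (snd p)))))) \<in> borel_measurable \<Omega>"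
      by (cases "p \<in> parcs H"; cases b) (simp_all add: pair_factor_def)
    then show "(\<lambda>v. ?g H p (v (?e p))) \<in> borel_measurable \<Omega>"
      by (simp add: split_beta')
  qed
  have "integrable \<Omega> (\<lambda>v. \<Prod>p\<in>index_pairs k. ?g H p (v (?e p)))" for H
  proof (rule \<Omega>.integrable_bounded_real[OF meas, where B = 1])
    show "\<bar>\<Prod>p\<in>index_pairs k. ?g H p (v (?e p))\<bar> \<le> 1" for v
      using abs_copy_prod_le_1[of k "\<lambda>i j. of_bool (v (Inr (\<alpha> i, \<alpha> j)) \<le> \<kappa> (x (\<alpha> i), x (\<alpha> j)))" b H]
      by (simp add: copy_prod_def split_beta')
  qed
  then have "(\<integral>v. phi_gen b F (\<lambda>i j. of_bool (v (Inr (\<alpha> i, \<alpha> j)) \<le> \<kappa> (x (\<alpha> i), x (\<alpha> j)))) \<partial>\<Omega>) =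
      (\<Sum>H\<in>copies F. \<integral>v. (\<Prod>p\<in>index_pairs k. ?g H p (v (?e p))) \<partial>\<Omega>)"
    unfolding phi_gen_def copy_prod_def
    by (subst Bochner_Integration.integral_sum[symmetric]) (simp_all add: split_beta')
  also have "\<dots> = (\<Sum>H\<in>copies F. \<Prod>p\<in>index_pairs k. integral\<^sup>L unif (?g H p))"
    by (intro sum.cong refl \<Omega>.integral_prod_components e finite_index_pairs)
       (use integral_pair_factor(2)[OF \<kappa>_range] in auto)
  also have "\<dots> = kernel (\<lambda>i. x (\<alpha> i))"
    unfolding phi_gen_def copy_prod_def
    by (intro sum.cong prod.cong refl) (use integral_pair_factor(1)[OF \<kappa>_range] in auto)
  finally show ?thesis .
qed

lemma update_meas:
  assumes "a \<in> {1..k}" "g \<in> borel_measurable M" "h \<in> measurable M (unif_prod {1..k})"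
  shows "(\<lambda>z. ((h z)(1 := g z)) a) \<in> borel_measurable M"
proof (cases "a = 1")
  case False
  have "(\<lambda>w. w a) \<in> borel_measurable (unif_prod {1..k})"
    by (rule unif_component_meas[OF assms(1)])
  from measurable_compose[OF assms(3) this] show ?thesis using False by simp
qed (use assms in simp)

lemma copy_prod_update_meas:
  assumes "g \<in> borel_measurable M" "h \<in> measurable M (unif_prod {1..k})"
  shows "(\<lambda>z. copy_prod b H k (\<lambda>i j. \<kappa> (((h z)(1 := g z)) i, ((h z)(1 := g z)) j))) \<in> borel_measurable M"
  by (rule borel_measurable_copy_prod) (intro \<kappa>_compose update_meas assms; auto simp: index_pairs_def)

lemma phi_gen_update_meas:
  assumes "g \<in> borel_measurable M" "h \<in> measurable M (unif_prod {1..k})"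
  shows "(\<lambda>z. kernel ((h z)(1 := g z))) \<in> borel_measurable M"
  unfolding phi_gen_def by (intro borel_measurable_sum copy_prod_update_meas assms)

lemma abs_phi_gen_\<kappa>_le: "\<bar>kernel x\<bar> \<le> real (card (copies F))"
  by (rule abs_phi_gen_le) (rule \<kappa>_range)

lemma proj_meas: "proj \<in> borel_measurable borel"
proof -
  have "(\<lambda>(x, w). kernel (w(1 := x))) \<in>
      borel_measurable (borel \<Otimes>\<^sub>M unif_prod {1..k})"
    unfolding split_beta' by (intro phi_gen_update_meas measurable_fst measurable_snd)
  then show ?thesis
    unfolding proj_def[abs_def] by (rule cube.borel_measurable_lebesgue_integral)
qed

lemma abs_proj_le: "\<bar>proj x\<bar> \<le> real (card (copies F))"
proof -
  have "\<bar>\<integral>w. kernel (w(1 := x)) * 1 \<partial>unif_prod {1..k}\<bar> \<le>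
      real (card (copies F)) * (\<integral>w. \<bar>1\<bar> \<partial>unif_prod {1..k})"
    by (rule cube.abs_expectation_mult_le) (intro phi_gen_update_meas abs_phi_gen_\<kappa>_le cube.P.integrable_const; simp)+
  then show ?thesis by (simp add: proj_def cube.P.prob_space del: One_nat_def)
qed

text \<open>The edges are integrated out first; the remaining function of the nodes is symmetric, so
  the fixed node can be moved to the first position, where the integral is
  \<open>proj\<close>.\<close>

lemma integral_local_count_update:
  assumes \<alpha>: "\<alpha> \<in> increasing_maps k n" and i: "i \<in> \<alpha> ` {1..k}"
  shows "(\<integral>u. local_count \<alpha> (u(Inl i := x)) \<partial>\<Omega>) = proj x"
proof -
  interpret QQ: pair_prob_space \<Omega> \<Omega> ..
  obtain j where j: "j \<in> {1..k}" "i = \<alpha> j" using i by blast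
  \<comment> \<open>The node i occupies position j of the subset; this transposition brings it to
    position 1.\<close>
  let ?\<pi> = "Transposition.transpose 1 j"
  let ?w = "\<lambda>u. (\<lambda>a\<in>{1..k}. u (Inl (\<alpha> (?\<pi> a))))(1 := x)"
  have i': "Inl i \<in> coord_set" using increasing_maps_in[OF \<alpha> j(1)] j(2) Inl_in by simp
  \<comment> \<open>Edge coordinates are taken from an independent second copy, so that Fubini
    separates them from the nodes.\<close>
  define f where "f = (\<lambda>(u, v). \<lambda>c\<in>coord_set. if c \<in> range Inr then v c else (u c :: real))"
  define y where "y u a = (u(Inl i := x)) (Inl a)" for u :: "nat + nat \<times> nat \<Rightarrow> real" and a :: nat
  have f_meas: "f \<in> measurable (\<Omega> \<Otimes>\<^sub>M \<Omega>) \<Omega>"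
    unfolding f_def by (rule \<Omega>.measurable_mix)
  have f_distr: "distr (\<Omega> \<Otimes>\<^sub>M \<Omega>) \<Omega> f = \<Omega>"
    unfolding f_def by (rule \<Omega>.distr_mix)
  have h_meas: "(\<lambda>u. local_count \<alpha> (u(Inl i := x))) \<in> borel_measurable \<Omega>"
    by (rule measurable_compose[OF \<Omega>.measurable_resample_const[OF i'] local_count_meas[OF \<alpha>]]) simp
  have hf_meas: "(\<lambda>z. local_count \<alpha> ((f z)(Inl i := x))) \<in> borel_measurable (\<Omega> \<Otimes>\<^sub>M \<Omega>)"
    by (rule measurable_compose[OF f_meas h_meas])
  have count: "local_count \<alpha> ((f (u, v))(Inl i := x)) =
      phi_gen b F (\<lambda>a c. of_bool (v (Inr (\<alpha> a, \<alpha> c)) \<le> \<kappa> (y u (\<alpha> a), y u (\<alpha> c))))" for u v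
    unfolding local_count_def
  proof (rule phi_gen_cong)
    fix a c assume "(a, c) \<in> index_pairs k"
    note p = pair_in[OF \<alpha> this]
    show "adj ((f (u, v))(Inl i := x)) (\<alpha> a) (\<alpha> c) = of_bool (v (Inr (\<alpha> a, \<alpha> c)) \<le> \<kappa> (y u (\<alpha> a), y u (\<alpha> c)))"
      using p(4-6) by (auto simp: adj_eq[OF p(1)] f_def y_def)
  qed
  have "(\<integral>u. local_count \<alpha> (u(Inl i := x)) \<partial>\<Omega>) = (\<integral>z. local_count \<alpha> ((f z)(Inl i := x)) \<partial>(\<Omega> \<Otimes>\<^sub>M \<Omega>))"
    using integral_distr[OF f_meas h_meas] f_distr by simp
  also have "\<dots> = (\<integral>u. (\<integral>v. local_count \<alpha> ((f (u, v))(Inl i := x)) \<partial>\<Omega>) \<partial>\<Omega>)"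
    by (rule QQ.integral_fst'[symmetric]) (rule QQ.integrable_bounded_real[OF hf_meas abs_local_count_le])
  also have "\<dots> = (\<integral>u. kernel (\<lambda>a. y u (\<alpha> a)) \<partial>\<Omega>)"
    unfolding count by (simp only: integral_edges[OF \<alpha>])
  also have "\<dots> = (\<integral>u. kernel (?w u) \<partial>\<Omega>)"
  proof (rule Bochner_Integration.integral_cong[OF refl])
    fix u
    have "1 \<in> {1..k}" using nodes_pos by simp
    then have perm: "?\<pi> permutes {1..k}"
      using j(1) by (intro permutes_swap_id)
    have "kernel (\<lambda>a. y u (\<alpha> a)) =
        kernel (\<lambda>a. y u (\<alpha> (?\<pi> a)))"
      using phi_gen_permute[OF perm, of "\<lambda>a c. \<kappa> (y u (\<alpha> a), y u (\<alpha> c))"] \<kappa>_sym by simp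
    also have "\<dots> = kernel (?w u)"
    proof (rule phi_gen_cong)
      have "y u (\<alpha> (?\<pi> a)) = ?w u a"
        if a: "a \<in> {1..k}" for a
      proof -
        have "?\<pi> a \<in> {1..k}" using permutes_in_image[OF perm] a by simp
        then have "\<alpha> (?\<pi> a) = i \<longleftrightarrow> ?\<pi> a = j"
          using inj_on_eq_iff[OF increasing_maps_inj_on[OF \<alpha>] _ j(1)] j(2) by simp
        also have "\<dots> \<longleftrightarrow> a = 1" by (auto simp: Transposition.transpose_def)
        finally show ?thesis using a by (simp add: y_def)
      qed
      moreover fix a c assume "(a, c) \<in> index_pairs k"
      then have "a \<in> {1..k}" "c \<in> {1..k}" by (auto simp: index_pairs_def)
      ultimately show "\<kappa> (y u (\<alpha> (?\<pi> a)), y u (\<alpha> (?\<pi> c))) =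
          \<kappa> (?w u a, ?w u c)"
        by (simp only:)
    qed
    finally show "kernel (\<lambda>a. y u (\<alpha> a)) =
        kernel (?w u)" .
  qed
  also have "\<dots> = proj x"
  proof -
    have "1 \<in> {1..k}" using nodes_pos by simp
    then have perm: "?\<pi> permutes {1..k}"
      using j(1) by (intro permutes_swap_id)
    let ?e = "\<lambda>a. Inl (\<alpha> (?\<pi> a)) :: nat + nat \<times> nat"
    have e_in: "?e \<in> {1..k} \<rightarrow> coord_set"
      using permutes_in_image[OF perm] increasing_maps_in[OF \<alpha>] Inl_in by blast
    have e_inj: "inj_on ?e {1..k}"
    proof (rule inj_onI)
      fix a c assume "a \<in> {1..k}" "c \<in> {1..k}" "?e a = ?e c"
      then show "a = c"
        using inj_onD[OF increasing_maps_inj_on[OF \<alpha>], of "?\<pi> a" "?\<pi> c"]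
          permutes_in_image[OF perm] permutes_inj[OF perm] by (auto simp: inj_eq)
    qed
    have m: "(\<lambda>u. \<lambda>a\<in>{1..k}. u (?e a)) \<in> measurable \<Omega> (unif_prod {1..k})"
      using e_in by (intro measurable_restrict measurable_component_singleton) auto
    have "distr \<Omega> (unif_prod {1..k}) (\<lambda>u. \<lambda>a\<in>{1..k}. u (?e a)) = unif_prod {1..k}"
      by (rule distr_PiM_reindex[OF prob_space_unif e_inj e_in])
    moreover have "(\<lambda>w. kernel (w(1 := x))) \<in> borel_measurable (unif_prod {1..k})"
      by (rule phi_gen_update_meas) auto
    ultimately show ?thesis
      using integral_distr[OF m, of "\<lambda>w. kernel (w(1 := x))"]
      by (simp add: proj_def)
  qed
  finally show ?thesis .
qed

text \<open>The kernels are indexed by increasing maps and bounded by the number of copies of F,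
  which becomes the constant B.\<close>

sublocale stat: u_statistic "\<lambda>_. unif" coord_set unif Inl n k "increasing_maps k n" "\<lambda>\<alpha>. \<alpha> ` {1..k}"
  coords_of local_count proj "real (card (copies F))"
proof
  show "bij_betw (\<lambda>\<alpha>. \<alpha> ` {1..k}) (increasing_maps k n) {A. A \<subseteq> {1..n} \<and> card A = k}"
    by (rule bij_betw_increasing_maps)
  show "proj \<in> borel_measurable unif"
    using proj_meas by simp
next
  fix \<alpha> assume \<alpha>: "\<alpha> \<in> increasing_maps k n"
  show "coords_of \<alpha> \<subseteq> coord_set"
  proof
    fix c assume c: "c \<in> coords_of \<alpha>"
    show "c \<in> coord_set"
    proof (cases c)
      case (Inl i)
      then show ?thesis using c increasing_maps_in[OF \<alpha>] Inl_in by (auto simp: coords_of_def Let_def)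
    next
      case (Inr p)
      obtain i j where p: "p = (i, j)" by (cases p)
      have "i \<in> {1..n}" "j \<in> {1..n}" "i < j"
        using c increasing_maps_in[OF \<alpha>] by (auto simp: coords_of_def Let_def Inr p)
      then show ?thesis by (simp add: coord_set_def index_pairs_def Inr p InrI)
    qed
  qed
  show "local_count \<alpha> \<in> borel_measurable \<Omega>" by (rule local_count_meas[OF \<alpha>])
  show "\<bar>local_count \<alpha> u\<bar> \<le> real (card (copies F))" for u by (rule abs_local_count_le)
  show "(\<integral>u. local_count \<alpha> (u(Inl i := x)) \<partial>\<Omega>) = proj x" if "i \<in> \<alpha> ` {1..k}" for i x
    by (rule integral_local_count_update[OF \<alpha> that])
  show "Inl i \<in> coords_of \<alpha> \<longleftrightarrow> i \<in> \<alpha> ` {1..k}" for i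
    by (auto simp: coords_of_def Let_def)
  show "local_count \<alpha> u = local_count \<alpha> v" if "\<And>c. c \<in> coords_of \<alpha> \<Longrightarrow> u c = v c" for u v
    by (rule local_count_cong[OF \<alpha> that])
next
  fix \<alpha> \<beta> :: "nat \<Rightarrow> nat" and i
  assume sub: "\<alpha> ` {1..k} \<inter> \<beta> ` {1..k} \<subseteq> {i}"
  show "coords_of \<alpha> \<inter> coords_of \<beta> \<subseteq> {Inl i}"
  proof
    fix c assume c: "c \<in> coords_of \<alpha> \<inter> coords_of \<beta>"
    show "c \<in> {Inl i}"
    proof (cases c)
      case (Inl j)
      then have "j \<in> \<alpha> ` {1..k} \<inter> \<beta> ` {1..k}" using c unfolding coords_of_def Let_def by blast
      then show ?thesis using sub Inl by blast
    next
      case (Inr p)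
      obtain j l where p: "p = (j, l)" by (cases p)
      have jl: "j < l" "j \<in> \<alpha> ` {1..k} \<inter> \<beta> ` {1..k}" "l \<in> \<alpha> ` {1..k} \<inter> \<beta> ` {1..k}"
        using c unfolding coords_of_def Let_def Inr p by blast+
      \<comment> \<open>A common edge coordinate would have two distinct endpoints in both supports,
        but only one common node is allowed.\<close>
      then show ?thesis using subsetD[OF sub jl(2)] subsetD[OF sub jl(3)] by simp
    qed
  qed
next
  show "\<bar>proj x\<bar> \<le> real (card (copies F))" for x by (rule abs_proj_le)
qed (fact nodes_pos nodes_le | simp add: Inl_in)+

end

section \<open>The Berry-Esseen bound for subgraph counts\<close>

definition T_gen :: "bool \<Rightarrow> 'v pair_pre_digraph \<Rightarrow> nat \<Rightarrow> (nat \<Rightarrow> nat \<Rightarrow> real) \<Rightarrow> real" where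
  "T_gen b F n \<xi> = (\<Sum>\<alpha>\<in>increasing_maps (num_nodes F) n. phi_gen b F (\<lambda>i j. \<xi> (\<alpha> i) (\<alpha> j)))"

definition f1_gen :: "bool \<Rightarrow> (real \<times> real \<Rightarrow> real) \<Rightarrow> 'v pair_pre_digraph \<Rightarrow> real \<Rightarrow> real" where
  "f1_gen b \<kappa> F x = (\<Sum>H\<in>copies F. cond_exp_at (cube (num_nodes F))
     (\<lambda>u. copy_prod b H (num_nodes F) (\<lambda>i j. \<kappa> (u i, u j))) (\<lambda>u. u 1) x)"

definition sigma_gen :: "bool \<Rightarrow> (real \<times> real \<Rightarrow> real) \<Rightarrow> 'v pair_pre_digraph \<Rightarrow> real" where
  "sigma_gen b \<kappa> F = (let M = cube (num_nodes F)
     in L2_norm_rv M (\<lambda>u. f1_gen b \<kappa> F (u 1) - integral\<^sup>L M (\<lambda>v. f1_gen b \<kappa> F (v 1))))"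

lemma T_inj_eq: "T_inj F = T_gen False F"
  by (intro ext) (simp add: T_inj_def T_gen_def phi_inj_eq)

lemma T_ind_eq: "T_ind F = T_gen True F"
  by (intro ext) (simp add: T_ind_def T_gen_def phi_ind_eq)

lemma f1_inj_eq: "f1_inj \<kappa> F = f1_gen False \<kappa> F"
  by (intro ext) (simp add: f1_inj_def f1_gen_def copy_prod_eq cong: sum.cong)

lemma f1_ind_eq: "f1_ind \<kappa> F = f1_gen True \<kappa> F"
  by (intro ext) (simp add: f1_ind_def f1_gen_def copy_prod_eq cong: sum.cong)

lemma sigma1_inj_eq: "sigma1_inj \<kappa> F = sigma_gen False \<kappa> F"
  by (simp add: sigma1_inj_def sigma_gen_def f1_inj_eq)

lemma sigma1_ind_eq: "sigma1_ind \<kappa> F = sigma_gen True \<kappa> F"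
  by (simp add: sigma1_ind_def sigma_gen_def f1_ind_eq)

lemma finite_copies: "finite (copies F)"
proof (rule finite_subset)
  show "copies F \<subseteq> (\<lambda>A. \<lparr>pverts = {1..num_nodes F}, parcs = A\<rparr>) ` Pow ({1..num_nodes F} \<times> {1..num_nodes F})"
  proof
    fix H assume "H \<in> copies F"
    then have H: "pair_graph H" "pverts H = {1..num_nodes F}" by (auto simp: copies_def)
    interpret pair_graph H by fact
    have "parcs H \<subseteq> {1..num_nodes F} \<times> {1..num_nodes F}"
      using in_arcsD1 in_arcsD2 H(2) by auto
    then show "H \<in> (\<lambda>A. \<lparr>pverts = {1..num_nodes F}, parcs = A\<rparr>) ` Pow ({1..num_nodes F} \<times> {1..num_nodes F})"
      using H(2) by (intro image_eqI[of _ _ "parcs H"]) auto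
  qed
qed simp

text \<open>Exhibiting one Borel version \<open>g\<close> shows that the choice in
  \<open>cond_exp_at\<close> succeeds; whatever is chosen then agrees with \<open>g\<close> up to a
  null set.\<close>

lemma cond_exp_at_eq:
  assumes "g \<in> borel_measurable borel"
    and "AE \<omega> in M. real_cond_exp M (vimage_algebra (space M) X borel) Z \<omega> = g (X \<omega>)"
  shows "cond_exp_at M Z X \<in> borel_measurable borel" and "AE \<omega> in M. cond_exp_at M Z X (X \<omega>) = g (X \<omega>)"
proof -
  let ?P = "\<lambda>g. g \<in> borel_measurable borel \<and>
     (AE \<omega> in M. g (X \<omega>) = real_cond_exp M (vimage_algebra (space M) X borel) Z \<omega>)"
  have "?P g" using assms by (auto elim: eventually_mono)
  then have P: "?P (cond_exp_at M Z X)"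
    unfolding cond_exp_at_def by (rule someI[where P = ?P])
  then show "cond_exp_at M Z X \<in> borel_measurable borel" by blast
  show "AE \<omega> in M. cond_exp_at M Z X (X \<omega>) = g (X \<omega>)"
    using conjunct2[OF P] assms(2) by eventually_elim simp
qed

text \<open>Without nodes the coordinate \<open>u 1\<close> is the constant \<open>undefined\<close>.\<close>

lemma sigma_gen_no_nodes:
  assumes "num_nodes F = 0"
  shows "sigma_gen b \<kappa> F = 0"
proof -
  have sp: "space (cube (num_nodes F)) = {\<lambda>_. undefined}"
    using assms by (simp add: cube_def space_PiM)
  interpret prob_space "cube (num_nodes F)"
  proof
    interpret N: finite_product_prob_space "\<lambda>_. unif" "{1..num_nodes F}" by (rule finite_product_prob_space_unif) simp
    show "emeasure (cube (num_nodes F)) (space (cube (num_nodes F))) = 1"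
      unfolding cube_def by (simp add: N.P.emeasure_space_1 del: One_nat_def)
  qed
  have "integral\<^sup>L (cube (num_nodes F)) (\<lambda>v. f1_gen b \<kappa> F (v 1)) =
      integral\<^sup>L (cube (num_nodes F)) (\<lambda>v. f1_gen b \<kappa> F undefined)"
    by (rule Bochner_Integration.integral_cong) (simp_all add: sp)
  then have "integral\<^sup>L (cube (num_nodes F)) (\<lambda>v. f1_gen b \<kappa> F (v 1)) = f1_gen b \<kappa> F undefined"
    by (simp add: prob_space)
  moreover have "integral\<^sup>L (cube (num_nodes F)) (\<lambda>u. (f1_gen b \<kappa> F (u 1) - f1_gen b \<kappa> F undefined)\<^sup>2) =
      integral\<^sup>L (cube (num_nodes F)) (\<lambda>u. 0)"
    by (rule Bochner_Integration.integral_cong) (simp_all add: sp)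
  ultimately show ?thesis
    by (simp add: sigma_gen_def L2_norm_rv_def)
qed

context graphon_count
begin

lemma AE_components_eq:
  assumes ae: "AE z in unif \<Otimes>\<^sub>M unif. \<kappa>' z = \<kappa> z" and J: "finite J"
    and P: "finite A" "\<And>i j. (i, j) \<in> A \<Longrightarrow> e i \<in> J \<and> e j \<in> J \<and> e i \<noteq> e j"
  shows "AE u in unif_prod J. \<forall>(i, j)\<in>A. \<kappa>' (u (e i), u (e j)) = \<kappa> (u (e i), u (e j))"
proof -
  have "AE u in unif_prod J. \<kappa>' (u (e (fst p)), u (e (snd p))) = \<kappa> (u (e (fst p)), u (e (snd p)))"
    if "p \<in> A" for p
    using AE_unif_components[OF J _ _ _ ae] P(2)[of "fst p" "snd p"] that by simp
  then have "AE u in unif_prod J. \<forall>p\<in>A. \<kappa>' (u (e (fst p)), u (e (snd p))) = \<kappa> (u (e (fst p)), u (e (snd p)))"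
    by (rule AE_finite_allI[OF P(1)])
  then show ?thesis by (simp add: split_beta')
qed

text \<open>A version is chosen separately for every copy of F. As there are finitely many copies,
  their null sets can be united, and the sum of the averaged copy products is the averaged
  kernel.\<close>

lemma f1_gen_eq:
  assumes ae: "AE z in unif \<Otimes>\<^sub>M unif. \<kappa>' z = \<kappa> z"
  shows "f1_gen b \<kappa>' F \<in> borel_measurable borel"
    and "AE u in unif_prod {1..k}. f1_gen b \<kappa>' F (u 1) = proj (u 1)"
proof -
  let ?N = "unif_prod {1..k}"
  define Z where "Z H u = copy_prod b H k (\<lambda>i j. \<kappa> (u i, u j))" for H :: "nat pair_pre_digraph" and u :: "nat \<Rightarrow> real"
  define Z' where "Z' H u = copy_prod b H k (\<lambda>i j. \<kappa>' (u i, u j))" for H :: "nat pair_pre_digraph" and u :: "nat \<Rightarrow> real"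
  define g where "g H x = (\<integral>w. Z H (w(1 := x)) \<partial>?N)" for H x
  have one: "1 \<in> {1..k}" using nodes_pos by simp
  have Z_meas: "Z H \<in> borel_measurable ?N" for H
    unfolding Z_def[abs_def]
    by (intro borel_measurable_copy_prod \<kappa>_compose unif_component_meas) (auto simp: index_pairs_def)
  have Z_bound: "\<bar>Z H u\<bar> \<le> 1" for H u
    unfolding Z_def by (rule abs_copy_prod_le_1) (rule \<kappa>_range)
  have "AE u in ?N. \<forall>(i, j)\<in>index_pairs k. \<kappa>' (u i, u j) = \<kappa> (u i, u j)"
    by (rule AE_components_eq[OF ae _ finite_index_pairs, where e = "\<lambda>i. i"]) (auto simp: index_pairs_def)
  then have ZZ': "AE u in ?N. Z' H u = Z H u" for H
    by eventually_elim (auto simp: Z_def Z'_def copy_prod_def intro!: prod.cong)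
  have g_meas: "g H \<in> borel_measurable borel" for H
  proof -
    have "(\<lambda>(x, w). Z H (w(1 := x))) \<in> borel_measurable (borel \<Otimes>\<^sub>M ?N)"
      unfolding split_beta' Z_def by (intro copy_prod_update_meas measurable_fst measurable_snd)
    then show ?thesis
      unfolding g_def[abs_def] by (rule cube.borel_measurable_lebesgue_integral)
  qed
  have ce: "AE u in Defs.cube k. real_cond_exp (Defs.cube k) (vimage_algebra (space (Defs.cube k)) (\<lambda>u. u 1) borel) (Z' H) u = g H (u 1)" for H
    unfolding cube_def g_def
    by (rule real_cond_exp_unif_component[OF _ one Z_meas Z_bound ZZ' g_meas[unfolded g_def]]) simp
  note c = cond_exp_at_eq[OF g_meas ce]
  have f1: "f1_gen b \<kappa>' F x = (\<Sum>H\<in>copies F. cond_exp_at (Defs.cube k) (Z' H) (\<lambda>u. u 1) x)" for x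
    unfolding f1_gen_def Z'_def ..
  show "f1_gen b \<kappa>' F \<in> borel_measurable borel"
    unfolding f1[abs_def] by (intro borel_measurable_sum c(1))
  have "AE u in Defs.cube k. \<forall>H\<in>copies F. cond_exp_at (Defs.cube k) (Z' H) (\<lambda>u. u 1) (u 1) = g H (u 1)"
    by (rule AE_finite_allI[OF finite_copies c(2)])
  then have "AE u in Defs.cube k. f1_gen b \<kappa>' F (u 1) = (\<Sum>H\<in>copies F. g H (u 1))"
    by eventually_elim (simp add: f1)
  moreover have "(\<Sum>H\<in>copies F. g H x) = proj x" for x
  proof -
    have "integrable ?N (\<lambda>w. Z H (w(1 := x)))" for H
      by (rule cube.integrable_bounded_real[OF measurable_compose[OF cube.measurable_resample_const[OF one] Z_meas] Z_bound]) simp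
    then show ?thesis
      unfolding g_def proj_def phi_gen_def Z_def by (intro Bochner_Integration.integral_sum[symmetric])
  qed
  ultimately have "AE u in Defs.cube k. f1_gen b \<kappa>' F (u 1) = proj (u 1)" by simp
  then show "AE u in ?N. f1_gen b \<kappa>' F (u 1) = proj (u 1)"
    unfolding cube_def AE_completion_iff .
qed

text \<open>\<open>stat.sd\<close> formally belongs to a structure depending on n; identifying it
  with a quantity of the graphon and F makes the constant uniform in n.\<close>

lemma sigma_gen_eq:
  assumes ae: "AE z in unif \<Otimes>\<^sub>M unif. \<kappa>' z = \<kappa> z"
  shows "sigma_gen b \<kappa>' F = stat.sd"
proof -
  let ?N = "unif_prod {1..k}"
  have one: "1 \<in> {1..k}" using nodes_pos by simp
  have first: "(\<lambda>u. u 1) \<in> borel_measurable ?N"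
    by (rule unif_component_meas[OF one])
  have int: "(\<integral>u. h (u 1) \<partial>?N) = integral\<^sup>L unif h" if h: "h \<in> borel_measurable borel" for h :: "real \<Rightarrow> real"
  proof -
    have "h \<in> borel_measurable unif"
      using h by (subst measurable_cong_sets[where M' = borel and N' = borel]) simp_all
    from integral_distr[OF measurable_component_singleton[OF one] this] show ?thesis
      unfolding distr_PiM_component[OF prob_space_unif one] ..
  qed
  have proj1: "(\<lambda>u. proj (u 1)) \<in> borel_measurable ?N"
    by (rule measurable_compose[OF first proj_meas])
  have mean: "integral\<^sup>L (Defs.cube k) (\<lambda>v. f1_gen b \<kappa>' F (v 1)) = stat.mu"
    unfolding cube_def integral_completion_AE[OF f1_gen_eq(2)[OF ae] proj1] int[OF proj_meas] stat.mu_def ..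
  have "integral\<^sup>L (Defs.cube k) (\<lambda>u. (f1_gen b \<kappa>' F (u 1) - stat.mu)\<^sup>2) = (\<integral>u. (proj (u 1) - stat.mu)\<^sup>2 \<partial>?N)"
    unfolding cube_def
    by (rule integral_completion_AE) (use f1_gen_eq(2)[OF ae] proj1 in \<open>auto elim: eventually_mono\<close>)
  also have "\<dots> = (\<integral>x. (proj x - stat.mu)\<^sup>2 \<partial>unif)"
    by (rule int) (use proj_meas in measurable)
  finally show ?thesis
    unfolding sigma_gen_def Let_def L2_norm_rv_def mean stat.sd_def by simp
qed

text \<open>Carries results from the canonical product space to an arbitrary space: joint
  independence of all X and Y says exactly that their joint law is the product.\<close>

lemma distr_coordinates:
  fixes M :: "'w measure"
  assumes "indep_uniforms M n X Y"
  defines "\<zeta> \<equiv> (\<lambda>\<omega>. \<lambda>c\<in>coord_set. case_sum X (\<lambda>(i, j). Y i j) c \<omega>)"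
  shows "\<zeta> \<in> measurable M \<Omega>" and "distr M \<Omega> \<zeta> = \<Omega>"
proof -
  let ?V = "case_sum X (\<lambda>(i, j). Y i j)"
  have ind: "prob_space M" "prob_space.indep_vars M (\<lambda>_. borel) ?V coord_set"
    "\<And>i. i \<in> {1..n} \<Longrightarrow> distr M borel (X i) = unif"
    "\<And>i j. (i, j) \<in> index_pairs n \<Longrightarrow> distr M borel (Y i j) = unif"
    using assms(1) by (auto simp: indep_uniforms_def coord_set_def index_pairs_def)
  interpret M: prob_space M by fact
  have rv: "?V c \<in> borel_measurable M" if "c \<in> coord_set" for c
    using ind(2) that by (auto simp: M.indep_vars_def)
  have ne: "coord_set \<noteq> {}"
    using nodes_pos nodes_le by (auto simp: coord_set_def)
  have sets_eq: "sets \<Omega> = sets (Pi\<^sub>M coord_set (\<lambda>_. borel))"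
    by (rule sets_PiM_cong) auto
  have "\<zeta> \<in> measurable M (Pi\<^sub>M coord_set (\<lambda>_. borel))"
    unfolding \<zeta>_def by (rule measurable_restrict) (rule rv)
  then show "\<zeta> \<in> measurable M \<Omega>"
    using measurable_cong_sets[OF refl sets_eq] by simp
  have "distr M \<Omega> \<zeta> = distr M (Pi\<^sub>M coord_set (\<lambda>_. borel)) \<zeta>"
    by (rule distr_cong) (simp_all add: sets_eq)
  also have "\<dots> = Pi\<^sub>M coord_set (\<lambda>c. distr M borel (?V c))"
    unfolding \<zeta>_def
    using M.indep_vars_iff_distr_eq_PiM'[where X = ?V and M' = "\<lambda>_. borel", OF ne rv] ind(2) by simp
  also have "\<dots> = \<Omega>"
    by (rule PiM_cong) (auto simp: coord_set_def ind(3,4))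
  finally show "distr M \<Omega> \<zeta> = \<Omega>" .
qed

text \<open>The count evaluates the graphon only at finitely many pairs of distinct nodes, so
  exchanging it for its Borel version changes the count on a null event only.\<close>

lemma T_gen_AE_eq:
  fixes M :: "'w measure"
  assumes ind: "indep_uniforms M n X Y" and ae: "AE z in unif \<Otimes>\<^sub>M unif. \<kappa>' z = \<kappa> z"
  defines "\<zeta> \<equiv> (\<lambda>\<omega>. \<lambda>c\<in>coord_set. case_sum X (\<lambda>(i, j). Y i j) c \<omega>)"
  shows "AE \<omega> in M. T_gen b F n (adjacency \<kappa>' X Y \<omega>) = (\<Sum>\<alpha>\<in>increasing_maps k n. local_count \<alpha> (\<zeta> \<omega>))"
proof -
  note \<zeta> = distr_coordinates[OF ind, folded \<zeta>_def]
  have "AE u in \<Omega>. \<forall>(i, j)\<in>index_pairs n. \<kappa>' (u (Inl i), u (Inl j)) = \<kappa> (u (Inl i), u (Inl j))"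
    by (rule AE_components_eq[OF ae finite_coord_set finite_index_pairs]) (auto simp: index_pairs_def intro!: Inl_in)
  then have "AE u in distr M \<Omega> \<zeta>. \<forall>(i, j)\<in>index_pairs n. \<kappa>' (u (Inl i), u (Inl j)) = \<kappa> (u (Inl i), u (Inl j))"
    unfolding \<zeta>(2) .
  then have "AE \<omega> in M. \<forall>(i, j)\<in>index_pairs n. \<kappa>' (\<zeta> \<omega> (Inl i), \<zeta> \<omega> (Inl j)) = \<kappa> (\<zeta> \<omega> (Inl i), \<zeta> \<omega> (Inl j))"
    by (rule AE_distrD[OF \<zeta>(1)])
  then show ?thesis
  proof eventually_elim
    case (elim \<omega>)
    show ?case
      unfolding T_gen_def local_count_def
    proof (intro sum.cong refl phi_gen_cong)
      fix \<alpha> i j assume \<alpha>: "\<alpha> \<in> increasing_maps k n" and ij: "(i, j) \<in> index_pairs k"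
      note p = pair_in[OF \<alpha> ij]
      have "(\<alpha> i, \<alpha> j) \<in> index_pairs n" using p(1-3) by (simp add: index_pairs_def)
      with elim have "\<kappa>' (\<zeta> \<omega> (Inl (\<alpha> i)), \<zeta> \<omega> (Inl (\<alpha> j))) = \<kappa> (\<zeta> \<omega> (Inl (\<alpha> i)), \<zeta> \<omega> (Inl (\<alpha> j)))" by blast
      then show "adjacency \<kappa>' X Y \<omega> (\<alpha> i) (\<alpha> j) = adj (\<zeta> \<omega>) (\<alpha> i) (\<alpha> j)"
        using p(1,4-6) by (simp add: adj_eq adjacency_def min_def max_def \<zeta>_def)
    qed
  qed
qed

lemma kolmogorov_distance_le:
  fixes M :: "'w measure"
  assumes ind: "indep_uniforms M n X Y" and ae: "AE z in unif \<Otimes>\<^sub>M unif. \<kappa>' z = \<kappa> z" and sd: "0 < stat.sd"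
  defines "T \<equiv> (\<lambda>\<omega>. T_gen b F n (adjacency \<kappa>' X Y \<omega>))"
  shows "\<bar>Pr M (\<lambda>\<omega>. sqrt (real n) / (real k * stat.sd) * inverse (real (n choose k)) * (T \<omega> - Expec M T) \<le> z)
      - cdf std_normal_distribution z\<bar> \<le>
    (36 * (real (card (copies F)))\<^sup>2 / stat.sd\<^sup>2 + 1 + 24 * real (card (copies F)) * sqrt stat.rem_const / stat.sd
      + 2 * sqrt stat.rem_const) / sqrt (real n)"
proof -
  define \<zeta> where "\<zeta> = (\<lambda>\<omega>. \<lambda>c\<in>coord_set. case_sum X (\<lambda>(i, j). Y i j) c \<omega>)"
  note \<zeta> = distr_coordinates[OF ind, folded \<zeta>_def]
  define S where "S u = (\<Sum>\<alpha>\<in>increasing_maps k n. local_count \<alpha> u)" for u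
  have T: "AE \<omega> in M. T \<omega> = S (\<zeta> \<omega>)"
    unfolding T_def S_def \<zeta>_def by (rule T_gen_AE_eq[OF ind ae])
  have S_meas: "S \<in> borel_measurable \<Omega>"
    unfolding S_def[abs_def] by (intro borel_measurable_sum local_count_meas)
  have S\<zeta>: "(\<lambda>\<omega>. S (\<zeta> \<omega>)) \<in> borel_measurable M"
    by (rule measurable_compose[OF \<zeta>(1) S_meas])
  have "Expec M T = (\<integral>\<omega>. S (\<zeta> \<omega>) \<partial>M)"
    unfolding Expec_def by (rule integral_completion_AE[OF T S\<zeta>])
  also have "\<dots> = integral\<^sup>L \<Omega> S"
    using integral_distr[OF \<zeta>(1) S_meas] \<zeta>(2) by simp
  also have "\<dots> = (\<Sum>\<alpha>\<in>increasing_maps k n. integral\<^sup>L \<Omega> (local_count \<alpha>))"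
    unfolding S_def
    by (rule Bochner_Integration.integral_sum) (rule \<Omega>.integrable_bounded_real[OF local_count_meas abs_local_count_le])
  also have "\<dots> = real (n choose k) * stat.mu"
    using stat.integral_\<phi> stat.card_idx by simp
  finally have E: "Expec M T = real (n choose k) * stat.mu" .
  have W: "sqrt (real n) / (real k * stat.sd) * inverse (real (n choose k)) * (S u - Expec M T) = stat.W u" for u
    unfolding E S_def stat.W_def stat.norm_const_def ..
  have pred: "Measurable.pred \<Omega> (\<lambda>u. stat.W u \<le> z)"
    using stat.W_meas[OF sd] by measurable
  have "Pr M (\<lambda>\<omega>. sqrt (real n) / (real k * stat.sd) * inverse (real (n choose k)) * (T \<omega> - Expec M T) \<le> z)
      = measure M {\<omega> \<in> space M. stat.W (\<zeta> \<omega>) \<le> z}"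
    unfolding Pr_def
  proof (rule measure_completion_AE)
    show "AE \<omega> in M. (sqrt (real n) / (real k * stat.sd) * inverse (real (n choose k)) * (T \<omega> - Expec M T) \<le> z)
        = (stat.W (\<zeta> \<omega>) \<le> z)"
      using T by eventually_elim (simp only: W[symmetric])
    show "Measurable.pred M (\<lambda>\<omega>. stat.W (\<zeta> \<omega>) \<le> z)"
      by (rule measurable_compose[OF \<zeta>(1) pred])
  qed
  also have "\<dots> = measure (distr M \<Omega> \<zeta>) {u \<in> space \<Omega>. stat.W u \<le> z}"
    using pred measurable_space[OF \<zeta>(1)]
    by (subst measure_distr[OF \<zeta>(1)]) (auto simp: pred_def intro!: arg_cong[where f = "measure M"])
  finally show ?thesis
    using stat.berry_esseen[OF sd, of z] unfolding \<zeta>(2) by simp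
qed

end

text \<open>The constant is assembled from the deviation \<open>s\<close>, the number of copies and
  k before n, the probability space and the variables are introduced; the Borel version is fixed at
  that stage too.\<close>

theorem subgraph_count_berry_esseen:
  fixes \<kappa> :: "real \<times> real \<Rightarrow> real" and F :: "'v pair_pre_digraph"
  assumes \<kappa>: "graphon \<kappa>" and k: "num_nodes F = k" and pos: "sigma_gen b \<kappa> F > 0"
  shows "\<exists>C>0. \<forall>n\<ge>k. \<forall>(M :: 'w measure) X Y. indep_uniforms M n X Y \<longrightarrow>
          (let T = (\<lambda>\<omega>. T_gen b F n (adjacency \<kappa> X Y \<omega>)) in
           (SUP z. \<bar>Pr M (\<lambda>\<omega>. sqrt (real n) / (real k * sigma_gen b \<kappa> F) *
                               inverse (real (n choose k)) * (T \<omega> - Expec M T) \<le> z)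
                    - cdf std_normal_distribution z\<bar>)
           \<le> C * real n powr (- 1 / 2))"
proof -
  define s where "s = sigma_gen b \<kappa> F"
  define B where "B = real (card (copies F))"
  define r where "r = 2 * (2 * B * (real k + 1))\<^sup>2 * (real k)\<^sup>2 / s\<^sup>2"
  define C where "C = 36 * B\<^sup>2 / s\<^sup>2 + 1 + 24 * B * sqrt r / s + 2 * sqrt r"
  have s: "s > 0" using pos by (simp add: s_def)
  \<comment> \<open>The empty graph is excluded by positivity: its deviation is zero.\<close>
  have k_pos: "1 \<le> k"
    using pos sigma_gen_no_nodes[of F b \<kappa>] k by (cases "k = 0") auto
  obtain \<kappa>' where \<kappa>': "\<kappa>' \<in> borel_measurable borel" "\<And>z. \<kappa>' z \<in> {0..1}" "\<And>x y. \<kappa>' (x, y) = \<kappa>' (y, x)"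
    "AE z in unif \<Otimes>\<^sub>M unif. \<kappa> z = \<kappa>' z"
    using graphon_borel_version[OF \<kappa>] by blast
  have "0 \<le> 36 * B\<^sup>2 / s\<^sup>2" "0 \<le> 24 * B * sqrt r / s" "0 \<le> 2 * sqrt r"
    using s by (auto simp: B_def r_def)
  then have "C > 0" unfolding C_def by linarith
  moreover have "(SUP z. \<bar>Pr M (\<lambda>\<omega>. sqrt (real n) / (real k * s) * inverse (real (n choose k)) *
        (T_gen b F n (adjacency \<kappa> X Y \<omega>) - Expec M (\<lambda>\<omega>. T_gen b F n (adjacency \<kappa> X Y \<omega>))) \<le> z)
      - cdf std_normal_distribution z\<bar>) \<le> C * real n powr (- 1 / 2)"
    if n: "n \<ge> k" and ind: "indep_uniforms M n X Y" for n X Y and M :: "'w measure"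
  proof (rule cSUP_least)
    fix z
    interpret graphon_count \<kappa>' b F n
      by standard (use \<kappa>' k k_pos n in auto)
    have sd: "stat.sd = s" using sigma_gen_eq[OF \<kappa>'(4)] by (simp add: s_def)
    \<comment> \<open>With the deviation identified as \<open>s\<close>, the remainder constant
      becomes the \<open>r\<close> chosen before n.\<close>
    have rc: "stat.rem_const = r" unfolding stat.rem_const_def sd unfolding r_def B_def k ..
    have "\<bar>Pr M (\<lambda>\<omega>. sqrt (real n) / (real k * s) * inverse (real (n choose k)) *
        (T_gen b F n (adjacency \<kappa> X Y \<omega>) - Expec M (\<lambda>\<omega>. T_gen b F n (adjacency \<kappa> X Y \<omega>))) \<le> z)
      - cdf std_normal_distribution z\<bar> \<le> C / sqrt (real n)"
      using kolmogorov_distance_le[OF ind \<kappa>'(4), of z] s unfolding sd rc unfolding C_def B_def k by simp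
    also have "C / sqrt (real n) = C * real n powr (- 1 / 2)"
    proof -
      have "real n powr (- 1 / 2) = real n powr (- (1 / 2))" by (rule arg_cong) simp
      also have "\<dots> = inverse (sqrt (real n))"
        by (simp only: powr_minus powr_half_sqrt of_nat_0_le_iff)
      finally show ?thesis by (simp only: divide_inverse)
    qed
    finally show "\<bar>Pr M (\<lambda>\<omega>. sqrt (real n) / (real k * s) * inverse (real (n choose k)) *
        (T_gen b F n (adjacency \<kappa> X Y \<omega>) - Expec M (\<lambda>\<omega>. T_gen b F n (adjacency \<kappa> X Y \<omega>))) \<le> z)
      - cdf std_normal_distribution z\<bar> \<le> C * real n powr (- 1 / 2)" .
  qed simp
  ultimately show ?thesis
    unfolding s_def[symmetric] Let_def by blast
qed

theorem theorem3p1: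
  fixes \<kappa> :: "real \<times> real \<Rightarrow> real" and F :: "'v pair_pre_digraph" and k :: nat
  assumes "graphon \<kappa>" and "pair_graph F" and "num_nodes F = k"
  shows
    "(sigma1_inj \<kappa> F > 0 \<longrightarrow>
       (\<exists>C>0. \<forall>n\<ge>k. \<forall>(M :: 'w measure) X Y. indep_uniforms M n X Y \<longrightarrow>
          (let T = (\<lambda>\<omega>. T_inj F n (adjacency \<kappa> X Y \<omega>)) in
           (SUP z. \<bar>Pr M (\<lambda>\<omega>. sqrt (real n) / (real k * sigma1_inj \<kappa> F) *
                               inverse (real (n choose k)) * (T \<omega> - Expec M T) \<le> z)
                    - cdf std_normal_distribution z\<bar>)
           \<le> C * real n powr (- 1 / 2)))) \<and>
     (sigma1_ind \<kappa> F > 0 \<longrightarrow>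
       (\<exists>C>0. \<forall>n\<ge>k. \<forall>(M :: 'w measure) X Y. indep_uniforms M n X Y \<longrightarrow>
          (let T = (\<lambda>\<omega>. T_ind F n (adjacency \<kappa> X Y \<omega>)) in
           (SUP z. \<bar>Pr M (\<lambda>\<omega>. sqrt (real n) / (real k * sigma1_ind \<kappa> F) *
                               inverse (real (n choose k)) * (T \<omega> - Expec M T) \<le> z)
                    - cdf std_normal_distribution z\<bar>)
           \<le> C * real n powr (- 1 / 2))))"
  unfolding sigma1_inj_eq sigma1_ind_eq T_inj_eq T_ind_eq
  by (intro conjI impI subgraph_count_berry_esseen[OF assms(1,3)])

end
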